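(* There exist a compact Kähler manifold $X$, a compact complex submanifold $Z\subset X$ of codimension $1$ with associated holomorphic line bundle $L_Z\to X$, a holomorphic section $T\in H^0(X,\mathcal O(L_Z))$ cutting out $Z$, a smooth Hermitian metric $\mathfrak g$ for $L_Z$, a holomorphic vector bundle $E\to X$ and a smooth Hermitian metric $\mathfrak h$ for $E\to X$ such that for some $\delta>0$ $$\sup_X |T|^2_{\mathfrak g}\le 1,\qquad \sqrt{-1}\,\Theta(\mathfrak h)\ \ge_{\rm Grif}\ t\,\delta\,\sqrt{-1}\,\Theta(\mathfrak g)\otimes \mathrm{Id}_E\quad\text{for all } t\in[0,1],$$ and the restriction map $$H^0(X,\mathcal O(K_X\otimes L_Z\otimes E))\ni F\ \mapsto\ \frac{F|_Z}{dT}\in H^0(Z,\mathcal O(K_Z\otimes E|_Z))$$ fails to be surjective.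
   Context: $K_X$, $K_Z$ denote canonical bundles. $L_Z\to X$ is the line bundle associated to the smooth divisor $Z$, and "$T$ cuts out $Z$" means that the zero divisor of $T$ is $Z$ (with multiplicity one). Then $dT|_Z$ is a nowhere-vanishing section of $N_Z^*\otimes L_Z|_Z$, where $N_Z^*$ is the conormal bundle of $Z$, and the adjunction isomorphism $K_Z\cong (K_X\otimes L_Z)|_Z$ is $f\mapsto f\wedge dT$; $F|_Z/dT$ denotes the section $f$ of $K_Z\otimes E|_Z$ with $f\wedge dT=F|_Z$. $\Theta(\cdot)$ denotes the curvature of the Chern connection. For $\mathrm{Hom}(E,E)$-valued $(1,1)$-forms $A,B$ that are $\mathfrak h$-Hermitian, $A\ge_{\rm Grif}B$ means that the Hermitian form on $T^{1,0}_X\otimes E$ determined by $(\xi\otimes v,\eta\otimes w)\mapsto \mathfrak h((A-B)_{\xi\bar\eta}v,w)$ is nonnegative on all tensors of rank one $\xi\otimes v$. *)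

theory Defs
  imports
    "HOL-Analysis.Analysis"
    "Jordan_Normal_Form.Determinant"
    "Jordan_Normal_Form.Gauss_Jordan_Elimination"
begin

no_notation vec_nth (infixl "$" 90)
no_notation inner (infix "\<bullet>" 70)

section \<open>Functions of several complex variables\<close>

text \<open>
  Points of \<open>C^n\<close> are sequences that vanish from position \<open>n\<close> on (the convention of
  \<^const>\<open>Euclidean_space\<close>), so that the dimension is a term and \<open>C^(n-1) \<subseteq> C^n\<close> is the
  hyperplane on which coordinate \<open>n-1\<close> vanishes.
\<close>

definition cspace :: "nat \<Rightarrow> (nat \<Rightarrow> complex) set" where
  "cspace n = {x. \<forall>i\<ge>n. x i = 0}"

text \<open>On an open subset of \<open>C^n\<close>: continuous and holomorphic in each variable separately.\<close>

definition holo_on :: "nat \<Rightarrow> (nat \<Rightarrow> complex) set \<Rightarrow> ((nat \<Rightarrow> complex) \<Rightarrow> complex) \<Rightarrow> bool" where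
  "holo_on n S f \<longleftrightarrow> continuous_on S f \<and>
     (\<forall>x\<in>S. \<forall>i<n. (\<lambda>z. f (x(i := z))) field_differentiable (at (x i)))"

definition cpartial :: "nat \<Rightarrow> ((nat \<Rightarrow> complex) \<Rightarrow> complex) \<Rightarrow> (nat \<Rightarrow> complex) \<Rightarrow> complex" where
  "cpartial i f x = deriv (\<lambda>z. f (x(i := z))) (x i)"

text \<open>
  Real partial derivative in the direction \<open>u\<close> of the \<open>i\<close>-th coordinate line; \<open>u = 1\<close> and
  \<open>u = \<i>\<close> give the derivatives with respect to the real and imaginary part of \<open>z\<^sub>i\<close>.
\<close>

definition rpartial ::
    "complex \<Rightarrow> nat \<Rightarrow> ((nat \<Rightarrow> complex) \<Rightarrow> complex) \<Rightarrow> (nat \<Rightarrow> complex) \<Rightarrow> complex" where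
  "rpartial u i f x =
     vector_derivative (\<lambda>t::real. f (x(i := x i + of_real t * u))) (at 0)"

primrec Ck_on :: "nat \<Rightarrow> nat \<Rightarrow> (nat \<Rightarrow> complex) set \<Rightarrow> ((nat \<Rightarrow> complex) \<Rightarrow> complex) \<Rightarrow> bool" where
  "Ck_on n 0 S f \<longleftrightarrow> continuous_on S f"
| "Ck_on n (Suc k) S f \<longleftrightarrow> continuous_on S f \<and>
     (\<forall>i<n. \<forall>u\<in>{1, \<i>}.
        (\<forall>x\<in>S. (\<lambda>t::real. f (x(i := x i + of_real t * u))) differentiable (at 0)) \<and>
        Ck_on n k S (rpartial u i f))"

definition smooth_fun_on :: "nat \<Rightarrow> (nat \<Rightarrow> complex) set \<Rightarrow> ((nat \<Rightarrow> complex) \<Rightarrow> complex) \<Rightarrow> bool" where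
  "smooth_fun_on n S f \<longleftrightarrow> (\<forall>k. Ck_on n k S f)"

text \<open>Wirtinger derivatives with respect to \<open>z\<^sub>i\<close> and to its conjugate.\<close>

definition wirt :: "nat \<Rightarrow> ((nat \<Rightarrow> complex) \<Rightarrow> complex) \<Rightarrow> (nat \<Rightarrow> complex) \<Rightarrow> complex" where
  "wirt i f x = (rpartial 1 i f x - \<i> * rpartial \<i> i f x) / 2"

definition wirt_bar :: "nat \<Rightarrow> ((nat \<Rightarrow> complex) \<Rightarrow> complex) \<Rightarrow> (nat \<Rightarrow> complex) \<Rightarrow> complex" where
  "wirt_bar i f x = (rpartial 1 i f x + \<i> * rpartial \<i> i f x) / 2"


section \<open>Complex manifolds\<close>

type_synonym 'p chart = "'p set \<times> ('p \<Rightarrow> nat \<Rightarrow> complex)"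

record 'p cmanifold =
  mtop :: "'p topology"
  mdim :: nat
  atlas :: "'p chart set"

definition in_chart :: "'p chart \<Rightarrow> ('p \<Rightarrow> 'b) \<Rightarrow> (nat \<Rightarrow> complex) \<Rightarrow> 'b" where
  "in_chart c f = (\<lambda>x. f (inv_into (fst c) (snd c) x))"

definition is_chart :: "'p topology \<Rightarrow> nat \<Rightarrow> 'p chart \<Rightarrow> bool" where
  "is_chart X n c \<longleftrightarrow>
     openin X (fst c) \<and> openin (top_of_set (cspace n)) (snd c ` fst c) \<and>
     homeomorphic_map (subtopology X (fst c)) (top_of_set (snd c ` fst c)) (snd c)"

definition compatible :: "nat \<Rightarrow> 'p chart \<Rightarrow> 'p chart \<Rightarrow> bool" where
  "compatible n c d \<longleftrightarrow>
     (\<forall>a<n. holo_on n (snd c ` (fst c \<inter> fst d)) (in_chart c (\<lambda>p. snd d p a)))"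

definition complex_manifold :: "'p cmanifold \<Rightarrow> bool" where
  "complex_manifold M \<longleftrightarrow>
     Hausdorff_space (mtop M) \<and> second_countable (mtop M) \<and>
     (\<Union>c\<in>atlas M. fst c) = topspace (mtop M) \<and>
     (\<forall>c\<in>atlas M. is_chart (mtop M) (mdim M) c) \<and>
     (\<forall>c\<in>atlas M. \<forall>d\<in>atlas M. compatible (mdim M) c d)"

text \<open>The maximal atlas.\<close>

definition holo_charts :: "'p cmanifold \<Rightarrow> 'p chart set" where
  "holo_charts M = {c. is_chart (mtop M) (mdim M) c \<and>
     (\<forall>d\<in>atlas M. compatible (mdim M) c d \<and> compatible (mdim M) d c)}"

definition holo_fun :: "'p cmanifold \<Rightarrow> 'p set \<Rightarrow> ('p \<Rightarrow> complex) \<Rightarrow> bool" where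
  "holo_fun M W f \<longleftrightarrow>
     (\<forall>c\<in>atlas M. holo_on (mdim M) (snd c ` (fst c \<inter> W)) (in_chart c f))"

definition smooth_fun :: "'p cmanifold \<Rightarrow> 'p set \<Rightarrow> ('p \<Rightarrow> complex) \<Rightarrow> bool" where
  "smooth_fun M W f \<longleftrightarrow>
     (\<forall>c\<in>atlas M. smooth_fun_on (mdim M) (snd c ` (fst c \<inter> W)) (in_chart c f))"

text \<open>The matrix of the partial derivatives of the coordinates of \<open>c\<close> by those of \<open>d\<close>.\<close>

definition jacobian :: "nat \<Rightarrow> 'p chart \<Rightarrow> 'p chart \<Rightarrow> 'p \<Rightarrow> complex mat" where
  "jacobian n c d p =
     mat n n (\<lambda>(a, b). cpartial b (in_chart d (\<lambda>q. snd c q a)) (snd d p))"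


section \<open>Holomorphic vector bundles\<close>

text \<open>
  A bundle is given by local holomorphic frames over the members of an open cover, together with
  the transition matrices \<open>g\<^sub>i\<^sub>j\<close>. Components of a vector in the frames \<open>i\<close> and \<open>j\<close> are related by
  \<open>s\<^sub>i = g\<^sub>i\<^sub>j s\<^sub>j\<close>.
\<close>

record ('i, 'p) vbundle =
  vrank :: nat
  vidx :: "'i set"
  vcov :: "'i \<Rightarrow> 'p set"
  vtrans :: "'i \<Rightarrow> 'i \<Rightarrow> 'p \<Rightarrow> complex mat"

definition holomorphic_vector_bundle :: "'p cmanifold \<Rightarrow> ('i, 'p) vbundle \<Rightarrow> bool" where
  "holomorphic_vector_bundle M B \<longleftrightarrow>
     (\<forall>i\<in>vidx B. openin (mtop M) (vcov B i)) \<and>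
     (\<Union>i\<in>vidx B. vcov B i) = topspace (mtop M) \<and>
     (\<forall>i\<in>vidx B. \<forall>j\<in>vidx B.
        (\<forall>p\<in>vcov B i \<inter> vcov B j. vtrans B i j p \<in> carrier_mat (vrank B) (vrank B)) \<and>
        (\<forall>a<vrank B. \<forall>b<vrank B.
           holo_fun M (vcov B i \<inter> vcov B j) (\<lambda>p. vtrans B i j p $$ (a, b)))) \<and>
     (\<forall>i\<in>vidx B. \<forall>p\<in>vcov B i. vtrans B i i p = 1\<^sub>m (vrank B)) \<and>
     (\<forall>i\<in>vidx B. \<forall>j\<in>vidx B. \<forall>k\<in>vidx B. \<forall>p\<in>vcov B i \<inter> vcov B j \<inter> vcov B k.
        vtrans B i j p * vtrans B j k p = vtrans B i k p)"

definition holo_sections :: "'p cmanifold \<Rightarrow> ('i, 'p) vbundle \<Rightarrow> ('i \<Rightarrow> 'p \<Rightarrow> complex vec) set" where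
  "holo_sections M B = {s.
     (\<forall>i\<in>vidx B. \<forall>p\<in>vcov B i. s i p \<in> carrier_vec (vrank B)) \<and>
     (\<forall>i\<in>vidx B. \<forall>a<vrank B. holo_fun M (vcov B i) (\<lambda>p. s i p $ a)) \<and>
     (\<forall>i\<in>vidx B. \<forall>j\<in>vidx B. \<forall>p\<in>vcov B i \<inter> vcov B j. s i p = vtrans B i j p *\<^sub>v s j p)}"

definition restrict_bundle :: "'p set \<Rightarrow> ('i, 'p) vbundle \<Rightarrow> ('i, 'p) vbundle" where
  "restrict_bundle Z B = B\<lparr>vcov := (\<lambda>i. vcov B i \<inter> Z)\<rparr>"

definition line_tensor :: "('i, 'p) vbundle \<Rightarrow> ('j, 'p) vbundle \<Rightarrow> ('i \<times> 'j, 'p) vbundle" where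
  "line_tensor L E =
     \<lparr>vrank = vrank E,
      vidx = vidx L \<times> vidx E,
      vcov = (\<lambda>(i, j). vcov L i \<inter> vcov E j),
      vtrans = (\<lambda>(i, j) (i', j') p. (vtrans L i i' p $$ (0, 0)) \<cdot>\<^sub>m vtrans E j j' p)\<rparr>"

definition tangent_bundle :: "'p cmanifold \<Rightarrow> ('p chart, 'p) vbundle" where
  "tangent_bundle M =
     \<lparr>vrank = mdim M, vidx = atlas M, vcov = fst, vtrans = jacobian (mdim M)\<rparr>"

text \<open>
  In the chart \<open>c\<close> with coordinates \<open>z\<close> the frame is \<open>dz\<^sub>0 \<and> \<dots> \<and> dz\<^sub>n\<^sub>-\<^sub>1\<close>, whence the transition
  function from \<open>d\<close> to \<open>c\<close> is the Jacobian determinant of the coordinates of \<open>d\<close> by those of \<open>c\<close>.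
  Frames are taken over the maximal atlas, so that the coefficient of a canonical form is
  available in the charts adapted to a hypersurface.
\<close>

definition canonical_bundle :: "'p cmanifold \<Rightarrow> ('p chart, 'p) vbundle" where
  "canonical_bundle M =
     \<lparr>vrank = 1, vidx = holo_charts M, vcov = fst,
      vtrans = (\<lambda>c d p. mat 1 1 (\<lambda>_. det (jacobian (mdim M) d c p)))\<rparr>"


section \<open>Hermitian metrics and curvature\<close>

text \<open>
  In a frame \<open>e\<close> a Hermitian metric \<open>h\<close> has the matrix \<open>H\<close> with \<open>(a, b)\<close> entry
  \<open>h(e\<^sub>b, e\<^sub>a)\<close>; \<open>herm H v w\<close> is \<open>h(v, w)\<close>, linear in \<open>v\<close> and antilinear in \<open>w\<close>.
\<close>

definition herm :: "complex mat \<Rightarrow> complex vec \<Rightarrow> complex vec \<Rightarrow> complex" where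
  "herm H v w = (H *\<^sub>v v) \<bullet>c w"

definition hermitian_metric ::
    "'p cmanifold \<Rightarrow> ('i, 'p) vbundle \<Rightarrow> ('i \<Rightarrow> 'p \<Rightarrow> complex mat) \<Rightarrow> bool" where
  "hermitian_metric M B h \<longleftrightarrow>
     (\<forall>i\<in>vidx B. \<forall>p\<in>vcov B i. h i p \<in> carrier_mat (vrank B) (vrank B) \<and>
        (\<forall>v\<in>carrier_vec (vrank B). \<forall>w\<in>carrier_vec (vrank B).
           herm (h i p) w v = cnj (herm (h i p) v w)) \<and>
        (\<forall>v\<in>carrier_vec (vrank B). v \<noteq> 0\<^sub>v (vrank B) \<longrightarrow> 0 < Re (herm (h i p) v v))) \<and>
     (\<forall>i\<in>vidx B. \<forall>a<vrank B. \<forall>b<vrank B.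
        smooth_fun M (vcov B i) (\<lambda>p. h i p $$ (a, b))) \<and>
     (\<forall>i\<in>vidx B. \<forall>j\<in>vidx B. \<forall>p\<in>vcov B i \<inter> vcov B j.
        \<forall>v\<in>carrier_vec (vrank B). \<forall>w\<in>carrier_vec (vrank B).
          herm (h i p) (vtrans B i j p *\<^sub>v v) (vtrans B i j p *\<^sub>v w) = herm (h j p) v w)"

text \<open>
  The fundamental form of \<open>h\<close> is \<open>\<i> \<Sum> h(\<partial>\<^sub>k, \<partial>\<^sub>l) dz\<^sub>k \<and> d(cnj z\<^sub>l)\<close>, with \<open>h(\<partial>\<^sub>k, \<partial>\<^sub>l)\<close> the entry
  \<open>(l, k)\<close> of the matrix. It is real, hence closed iff it is annihilated by \<open>\<partial>\<close>.
\<close>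

definition kaehler_metric :: "'p cmanifold \<Rightarrow> ('p chart \<Rightarrow> 'p \<Rightarrow> complex mat) \<Rightarrow> bool" where
  "kaehler_metric M h \<longleftrightarrow> hermitian_metric M (tangent_bundle M) h \<and>
     (\<forall>c\<in>atlas M. \<forall>p\<in>fst c. \<forall>k<mdim M. \<forall>l<mdim M. \<forall>m<mdim M.
        wirt m (in_chart c (\<lambda>q. h c q $$ (l, k))) (snd c p) =
        wirt k (in_chart c (\<lambda>q. h c q $$ (l, m))) (snd c p))"

definition compact_kaehler_manifold :: "'p cmanifold \<Rightarrow> bool" where
  "compact_kaehler_manifold M \<longleftrightarrow>
     complex_manifold M \<and> compact_space (mtop M) \<and> connected_space (mtop M) \<and>
     (\<exists>h. kaehler_metric M h)"

text \<open>
  For the matrix \<open>H\<close> of a metric in a holomorphic frame, as a function of the coordinates, the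
  Chern connection has the connection matrix \<open>\<theta> = H\<^sup>-\<^sup>1 \<partial>H\<close> and curvature
  \<open>\<Theta> = dbar \<theta>\<close>. The functions below are the coefficients of \<open>dz\<^sub>k\<close> in \<open>\<theta>\<close> and of \<open>dz\<^sub>k \<and> d(cnj z\<^sub>l)\<close> in
  \<open>\<Theta>\<close>; the sign in the latter comes from \<open>d(cnj z\<^sub>l) \<and> dz\<^sub>k = - dz\<^sub>k \<and> d(cnj z\<^sub>l)\<close>.
\<close>

definition chern_connection ::
    "nat \<Rightarrow> ((nat \<Rightarrow> complex) \<Rightarrow> complex mat) \<Rightarrow> nat \<Rightarrow> (nat \<Rightarrow> complex) \<Rightarrow> complex mat" where
  "chern_connection r H k x =
     the (mat_inverse (H x)) * mat r r (\<lambda>(a, b). wirt k (\<lambda>y. H y $$ (a, b)) x)"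

definition chern_curvature ::
    "nat \<Rightarrow> ((nat \<Rightarrow> complex) \<Rightarrow> complex mat) \<Rightarrow> nat \<Rightarrow> nat \<Rightarrow> (nat \<Rightarrow> complex) \<Rightarrow> complex mat" where
  "chern_curvature r H k l x =
     mat r r (\<lambda>(a, b). - wirt_bar l (\<lambda>y. chern_connection r H k y $$ (a, b)) x)"

text \<open>The curvature coefficients at \<open>p\<close>, in the chart \<open>c\<close> and the frame \<open>i\<close>.\<close>

definition curvature_at ::
    "('i, 'p) vbundle \<Rightarrow> ('i \<Rightarrow> 'p \<Rightarrow> complex mat) \<Rightarrow> 'p chart \<Rightarrow> 'i \<Rightarrow> 'p
      \<Rightarrow> nat \<Rightarrow> nat \<Rightarrow> complex mat" where
  "curvature_at B h c i p k l = chern_curvature (vrank B) (in_chart c (h i)) k l (snd c p)"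

text \<open>
  At a point, \<open>A k l\<close> and \<open>B k l\<close> are the coefficients of the endomorphism valued forms
  \<open>\<i> \<Sum> A\<^sub>k\<^sub>l dz\<^sub>k \<and> d(cnj z\<^sub>l)\<close> and \<open>\<i> \<Sum> B\<^sub>k\<^sub>l dz\<^sub>k \<and> d(cnj z\<^sub>l)\<close>; the factor \<open>\<i>\<close> is absorbed in
  the usual passage from real (1,1)-forms to Hermitian forms. For \<open>h\<close>-Hermitian forms the sum is
  real.
\<close>

definition griffiths_ge ::
    "nat \<Rightarrow> nat \<Rightarrow> complex mat \<Rightarrow> (nat \<Rightarrow> nat \<Rightarrow> complex mat) \<Rightarrow> (nat \<Rightarrow> nat \<Rightarrow> complex mat) \<Rightarrow> bool"
  where
  "griffiths_ge n r H A B \<longleftrightarrow>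
     (\<forall>\<xi>::nat \<Rightarrow> complex. \<forall>v\<in>carrier_vec r.
        0 \<le> Re (\<Sum>k<n. \<Sum>l<n. \<xi> k * cnj (\<xi> l) * herm H ((A k l - B k l) *\<^sub>v v) v))"

text \<open>
  \<open>\<i> \<Theta>(h) \<ge> s \<i> \<Theta>(g) \<otimes> Id\<close> in the sense of Griffiths, for metrics \<open>h\<close> on \<open>E\<close> and \<open>g\<close> on the line
  bundle \<open>L\<close>.
\<close>

definition griffiths_curvature_ge ::
    "'p cmanifold \<Rightarrow> ('i, 'p) vbundle \<Rightarrow> ('i \<Rightarrow> 'p \<Rightarrow> complex mat) \<Rightarrow>
     real \<Rightarrow> ('j, 'p) vbundle \<Rightarrow> ('j \<Rightarrow> 'p \<Rightarrow> complex mat) \<Rightarrow> bool" where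
  "griffiths_curvature_ge M E h s L g \<longleftrightarrow>
     (\<forall>c\<in>atlas M. \<forall>i\<in>vidx E. \<forall>j\<in>vidx L. \<forall>p\<in>fst c \<inter> vcov E i \<inter> vcov L j.
        griffiths_ge (mdim M) (vrank E) (h i p)
          (curvature_at E h c i p)
          (\<lambda>k l. (of_real s * curvature_at L g c j p k l $$ (0, 0)) \<cdot>\<^sub>m 1\<^sub>m (vrank E)))"


section \<open>Hypersurfaces\<close>

definition adapted_charts :: "'p cmanifold \<Rightarrow> 'p set \<Rightarrow> 'p chart set" where
  "adapted_charts M Z =
     {c \<in> holo_charts M. \<forall>p\<in>fst c. p \<in> Z \<longleftrightarrow> snd c p (mdim M - 1) = 0}"

definition compact_hypersurface :: "'p cmanifold \<Rightarrow> 'p set \<Rightarrow> bool" where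
  "compact_hypersurface M Z \<longleftrightarrow>
     1 \<le> mdim M \<and> compactin (mtop M) Z \<and> (\<forall>p\<in>Z. \<exists>c\<in>adapted_charts M Z. p \<in> fst c)"

text \<open>
  On \<open>Z\<close> the last coordinate of an adapted chart vanishes, so that the same map is a chart of \<open>Z\<close>
  with values in \<open>C^(n-1)\<close>.
\<close>

definition hypersurface :: "'p cmanifold \<Rightarrow> 'p set \<Rightarrow> 'p cmanifold" where
  "hypersurface M Z =
     \<lparr>mtop = subtopology (mtop M) Z, mdim = mdim M - 1,
      atlas = (\<lambda>c. (fst c \<inter> Z, snd c)) ` adapted_charts M Z\<rparr>"

text \<open>
  The zero divisor of the holomorphic function \<open>f\<close> on the open set \<open>W\<close> is \<open>Z \<inter> W\<close> with
  multiplicity one: near each point of \<open>Z\<close>, \<open>f\<close> is a unit times a coordinate defining \<open>Z\<close>.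
\<close>

definition local_equation :: "'p cmanifold \<Rightarrow> 'p set \<Rightarrow> 'p set \<Rightarrow> ('p \<Rightarrow> complex) \<Rightarrow> bool" where
  "local_equation M Z W f \<longleftrightarrow> holo_fun M W f \<and> (\<forall>p\<in>W. f p = 0 \<longleftrightarrow> p \<in> Z) \<and>
     (\<forall>p\<in>Z \<inter> W. \<exists>c\<in>adapted_charts M Z. \<exists>V u.
        openin (mtop M) V \<and> p \<in> V \<and> V \<subseteq> fst c \<inter> W \<and> holo_fun M V u \<and>
        (\<forall>q\<in>V. u q \<noteq> 0 \<and> f q = u q * snd c q (mdim M - 1)))"

text \<open>\<open>L\<close> is (up to isomorphism) the line bundle \<open>O(Z)\<close> associated to \<open>Z\<close>.\<close>

definition line_bundle_of_divisor :: "'p cmanifold \<Rightarrow> 'p set \<Rightarrow> ('j, 'p) vbundle \<Rightarrow> bool" where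
  "line_bundle_of_divisor M Z L \<longleftrightarrow> holomorphic_vector_bundle M L \<and> vrank L = 1 \<and>
     (\<exists>f. (\<forall>j\<in>vidx L. local_equation M Z (vcov L j) (f j)) \<and>
          (\<forall>j\<in>vidx L. \<forall>k\<in>vidx L. \<forall>p\<in>vcov L j \<inter> vcov L k - Z.
             vtrans L j k p $$ (0, 0) = f j p / f k p))"

definition cuts_out ::
    "'p cmanifold \<Rightarrow> ('j, 'p) vbundle \<Rightarrow> ('j \<Rightarrow> 'p \<Rightarrow> complex vec) \<Rightarrow> 'p set \<Rightarrow> bool" where
  "cuts_out M L T Z \<longleftrightarrow> (\<forall>j\<in>vidx L. local_equation M Z (vcov L j) (\<lambda>p. T j p $ 0))"

text \<open>
  \<open>F|\<^sub>Z = f \<and> dT\<close>, i.e. \<open>f = F|\<^sub>Z / dT\<close>, for a section \<open>F\<close> of the bundle \<open>K\<^sub>X \<otimes> L \<otimes> E\<close> and a section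
  \<open>f\<close> of \<open>K\<^sub>Z \<otimes> E|\<^sub>Z\<close>. In an adapted chart, \<open>dT|\<^sub>Z = (\<partial>T/\<partial>z\<^sub>n\<^sub>-\<^sub>1) dz\<^sub>n\<^sub>-\<^sub>1\<close>, so the coefficient of
  \<open>f dz\<^sub>0 \<and> \<dots> \<and> dz\<^sub>n\<^sub>-\<^sub>2 \<and> dT\<close> with respect to \<open>dz\<^sub>0 \<and> \<dots> \<and> dz\<^sub>n\<^sub>-\<^sub>1\<close> is \<open>(\<partial>T/\<partial>z\<^sub>n\<^sub>-\<^sub>1) f\<close>.
\<close>

definition is_restriction_over_dT ::
    "'p cmanifold \<Rightarrow> 'p set \<Rightarrow> ('j, 'p) vbundle \<Rightarrow> ('j \<Rightarrow> 'p \<Rightarrow> complex vec) \<Rightarrow> ('i, 'p) vbundle \<Rightarrow>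
     ('p chart \<times> 'j \<times> 'i \<Rightarrow> 'p \<Rightarrow> complex vec) \<Rightarrow> ('p chart \<times> 'i \<Rightarrow> 'p \<Rightarrow> complex vec) \<Rightarrow> bool" where
  "is_restriction_over_dT M Z L T E F f \<longleftrightarrow>
     (\<forall>c\<in>adapted_charts M Z. \<forall>j\<in>vidx L. \<forall>i\<in>vidx E. \<forall>p\<in>Z \<inter> fst c \<inter> vcov L j \<inter> vcov E i.
        F (c, j, i) p =
          cpartial (mdim M - 1) (in_chart c (\<lambda>q. T j q $ 0)) (snd c p) \<cdot>\<^sub>v
          f ((fst c \<inter> Z, snd c), i) p)"

end

theory Submission
  imports Defs "HOL-Complex_Analysis.Cauchy_Integral_Formula"
begin

no_notation vec_nth (infixl "$" 90)
no_notation inner (infix "\<bullet>" 70)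

text \<open>
  The cokernel of the restriction map embeds into \<open>H\<^sup>1(X, K\<^sub>X \<otimes> E)\<close>, by the exact sequence
  \<open>0 \<rightarrow> K\<^sub>X \<otimes> E \<rightarrow> K\<^sub>X \<otimes> L \<otimes> E \<rightarrow> K\<^sub>Z \<otimes> E|\<^sub>Z \<rightarrow> 0\<close>. This cohomology vanishes when \<open>E\<close> is positive
  in the sense of Nakano, but not under positivity in the sense of Griffiths: the tangent bundle of
  the projective plane is Griffiths positive; it is \<open>\<Omega>(3)\<close>, with \<open>\<Omega>\<close> the cotangent bundle, so that
  \<open>H\<^sup>1(X, K\<^sub>X \<otimes> E) = H\<^sup>1(X, \<Omega>)\<close>, which has dimension one. The counterexample is therefore the plane
  \<open>X\<close> with \<open>E = \<Omega>(3)\<close>, a line \<open>Z\<close>, the hyperplane bundle \<open>L = O(1)\<close> with the section \<open>Z\<^sub>2\<close>, the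
  Fubini-Study metrics, and \<open>\<delta> = 1\<close>.

  All of it is made explicit in homogeneous coordinates. The bundle \<open>\<Omega>(1)\<close> consists of the vectors
  \<open>\<xi> \<in> C\<^sup>3\<close> with \<open>\<Sum> Z\<^sub>a \<xi>\<^sub>a = 0\<close>, and \<open>\<Omega>(3)\<close> carries the metric \<open>|\<xi>|\<^sup>2 / |Z|\<^sup>4\<close>. In the frame of an
  affine patch its matrix is, up to a scalar factor, a rank one perturbation of the identity by
  holomorphic functions, which makes the Chern connection and its curvature short rational expressions
  (\<open>connection_perp_matrix\<close>, \<open>curvature_perp_matrix\<close>). On a tensor of rank one the curvature
  exceeds that of \<open>O(1)\<close> by an expression that Lagrange's identity for vectors of \<open>C\<^sup>3\<close> turns into a
  square (\<open>lagrange_identity_perp\<close>, \<open>griffiths_twisted_cotangent\<close>).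

  As for the restriction map, \<open>K\<^sub>X \<otimes> L \<otimes> E = \<Omega>(1)\<close>. A section of it is a vector \<open>\<xi>\<close> of global
  holomorphic functions, which are constant, and \<open>\<Sum> Z\<^sub>a \<xi>\<^sub>a = 0\<close> for all \<open>Z\<close> leaves only zero; it is
  enough to apply Liouville's theorem on one line transversal to the line \<open>Z\<^sub>2 = 0\<close>
  (\<open>extension_bundle_section_vanishes\<close>). On the line \<open>Z\<^sub>2 = 0\<close> itself, however, the constant vector \<open>(0, 0, 1)\<close> is admissible, and it gives a section
  of \<open>K\<^sub>Z \<otimes> E|\<^sub>Z\<close> without zeros (\<open>conormal_section_holomorphic\<close>).
\<close>


section \<open>Calculus along coordinate lines\<close>

lemma continuous_on_fun_upd [continuous_intros]:
  fixes x :: "'a \<Rightarrow> 'b :: topological_space"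
  assumes "continuous_on A g"
  shows "continuous_on A (\<lambda>t. x(i := g t))"
proof (rule continuous_on_coordinatewise_then_product)
  fix k
  show "continuous_on A (\<lambda>t. (x(i := g t)) k)"
    using assms by (cases "k = i") auto
qed

lemma continuous_on_coord [continuous_intros]:
  fixes S :: "('a \<Rightarrow> 'b :: topological_space) set"
  shows "continuous_on S (\<lambda>x. x j)"
  by (rule continuous_on_subset[OF continuous_on_product_coordinates]) simp

lemma open_coordinate_line:
  assumes S: "openin (top_of_set (cspace n)) S" and x: "x \<in> S" and i: "i < n"
  shows "open {z. x(i := z) \<in> S}"
proof -
  have sub: "(\<lambda>z. x(i := z)) ` UNIV \<subseteq> cspace n"
    using S x i openin_subset[OF S] by (auto simp: cspace_def)
  have "continuous_on UNIV (\<lambda>z. x(i := z))"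
    by (intro continuous_intros)
  then have "openin (top_of_set UNIV) (UNIV \<inter> (\<lambda>z. x(i := z)) -` S)"
    using S sub by (intro continuous_openin_preimage) auto
  then show ?thesis
    by (simp add: vimage_def)
qed

lemma eventually_coordinate_line:
  assumes "openin (top_of_set (cspace n)) S" "x \<in> S" "i < n"
  shows "\<forall>\<^sub>F z in nhds (x i). x(i := z) \<in> S"
  using eventually_nhds_in_open[OF open_coordinate_line[OF assms], of "x i"] assms(2) by simp

lemma eventually_real_line:
  assumes "openin (top_of_set (cspace n)) S" "x \<in> S" "i < n"
  shows "\<forall>\<^sub>F t in nhds (0::real). x(i := x i + of_real t * u) \<in> S"
proof -
  have "isCont (\<lambda>t::real. x i + of_real t * u) 0"
    by (intro continuous_intros)
  then have "filterlim (\<lambda>t::real. x i + of_real t * u) (nhds (x i)) (nhds 0)"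
    using tendsto_at_iff_tendsto_nhds[of "\<lambda>t::real. x i + of_real t * u" 0]
    by (simp add: isCont_def)
  from filterlim_iff[THEN iffD1, OF this, rule_format, OF eventually_coordinate_line[OF assms]]
  show ?thesis .
qed

text \<open>
  \<open>a\<close> and \<open>b\<close> are the two Wirtinger derivatives of \<open>f\<close>. Asking for real differentiability along the
  whole complex coordinate line, and not only along its two real axes, makes the product and
  quotient rules instances of those for \<^const>\<open>has_derivative\<close>.
\<close>

definition has_wirt ::
    "nat \<Rightarrow> ((nat \<Rightarrow> complex) \<Rightarrow> complex) \<Rightarrow> complex \<Rightarrow> complex \<Rightarrow> (nat \<Rightarrow> complex) \<Rightarrow> bool" where
  "has_wirt i f a b x \<longleftrightarrow>
     ((\<lambda>z. f (x(i := z))) has_derivative (\<lambda>u. a * u + b * cnj u)) (at (x i))"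

lemma has_wirt_rpartial:
  assumes "has_wirt i f a b x"
  shows "rpartial u i f x = a * u + b * cnj u"
proof -
  have "((\<lambda>t::real. x i + of_real t * u) has_derivative (\<lambda>t. of_real t * u)) (at 0)"
    by (auto intro!: derivative_eq_intros)
  moreover have "((\<lambda>z. f (x(i := z))) has_derivative (\<lambda>u. a * u + b * cnj u))
      (at (x i + of_real 0 * u))"
    using assms by (simp add: has_wirt_def)
  ultimately have "((\<lambda>z. f (x(i := z))) \<circ> (\<lambda>t::real. x i + of_real t * u) has_derivative
      (\<lambda>u. a * u + b * cnj u) \<circ> (\<lambda>t. of_real t * u)) (at 0)"
    by (rule diff_chain_at)
  then have "((\<lambda>t::real. f (x(i := x i + of_real t * u))) has_vector_derivative
      a * u + b * cnj u) (at 0)"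
    by (simp add: has_vector_derivative_def o_def scaleR_conv_of_real algebra_simps)
  then show ?thesis
    unfolding rpartial_def by (rule vector_derivative_at)
qed

lemma has_wirt_imp:
  assumes "has_wirt i f a b x"
  shows "wirt i f x = a" "wirt_bar i f x = b"
  by (simp_all add: wirt_def wirt_bar_def has_wirt_rpartial[OF assms] algebra_simps)

lemma has_wirtI:
  assumes "((\<lambda>z. f (x(i := z))) has_derivative D) (at (x i))"
    and "\<And>u. D u = a * u + b * cnj u"
  shows "has_wirt i f a b x"
proof -
  have "D = (\<lambda>u. a * u + b * cnj u)"
    using assms(2) by (rule ext)
  with assms(1) show ?thesis
    by (simp only: has_wirt_def)
qed

lemma has_wirt_const: "has_wirt i (\<lambda>x. c) 0 0 x"
  by (simp add: has_wirt_def)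

lemma has_wirt_add:
  assumes "has_wirt i f a b x" "has_wirt i g c d x"
  shows "has_wirt i (\<lambda>x. f x + g x) (a + c) (b + d) x"
  by (rule has_wirtI, rule has_derivative_add[OF assms[unfolded has_wirt_def]])
    (simp add: algebra_simps)

lemma has_wirt_diff:
  assumes "has_wirt i f a b x" "has_wirt i g c d x"
  shows "has_wirt i (\<lambda>x. f x - g x) (a - c) (b - d) x"
  by (rule has_wirtI, rule has_derivative_diff[OF assms[unfolded has_wirt_def]])
    (simp add: algebra_simps)

lemma has_wirt_mult:
  assumes "has_wirt i f a b x" "has_wirt i g c d x"
  shows "has_wirt i (\<lambda>x. f x * g x) (a * g x + f x * c) (b * g x + f x * d) x"
proof (rule has_wirtI)
  show "((\<lambda>z. f (x(i := z)) * g (x(i := z))) has_derivative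
      (\<lambda>u. f (x(i := x i)) * (c * u + d * cnj u) + (a * u + b * cnj u) * g (x(i := x i)))) (at (x i))"
    by (rule has_derivative_mult) (rule assms[unfolded has_wirt_def])+
  show "f (x(i := x i)) * (c * u + d * cnj u) + (a * u + b * cnj u) * g (x(i := x i)) =
      (a * g x + f x * c) * u + (b * g x + f x * d) * cnj u" for u
    by (simp only: fun_upd_triv distrib_left distrib_right mult_ac add_ac)
qed

lemma has_wirt_inverse:
  assumes "has_wirt i f a b x" "f x \<noteq> 0"
  shows "has_wirt i (\<lambda>x. inverse (f x)) (- a / (f x)\<^sup>2) (- b / (f x)\<^sup>2) x"
proof (rule has_wirtI)
  show "((\<lambda>z. inverse (f (x(i := z)))) has_derivative
     (\<lambda>h. - (inverse (f (x(i := x i))) * (a * h + b * cnj h) * inverse (f (x(i := x i)))))) (at (x i))"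
    by (rule Deriv.has_derivative_inverse) (use assms in \<open>simp_all add: has_wirt_def\<close>)
  show "- (inverse (f (x(i := x i))) * (a * u + b * cnj u) * inverse (f (x(i := x i)))) =
      - a / (f x)\<^sup>2 * u + - b / (f x)\<^sup>2 * cnj u" for u
    using assms(2) by (simp add: field_simps power2_eq_square)
qed

lemma has_wirt_divide:
  assumes "has_wirt i f a b x" "has_wirt i g c d x" "g x \<noteq> 0"
  shows "has_wirt i (\<lambda>x. f x / g x)
    ((a * g x - f x * c) / (g x)\<^sup>2) ((b * g x - f x * d) / (g x)\<^sup>2) x"
  using has_wirt_mult[OF assms(1) has_wirt_inverse[OF assms(2,3)]] assms(3)
  by (simp add: divide_inverse algebra_simps power2_eq_square)

lemma has_wirt_cnj:
  assumes "has_wirt i f a b x"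
  shows "has_wirt i (\<lambda>x. cnj (f x)) (cnj b) (cnj a) x"
  by (rule has_wirtI, rule has_derivative_cnj[OF assms[unfolded has_wirt_def]]) simp

lemma has_wirt_sum:
  assumes "\<And>e. e \<in> A \<Longrightarrow> has_wirt i (f e) (a e) (b e) x"
  shows "has_wirt i (\<lambda>x. \<Sum>e\<in>A. f e x) (\<Sum>e\<in>A. a e) (\<Sum>e\<in>A. b e) x"
  using assms
  by (induction A rule: infinite_finite_induct) (auto intro: has_wirt_add has_wirt_const)

lemma has_wirt_field_derivative:
  assumes "((\<lambda>z. f (x(i := z))) has_field_derivative D) (at (x i))"
  shows "has_wirt i f D 0 x"
  using assms by (simp add: has_wirt_def has_field_derivative_def)

lemma has_wirt_cong:
  assumes S: "openin (top_of_set (cspace n)) S" "x \<in> S" "i < n"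
    and eq: "\<And>y. y \<in> S \<Longrightarrow> f y = g y" and f: "has_wirt i f a b x"
  shows "has_wirt i g a b x"
proof -
  have "\<forall>\<^sub>F z in nhds (x i). f (x(i := z)) = g (x(i := z))"
    using eventually_coordinate_line[OF S] by eventually_elim (rule eq)
  with f show ?thesis
    unfolding has_wirt_def
    using has_derivative_transform_eventually[of "\<lambda>z. f (x(i := z))" _ "x i" UNIV]
    by (simp add: eventually_at_filter eq[OF S(2)] eventually_mono)
qed


section \<open>Smooth functions of several variables\<close>

lemma Ck_on_SucI:
  assumes "continuous_on S f"
    and "\<And>i u x. i < n \<Longrightarrow> u \<in> {1, \<i>} \<Longrightarrow> x \<in> S \<Longrightarrow>
      (\<lambda>t::real. f (x(i := x i + of_real t * u))) differentiable (at 0)"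
    and "\<And>i u. i < n \<Longrightarrow> u \<in> {1, \<i>} \<Longrightarrow> Ck_on n k S (rpartial u i f)"
  shows "Ck_on n (Suc k) S f"
  using assms by simp

lemma Ck_on_SucD:
  assumes "Ck_on n (Suc k) S f"
  shows "continuous_on S f"
    and "\<And>i u x. i < n \<Longrightarrow> u \<in> {1, \<i>} \<Longrightarrow> x \<in> S \<Longrightarrow>
      ((\<lambda>t::real. f (x(i := x i + of_real t * u))) has_vector_derivative rpartial u i f x) (at 0)"
    and "\<And>i u. i < n \<Longrightarrow> u \<in> {1, \<i>} \<Longrightarrow> Ck_on n k S (rpartial u i f)"
  using assms by (auto simp: rpartial_def vector_derivative_works[symmetric])

lemma Ck_on_Suc_imp: "Ck_on n (Suc k) S f \<Longrightarrow> Ck_on n k S f"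
proof (induction k arbitrary: f)
  case 0
  then show ?case by simp
next
  case (Suc k)
  note f = Ck_on_SucD[OF Suc.prems]
  show ?case
    by (rule Ck_on_SucI) (rule f(1) differentiableI_vector[OF f(2)] Suc.IH[OF f(3)]; assumption)+
qed

lemma Ck_on_cong:
  assumes S: "openin (top_of_set (cspace n)) S"
    and eq: "\<And>x. x \<in> S \<Longrightarrow> f x = g x" and f: "Ck_on n k S f"
  shows "Ck_on n k S g"
  using eq f
proof (induction k arbitrary: f g)
  case 0
  then show ?case by (simp cong: continuous_on_cong)
next
  case (Suc k)
  have deriv: "((\<lambda>t::real. g (x(i := x i + of_real t * u))) has_vector_derivative rpartial u i f x) (at 0)"
    if "i < n" "u \<in> {1, \<i>}" "x \<in> S" for i u x
  proof -
    have "\<forall>\<^sub>F t in nhds (0::real). f (x(i := x i + of_real t * u)) = g (x(i := x i + of_real t * u))"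
      using eventually_real_line[OF S that(3,1)] by eventually_elim (rule Suc.prems(1))
    then show ?thesis
      using Ck_on_SucD(2)[OF Suc.prems(2) that]
      by (subst (asm) has_vector_derivative_cong_ev)
        (auto elim: eventually_mono simp: Suc.prems(1) that(3))
  qed
  show ?case
  proof (rule Ck_on_SucI)
    show "continuous_on S g"
      using Ck_on_SucD(1)[OF Suc.prems(2)] Suc.prems(1) by (simp cong: continuous_on_cong)
    fix i u assume iu: "i < n" "u \<in> {1, \<i>}"
    show "(\<lambda>t::real. g (x(i := x i + of_real t * u))) differentiable (at 0)" if "x \<in> S" for x
      using deriv[OF iu that] by (rule differentiableI_vector)
    have "rpartial u i f x = rpartial u i g x" if "x \<in> S" for x
      using deriv[OF iu that] by (simp add: rpartial_def vector_derivative_at)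
    then show "Ck_on n k S (rpartial u i g)"
      by (rule Suc.IH) (use Ck_on_SucD(3)[OF Suc.prems(2)] iu in auto)
  qed
qed

text \<open>
  The derivatives are given by a formula \<open>D\<close> that may hold on \<open>S\<close> only; openness of \<open>S\<close> makes the
  values outside irrelevant. The closure properties below are inductions over the order with this
  rule, in which the formula is the one of the elementary rule of differentiation.
\<close>

lemma Ck_on_SucI_deriv:
  assumes S: "openin (top_of_set (cspace n)) S" and f: "continuous_on S f"
    and d: "\<And>i u x. i < n \<Longrightarrow> u \<in> {1, \<i>} \<Longrightarrow> x \<in> S \<Longrightarrow>
      ((\<lambda>t::real. f (x(i := x i + of_real t * u))) has_vector_derivative D u i x) (at 0)"
    and D: "\<And>i u. i < n \<Longrightarrow> u \<in> {1, \<i>} \<Longrightarrow> Ck_on n k S (D u i)"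
  shows "Ck_on n (Suc k) S f"
proof (rule Ck_on_SucI)
  fix i u assume iu: "i < n" "u \<in> {1, \<i>}"
  show "(\<lambda>t::real. f (x(i := x i + of_real t * u))) differentiable (at 0)" if "x \<in> S" for x
    using d[OF iu that] by (rule differentiableI_vector)
  have "D u i x = rpartial u i f x" if "x \<in> S" for x
    using d[OF iu that] by (simp add: rpartial_def vector_derivative_at)
  then show "Ck_on n k S (rpartial u i f)"
    by (rule Ck_on_cong[OF S]) (use D iu in auto)
qed (rule f)

lemma Ck_on_const:
  assumes "openin (top_of_set (cspace n)) S"
  shows "Ck_on n k S (\<lambda>x. c)"
proof (induction k arbitrary: c)
  case (Suc k)
  show ?case
    by (rule Ck_on_SucI_deriv[OF assms, where D = "\<lambda>u i x. 0"]) (auto intro: Suc)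
qed simp

lemma Ck_on_coord:
  assumes "openin (top_of_set (cspace n)) S"
  shows "Ck_on n k S (\<lambda>x. x j)"
proof (cases k)
  case (Suc k')
  show ?thesis
    unfolding Suc
  proof (rule Ck_on_SucI_deriv[OF assms, where D = "\<lambda>u i x. if i = j then u else 0"])
    show "continuous_on S (\<lambda>x. x j)"
      by (rule continuous_on_coord)
    show "Ck_on n k' S (\<lambda>x. if i = j then u else 0)" for i u
      by (rule Ck_on_const[OF assms])
    show "((\<lambda>t::real. (x(i := x i + of_real t * u)) j) has_vector_derivative
        (if i = j then u else 0)) (at 0)" for i u and x :: "nat \<Rightarrow> complex"
    proof -
      have "((\<lambda>t::real. x j + of_real t * u) has_derivative (\<lambda>t. of_real t * u)) (at 0)"
        by (auto intro!: derivative_eq_intros)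
      then show ?thesis
        by (cases "i = j") (simp_all add: has_vector_derivative_def scaleR_conv_of_real)
    qed
  qed
qed (auto intro: continuous_intros)

lemma Ck_on_cnj:
  assumes S: "openin (top_of_set (cspace n)) S" and "Ck_on n k S f"
  shows "Ck_on n k S (\<lambda>x. cnj (f x))"
  using assms(2)
proof (induction k arbitrary: f)
  case 0
  then show ?case by (auto intro: continuous_intros)
next
  case (Suc k)
  note f = Ck_on_SucD[OF Suc.prems]
  show ?case
    by (rule Ck_on_SucI_deriv[OF S, where D = "\<lambda>u i x. cnj (rpartial u i f x)"])
      (intro continuous_intros f(1) has_vector_derivative_cnj f(2) Suc.IH f(3); assumption)+
qed

lemma Ck_on_add:
  assumes S: "openin (top_of_set (cspace n)) S" and "Ck_on n k S f" "Ck_on n k S g"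
  shows "Ck_on n k S (\<lambda>x. f x + g x)"
  using assms(2,3)
proof (induction k arbitrary: f g)
  case 0
  then show ?case by (auto intro: continuous_intros)
next
  case (Suc k)
  note f = Ck_on_SucD[OF Suc.prems(1)]
  note g = Ck_on_SucD[OF Suc.prems(2)]
  show ?case
    by (rule Ck_on_SucI_deriv[OF S, where D = "\<lambda>u i x. rpartial u i f x + rpartial u i g x"])
      (intro continuous_intros f(1) g(1) has_vector_derivative_add f(2) g(2) Suc.IH f(3) g(3); assumption)+
qed

lemma Ck_on_mult:
  assumes S: "openin (top_of_set (cspace n)) S" and "Ck_on n k S f" "Ck_on n k S g"
  shows "Ck_on n k S (\<lambda>x. f x * g x)"
  using assms(2,3)
proof (induction k arbitrary: f g)
  case 0
  then show ?case by (auto intro: continuous_intros)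
next
  case (Suc k)
  note f = Ck_on_SucD[OF Suc.prems(1)]
  note g = Ck_on_SucD[OF Suc.prems(2)]
  show ?case
  proof (rule Ck_on_SucI_deriv[OF S,
        where D = "\<lambda>u i x. f x * rpartial u i g x + rpartial u i f x * g x"])
    show "continuous_on S (\<lambda>x. f x * g x)"
      by (intro continuous_intros f(1) g(1))
    fix i u assume iu: "i < n" "u \<in> {1, \<i>}"
    show "Ck_on n k S (\<lambda>x. f x * rpartial u i g x + rpartial u i f x * g x)"
      by (intro Ck_on_add[OF S] Suc.IH f(3) g(3) iu Ck_on_Suc_imp[OF Suc.prems(1)]
          Ck_on_Suc_imp[OF Suc.prems(2)])
    show "((\<lambda>t::real. f (x(i := x i + of_real t * u)) * g (x(i := x i + of_real t * u)))
        has_vector_derivative f x * rpartial u i g x + rpartial u i f x * g x) (at 0)"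
      if "x \<in> S" for x
      using has_vector_derivative_mult[OF f(2)[OF iu that] g(2)[OF iu that]]
      by (simp only: of_real_0 mult_zero_left add_0_right fun_upd_triv)
  qed
qed

lemma Ck_on_inverse:
  assumes S: "openin (top_of_set (cspace n)) S" and "Ck_on n k S f" and nz: "\<And>x. x \<in> S \<Longrightarrow> f x \<noteq> 0"
  shows "Ck_on n k S (\<lambda>x. inverse (f x))"
  using assms(2)
proof (induction k)
  case 0
  then show ?case using nz by (auto intro: continuous_intros)
next
  case (Suc k)
  note f = Ck_on_SucD[OF Suc.prems]
  have inv: "Ck_on n k S (\<lambda>x. inverse (f x))"
    by (rule Suc.IH[OF Ck_on_Suc_imp[OF Suc.prems]])
  show ?case
  proof (rule Ck_on_SucI_deriv[OF S,
        where D = "\<lambda>u i x. (- 1) * (inverse (f x) * rpartial u i f x * inverse (f x))"])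
    show "continuous_on S (\<lambda>x. inverse (f x))"
      using nz by (intro continuous_intros f(1)) auto
    fix i u assume iu: "i < n" "u \<in> {1, \<i>}"
    show "Ck_on n k S (\<lambda>x. (- 1) * (inverse (f x) * rpartial u i f x * inverse (f x)))"
      by (intro Ck_on_mult[OF S] inv f(3) iu Ck_on_const[OF S])
    show "((\<lambda>t::real. inverse (f (x(i := x i + of_real t * u)))) has_vector_derivative
        (- 1) * (inverse (f x) * rpartial u i f x * inverse (f x))) (at 0)" if "x \<in> S" for x
      using Deriv.has_derivative_inverse[OF _ f(2)[OF iu that, unfolded has_vector_derivative_def]] nz[OF that]
      by (simp add: has_vector_derivative_def scaleR_conv_of_real algebra_simps)
  qed
qed

lemma smooth_fun_on_cong:
  assumes "openin (top_of_set (cspace n)) S"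
    and "\<And>x. x \<in> S \<Longrightarrow> f x = g x" and "smooth_fun_on n S f"
  shows "smooth_fun_on n S g"
  using assms Ck_on_cong unfolding smooth_fun_on_def by blast

context
  fixes n S
  assumes S: "openin (top_of_set (cspace n)) S"
begin

lemma smooth_fun_on_const: "smooth_fun_on n S (\<lambda>x. c)"
  using Ck_on_const[OF S] by (simp add: smooth_fun_on_def)

lemma smooth_fun_on_coord: "smooth_fun_on n S (\<lambda>x. x j)"
  using Ck_on_coord[OF S] by (simp add: smooth_fun_on_def)

lemma smooth_fun_on_cnj: "smooth_fun_on n S f \<Longrightarrow> smooth_fun_on n S (\<lambda>x. cnj (f x))"
  using Ck_on_cnj[OF S] by (simp add: smooth_fun_on_def)

lemma smooth_fun_on_add:
  "smooth_fun_on n S f \<Longrightarrow> smooth_fun_on n S g \<Longrightarrow> smooth_fun_on n S (\<lambda>x. f x + g x)"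
  using Ck_on_add[OF S] by (simp add: smooth_fun_on_def)

lemma smooth_fun_on_mult:
  "smooth_fun_on n S f \<Longrightarrow> smooth_fun_on n S g \<Longrightarrow> smooth_fun_on n S (\<lambda>x. f x * g x)"
  using Ck_on_mult[OF S] by (simp add: smooth_fun_on_def)

lemma smooth_fun_on_diff:
  "smooth_fun_on n S f \<Longrightarrow> smooth_fun_on n S g \<Longrightarrow> smooth_fun_on n S (\<lambda>x. f x - g x)"
  using smooth_fun_on_add[of f "\<lambda>x. (- 1) * g x"] smooth_fun_on_mult[OF smooth_fun_on_const, of g "- 1"]
  by simp

lemma smooth_fun_on_divide:
  "smooth_fun_on n S f \<Longrightarrow> smooth_fun_on n S g \<Longrightarrow> (\<And>x. x \<in> S \<Longrightarrow> g x \<noteq> 0) \<Longrightarrow>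
    smooth_fun_on n S (\<lambda>x. f x / g x)"
  unfolding divide_inverse
  by (rule smooth_fun_on_mult) (auto simp: smooth_fun_on_def intro: Ck_on_inverse[OF S])

end


section \<open>Charts and holomorphic functions\<close>

lemma holo_on_cong:
  assumes S: "openin (top_of_set (cspace n)) S" and eq: "\<And>x. x \<in> S \<Longrightarrow> f x = g x"
    and f: "holo_on n S f"
  shows "holo_on n S g"
  unfolding holo_on_def
proof (intro conjI ballI allI impI)
  show "continuous_on S g"
    using f eq by (simp add: holo_on_def cong: continuous_on_cong)
  fix x i assume x: "x \<in> S" and i: "i < n"
  have "\<forall>\<^sub>F z in nhds (x i). f (x(i := z)) = g (x(i := z))"
    using eventually_coordinate_line[OF S x i] by eventually_elim (rule eq)
  moreover have "(\<lambda>z. f (x(i := z))) field_differentiable (at (x i))"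
    using f x i by (simp add: holo_on_def)
  ultimately show "(\<lambda>z. g (x(i := z))) field_differentiable (at (x i))"
    unfolding field_differentiable_def by (subst (asm) DERIV_cong_ev[OF refl _ refl]) auto
qed

lemma holo_on_subset: "holo_on n S f \<Longrightarrow> T \<subseteq> S \<Longrightarrow> holo_on n T f"
  by (auto simp: holo_on_def intro: continuous_on_subset)

lemma holo_on_const: "holo_on n S (\<lambda>x. c)"
  by (auto simp: holo_on_def)

lemma holo_on_coord: "holo_on n S (\<lambda>x. x j)"
proof -
  have "(\<lambda>z. (x(i := z)) j) field_differentiable (at (x i))" for x :: "nat \<Rightarrow> complex" and i
    by (cases "i = j") (auto simp: field_differentiable_ident field_differentiable_const)
  then show ?thesis
    using continuous_on_coord by (simp add: holo_on_def)
qed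

lemma holo_on_mult: "holo_on n S f \<Longrightarrow> holo_on n S g \<Longrightarrow> holo_on n S (\<lambda>x. f x * g x)"
  by (auto simp: holo_on_def intro: continuous_on_mult field_differentiable_mult)

lemma holo_on_divide:
  "holo_on n S f \<Longrightarrow> holo_on n S g \<Longrightarrow> (\<And>x. x \<in> S \<Longrightarrow> g x \<noteq> 0) \<Longrightarrow> holo_on n S (\<lambda>x. f x / g x)"
  by (auto simp: holo_on_def intro!: continuous_on_divide field_differentiable_divide)

lemma is_chart_inj:
  assumes "is_chart X n c"
  shows "inj_on (snd c) (fst c)"
proof -
  have "fst c \<subseteq> topspace X"
    using assms openin_subset by (auto simp: is_chart_def)
  then show ?thesis
    using assms homeomorphic_imp_injective_map[of _ _ "snd c"]
    by (force simp: is_chart_def Int_absorb1)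
qed

lemma is_chart_inv_into:
  assumes "is_chart X n c" "p \<in> fst c"
  shows "inv_into (fst c) (snd c) (snd c p) = p"
  using inv_into_f_f[OF is_chart_inj[OF assms(1)] assms(2)] .

lemma in_chart_apply:
  assumes "is_chart X n c" "p \<in> fst c"
  shows "in_chart c f (snd c p) = f p"
  by (simp add: in_chart_def is_chart_inv_into[OF assms])

text \<open>
  Locality arguments in a chart refer to this set: a function that agrees on it with a holomorphic
  one is holomorphic, whatever the inverse of the chart does outside of its range.
\<close>

lemma is_chart_image_open:
  assumes c: "is_chart X n c" and W: "openin X W"
  shows "openin (top_of_set (cspace n)) (snd c ` (fst c \<inter> W))"
proof -
  have "openin (subtopology X (fst c)) (fst c \<inter> W)"
    using W by (simp add: openin_subtopology_Int2)
  moreover have "open_map (subtopology X (fst c)) (top_of_set (snd c ` fst c)) (snd c)"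
    using c by (simp add: is_chart_def homeomorphic_imp_open_map)
  ultimately have "openin (top_of_set (snd c ` fst c)) (snd c ` (fst c \<inter> W))"
    by (simp add: open_map_def)
  then show ?thesis
    using c openin_trans by (auto simp: is_chart_def)
qed

lemma is_chart_cspace:
  assumes "is_chart X n c" "p \<in> fst c"
  shows "snd c p \<in> cspace n"
  using assms openin_subset[of "top_of_set (cspace n)"] by (force simp: is_chart_def)

lemma holo_funI:
  assumes M: "complex_manifold M" and W: "openin (mtop M) W"
    and f: "\<And>c. c \<in> atlas M \<Longrightarrow> \<exists>g. holo_on (mdim M) (snd c ` (fst c \<inter> W)) g \<and>
      (\<forall>p\<in>fst c \<inter> W. g (snd c p) = f p)"
  shows "holo_fun M W f"
  unfolding holo_fun_def
proof
  fix c assume c: "c \<in> atlas M"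
  then have chart: "is_chart (mtop M) (mdim M) c"
    using M by (simp add: complex_manifold_def)
  obtain g where g: "holo_on (mdim M) (snd c ` (fst c \<inter> W)) g" "\<forall>p\<in>fst c \<inter> W. g (snd c p) = f p"
    using f[OF c] by blast
  show "holo_on (mdim M) (snd c ` (fst c \<inter> W)) (in_chart c f)"
    by (rule holo_on_cong[OF is_chart_image_open[OF chart W] _ g(1)])
      (use g(2) in \<open>auto simp: in_chart_apply[OF chart]\<close>)
qed

lemma holo_fun_const: "holo_fun M W (\<lambda>p. c)"
  by (simp add: holo_fun_def in_chart_def holo_on_const)

lemma holo_fun_mult:
  "holo_fun M W f \<Longrightarrow> holo_fun M W g \<Longrightarrow> holo_fun M W (\<lambda>p. f p * g p)"
  by (auto simp: holo_fun_def in_chart_def intro: holo_on_mult)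

lemma holo_fun_minus: "holo_fun M W f \<Longrightarrow> holo_fun M W (\<lambda>p. - f p)"
  using holo_fun_mult[OF holo_fun_const, of M W f "- 1"] by simp

lemma holo_fun_divide:
  assumes M: "complex_manifold M" and f: "holo_fun M W f" and g: "holo_fun M W g"
    and nz: "\<And>p. p \<in> W \<Longrightarrow> g p \<noteq> 0"
  shows "holo_fun M W (\<lambda>p. f p / g p)"
  unfolding holo_fun_def
proof
  fix c assume c: "c \<in> atlas M"
  then have chart: "is_chart (mtop M) (mdim M) c"
    using M by (simp add: complex_manifold_def)
  have "holo_on (mdim M) (snd c ` (fst c \<inter> W)) (\<lambda>x. in_chart c f x / in_chart c g x)"
    by (rule holo_on_divide) (use f g c nz in \<open>auto simp: holo_fun_def in_chart_apply[OF chart]\<close>)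
  then show "holo_on (mdim M) (snd c ` (fst c \<inter> W)) (in_chart c (\<lambda>p. f p / g p))"
    by (simp add: in_chart_def)
qed

lemma atlas_subset_holo_charts:
  assumes "complex_manifold M"
  shows "atlas M \<subseteq> holo_charts M"
  using assms by (auto simp: complex_manifold_def holo_charts_def)


section \<open>The complex projective plane\<close>

text \<open>
  A point of the projective plane is encoded by the orthogonal projection onto the line that it is,
  the matrix \<open>Z Z\<^sup>* / |Z|\<^sup>2\<close> written row by row. The plane is thereby a subset of a metric space,
  and its topology the subspace topology.
\<close>

definition cinner :: "(nat \<Rightarrow> complex) \<Rightarrow> (nat \<Rightarrow> complex) \<Rightarrow> complex" where
  "cinner V W = (\<Sum>a<3. V a * cnj (W a))"

definition homogeneous :: "(nat \<Rightarrow> complex) set" where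
  "homogeneous = {Z. \<exists>a<3. Z a \<noteq> 0}"

definition proj :: "(nat \<Rightarrow> complex) \<Rightarrow> (nat \<Rightarrow> complex)" where
  "proj Z = (\<lambda>n. if n < 9 then Z (n div 3) * cnj (Z (n mod 3)) / cinner Z Z else 0)"

definition P2 :: "(nat \<Rightarrow> complex) set" where
  "P2 = proj ` homogeneous"

text \<open>The meromorphic function \<open>Z\<^sub>a / Z\<^sub>i\<close>.\<close>

definition ratio :: "nat \<Rightarrow> nat \<Rightarrow> (nat \<Rightarrow> complex) \<Rightarrow> complex" where
  "ratio a i p = p (3 * a + i) / p (3 * i + i)"

definition patch :: "nat \<Rightarrow> (nat \<Rightarrow> complex) set" where
  "patch i = {p \<in> P2. p (3 * i + i) \<noteq> 0}"

text \<open>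
  The increasing enumeration of the indices different from \<open>i\<close>. As the order is kept, \<open>Z\<^sub>2\<close> is the
  last coordinate in the patches \<open>0\<close> and \<open>1\<close>, which are thereby adapted to the line \<open>Z\<^sub>2 = 0\<close>.
\<close>

definition skip :: "nat \<Rightarrow> nat \<Rightarrow> nat" where
  "skip i k = (if k < i then k else Suc k)"

definition affine_coords :: "nat \<Rightarrow> (nat \<Rightarrow> complex) \<Rightarrow> (nat \<Rightarrow> complex)" where
  "affine_coords i p = (\<lambda>k. if k < 2 then ratio (skip i k) i p else 0)"

definition insert_at :: "nat \<Rightarrow> complex \<Rightarrow> (nat \<Rightarrow> complex) \<Rightarrow> (nat \<Rightarrow> complex)" where
  "insert_at i c x = (\<lambda>a. if a = i then c else if a < i then x a else x (a - 1))"

abbreviation lift :: "nat \<Rightarrow> (nat \<Rightarrow> complex) \<Rightarrow> (nat \<Rightarrow> complex)" where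
  "lift i \<equiv> insert_at i 1"

definition affine_chart :: "nat \<Rightarrow> (nat \<Rightarrow> complex) chart" where
  "affine_chart i = (patch i, affine_coords i)"

definition plane :: "(nat \<Rightarrow> complex) cmanifold" where
  "plane = \<lparr>mtop = top_of_set P2, mdim = 2, atlas = affine_chart ` {..<3}\<rparr>"

lemma less_3_cases: "(i::nat) < 3 \<Longrightarrow> i = 0 \<or> i = 1 \<or> i = 2"
  by auto

lemma sum_less_2: "(\<Sum>k<(2::nat). f k) = f 0 + (f 1 :: 'a :: comm_monoid_add)"
  by (simp add: numeral_2_eq_2)

lemma sum_less_3: "(\<Sum>k<(3::nat). f k) = f 0 + f 1 + (f 2 :: 'a :: comm_monoid_add)"
  by (simp add: numeral_3_eq_3 numeral_2_eq_2)

lemma sum_skip: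
  assumes "i < 3"
  shows "(\<Sum>a<3. f a) = f i + (\<Sum>k<2. f (skip i k) :: 'a :: comm_monoid_add)"
  using less_3_cases[OF assms] by (auto simp: sum_less_2 sum_less_3 skip_def ac_simps numeral_2_eq_2)

lemma skip_less: "k < 2 \<Longrightarrow> skip i k < 3"
  by (simp add: skip_def)

lemma skip_neq: "skip i k \<noteq> i"
  by (simp add: skip_def)

lemma skip_eq_iff: "skip i k = skip i l \<longleftrightarrow> k = l"
  by (auto simp: skip_def)

lemma insert_at_same [simp]: "insert_at i c x i = c"
  by (simp add: insert_at_def)

lemma insert_at_skip [simp]: "insert_at i c x (skip i k) = x k"
  by (simp add: insert_at_def skip_def)

lemma skip_cases:
  assumes "a < 3" "i < 3"
  obtains "a = i" | k where "k < 2" "a = skip i k"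
proof (cases "a = i")
  case False
  then have "(if a < i then a else a - 1) < 2" "a = skip i (if a < i then a else a - 1)"
    using assms by (auto simp: skip_def)
  then show ?thesis using that by blast
qed (use that in blast)

lemma cinner_self: "cinner Z Z = of_real (\<Sum>a<3. (cmod (Z a))\<^sup>2)"
  by (simp add: cinner_def complex_norm_square[symmetric] del: of_real_power)

lemma cinner_self_nonzero:
  assumes "Z \<in> homogeneous"
  shows "cinner Z Z \<noteq> 0"
proof -
  obtain a where a: "a < 3" "Z a \<noteq> 0"
    using assms by (auto simp: homogeneous_def)
  then have "0 < (\<Sum>a<3. (cmod (Z a))\<^sup>2)"
    by (intro sum_pos2[of _ a]) auto
  then show ?thesis
    unfolding cinner_self by (metis less_irrefl of_real_eq_0_iff)
qed

lemma homogeneousI: "a < 3 \<Longrightarrow> Z a \<noteq> 0 \<Longrightarrow> Z \<in> homogeneous"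
  by (auto simp: homogeneous_def)

lemma lift_homogeneous: "i < 3 \<Longrightarrow> lift i x \<in> homogeneous"
  by (rule homogeneousI[of i]) simp_all

lemma proj_entry:
  assumes "a < 3" "b < 3"
  shows "proj Z (3 * a + b) = Z a * cnj (Z b) / cinner Z Z"
  using assms by (simp add: proj_def)

lemma ratio_proj:
  assumes "Z \<in> homogeneous" "a < 3" "i < 3"
  shows "ratio a i (proj Z) = Z a / Z i"
  using cinner_self_nonzero[OF assms(1)] assms(2,3)
  by (simp add: ratio_def proj_entry[of i i, simplified] proj_entry)

lemma proj_in_patch:
  assumes "Z \<in> homogeneous" "i < 3"
  shows "proj Z \<in> patch i \<longleftrightarrow> Z i \<noteq> 0"
  using cinner_self_nonzero[OF assms(1)] assms proj_entry[of i i Z]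
  by (simp add: patch_def P2_def)

lemma proj_scale:
  assumes "c \<noteq> 0" "\<And>a. a < 3 \<Longrightarrow> W a = c * Z a"
  shows "proj W = proj Z"
proof
  fix n
  have "cinner W W = c * cnj c * cinner Z Z"
    using assms(2) by (simp add: cinner_def sum_distrib_left mult_ac)
  moreover have "n div 3 < 3" "n mod 3 < 3" if "n < (9::nat)"
    using that by (auto simp: less_mult_imp_div_less)
  ultimately show "proj W n = proj Z n"
    using assms by (simp add: proj_def)
qed

lemma P2_cases:
  assumes "p \<in> P2"
  obtains Z where "Z \<in> homogeneous" "p = proj Z"
  using assms by (auto simp: P2_def)

lemma patch_subset: "patch i \<subseteq> P2"
  by (auto simp: patch_def)

lemma P2_eq_patches: "P2 = (\<Union>i<3. patch i)"
proof
  show "P2 \<subseteq> (\<Union>i<3. patch i)"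
  proof
    fix p assume "p \<in> P2"
    then obtain Z where Z: "Z \<in> homogeneous" "p = proj Z" by (rule P2_cases)
    then obtain a where "a < 3" "Z a \<noteq> 0" by (auto simp: homogeneous_def)
    then show "p \<in> (\<Union>i<3. patch i)"
      using Z proj_in_patch by auto
  qed
qed (use patch_subset in auto)

lemma affine_coords_cspace: "affine_coords i p \<in> cspace 2"
  by (simp add: affine_coords_def cspace_def)

lemma affine_coords_lift:
  assumes i: "i < 3" and x: "x \<in> cspace 2"
  shows "affine_coords i (proj (lift i x)) = x"
proof
  fix k
  show "affine_coords i (proj (lift i x)) k = x k"
    using ratio_proj[OF lift_homogeneous[OF i] skip_less i] x
    by (simp add: affine_coords_def cspace_def)
qed

lemma proj_lift_patch: "i < 3 \<Longrightarrow> proj (lift i x) \<in> patch i"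
  by (simp add: proj_in_patch lift_homogeneous)

text \<open>
  The coordinates of \<open>[Z]\<close> in the patch \<open>i\<close> are those of the representative \<open>Z / Z\<^sub>i\<close>.
\<close>

lemma proj_lift_coords:
  assumes i: "i < 3" and p: "p \<in> patch i"
  shows "proj (lift i (affine_coords i p)) = p"
proof -
  obtain Z where Z: "Z \<in> homogeneous" "p = proj Z"
    using p patch_subset P2_cases by blast
  then have nz: "Z i \<noteq> 0"
    using p proj_in_patch[OF Z(1) i] by simp
  have "lift i (affine_coords i p) a = (1 / Z i) * Z a" if "a < 3" for a
    using \<open>a < 3\<close> i
  proof (cases rule: skip_cases)
    case 1
    then show ?thesis using nz by simp
  next
    case (2 k)
    then show ?thesis using Z(2) ratio_proj[OF Z(1) that i] by (simp add: affine_coords_def)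
  qed
  then show ?thesis
    unfolding Z(2) using nz by (intro proj_scale[of "1 / Z i"]) auto
qed

lemma affine_coords_image:
  assumes i: "i < 3"
  shows "affine_coords i ` (patch i \<inter> W) = {x \<in> cspace 2. proj (lift i x) \<in> W}"
proof (intro equalityI subsetI)
  fix x assume "x \<in> affine_coords i ` (patch i \<inter> W)"
  then show "x \<in> {x \<in> cspace 2. proj (lift i x) \<in> W}"
    using i by (auto simp: affine_coords_cspace proj_lift_coords)
next
  fix x assume x: "x \<in> {x \<in> cspace 2. proj (lift i x) \<in> W}"
  then have "x = affine_coords i (proj (lift i x))"
    using i by (simp add: affine_coords_lift)
  then show "x \<in> affine_coords i ` (patch i \<inter> W)"
    using x i by (intro image_eqI[of _ _ "proj (lift i x)"]) (auto simp: proj_lift_patch)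
qed

lemma affine_coords_image_patch:
  assumes "i < 3"
  shows "affine_coords i ` patch i = cspace 2"
  using affine_coords_image[OF assms, of UNIV] by simp

lemma continuous_on_insert_at: "continuous_on A (\<lambda>x. insert_at i c x a)"
  unfolding insert_at_def by (cases "a = i"; cases "a < i") (auto intro: continuous_on_coord)

lemma continuous_on_proj_lift:
  assumes "i < 3"
  shows "continuous_on A (\<lambda>x. proj (lift i x))"
proof (rule continuous_on_coordinatewise_then_product)
  fix n
  show "continuous_on A (\<lambda>x. proj (lift i x) n)"
    using cinner_self_nonzero[OF lift_homogeneous[OF assms]]
    by (cases "n < 9") (auto simp: proj_def cinner_def intro!: continuous_intros continuous_on_insert_at)
qed

lemma continuous_on_affine_coords:
  shows "continuous_on (patch i) (affine_coords i)"
proof (rule continuous_on_coordinatewise_then_product)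
  fix k
  show "continuous_on (patch i) (\<lambda>p. affine_coords i p k)"
    by (cases "k < 2") (auto simp: affine_coords_def ratio_def patch_def intro!: continuous_intros)
qed

lemma openin_patch: "openin (top_of_set P2) (patch i)"
proof -
  have "open ((\<lambda>p::nat \<Rightarrow> complex. p (3 * i + i)) -` (- {0}))"
    by (rule open_vimage) (auto intro: continuous_on_coord)
  moreover have "patch i = P2 \<inter> (\<lambda>p. p (3 * i + i)) -` (- {0})"
    by (auto simp: patch_def)
  ultimately show ?thesis
    by (auto simp: openin_open)
qed

lemma is_chart_affine:
  assumes i: "i < 3"
  shows "is_chart (top_of_set P2) 2 (affine_chart i)"
proof -
  have "homeomorphic_maps (top_of_set (patch i)) (top_of_set (cspace 2)) (affine_coords i)
      (\<lambda>x. proj (lift i x))"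
    using i continuous_on_affine_coords continuous_on_proj_lift
    by (auto simp: homeomorphic_maps_def affine_coords_cspace proj_lift_patch affine_coords_lift
        proj_lift_coords)
  then have "homeomorphic_map (top_of_set (patch i)) (top_of_set (cspace 2)) (affine_coords i)"
    using homeomorphic_map_maps by blast
  moreover have "subtopology (top_of_set P2) (patch i) = top_of_set (patch i)"
    by (simp add: subtopology_subtopology Int_absorb1 patch_subset)
  ultimately show ?thesis
    using i by (simp add: is_chart_def affine_chart_def affine_coords_image_patch openin_patch)
qed

lemma in_affine_chart:
  assumes i: "i < 3" and x: "x \<in> cspace 2"
  shows "in_chart (affine_chart i) f x = f (proj (lift i x))"
proof -
  have "in_chart (affine_chart i) f (snd (affine_chart i) (proj (lift i x))) = f (proj (lift i x))"
    by (rule in_chart_apply[OF is_chart_affine[OF i]])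
      (simp add: affine_chart_def i proj_lift_patch)
  then show ?thesis
    by (simp add: affine_chart_def affine_coords_lift[OF i x])
qed

lemma holo_on_insert_at: "holo_on n S (\<lambda>x. insert_at i c x a)"
  unfolding insert_at_def by (cases "a = i"; cases "a < i") (auto intro: holo_on_const holo_on_coord)

lemma holo_on_ratio:
  assumes "i < 3" "j < 3" "a < 3"
  shows "holo_on 2 {x \<in> cspace 2. proj (lift i x) \<in> patch j} (\<lambda>x. lift i x a / lift i x j)"
  using assms by (auto intro!: holo_on_divide holo_on_insert_at simp: proj_in_patch lift_homogeneous)

lemma compatible_affine:
  assumes i: "i < 3" and j: "j < 3"
  shows "compatible 2 (affine_chart i) (affine_chart j)"
  unfolding compatible_def
proof (intro allI impI)
  fix a :: nat assume a: "a < 2"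
  have op: "openin (top_of_set (cspace 2))
      (snd (affine_chart i) ` (fst (affine_chart i) \<inter> fst (affine_chart j)))"
    by (rule is_chart_image_open[OF is_chart_affine[OF i]]) (simp add: affine_chart_def openin_patch)
  show "holo_on 2 (snd (affine_chart i) ` (fst (affine_chart i) \<inter> fst (affine_chart j)))
      (in_chart (affine_chart i) (\<lambda>p. snd (affine_chart j) p a))"
  proof (rule holo_on_cong[OF op])
    show "holo_on 2 (snd (affine_chart i) ` (fst (affine_chart i) \<inter> fst (affine_chart j)))
        (\<lambda>x. lift i x (skip j a) / lift i x j)"
      using holo_on_ratio[OF i j skip_less[OF a]] by (simp add: affine_chart_def affine_coords_image[OF i])
    fix x assume "x \<in> snd (affine_chart i) ` (fst (affine_chart i) \<inter> fst (affine_chart j))"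
    then have "x \<in> cspace 2"
      by (auto simp: affine_chart_def affine_coords_cspace)
    then show "lift i x (skip j a) / lift i x j =
        in_chart (affine_chart i) (\<lambda>p. snd (affine_chart j) p a) x"
      using a i j
      by (simp add: in_affine_chart)
        (simp add: affine_chart_def affine_coords_def ratio_proj lift_homogeneous skip_less)
  qed
qed

definition pt :: "complex \<times> complex \<Rightarrow> nat \<Rightarrow> complex" where
  "pt = (\<lambda>(a, b) k. if k = 0 then a else if k = 1 then b else 0)"

lemma continuous_on_pt: "continuous_on A pt"
proof (rule continuous_on_coordinatewise_then_product)
  fix k
  show "continuous_on A (\<lambda>ab. pt ab k)"
    by (cases "k = 0"; cases "k = 1") (auto simp: pt_def case_prod_beta intro!: continuous_intros)
qed

lemma cspace_2_pt: "x \<in> cspace 2 \<Longrightarrow> x = pt (x 0, x 1)"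
  by (auto simp: pt_def cspace_def fun_eq_iff)

lemma compact_P2: "compact P2"
proof -
  have "P2 = (\<Union>i<3. (\<lambda>x. proj (lift i x)) ` pt ` (cball 0 1 \<times> cball 0 1))"
  proof (intro equalityI subsetI)
    fix p assume "p \<in> P2"
    then obtain Z where Z: "Z \<in> homogeneous" "p = proj Z" by (rule P2_cases)
    \<comment> \<open>In the chart of a coordinate of largest modulus, the point lies in the unit bidisc.\<close>
    have "Max ((\<lambda>a. cmod (Z a)) ` {..<3}) \<in> (\<lambda>a. cmod (Z a)) ` {..<3}"
      by (rule Max_in) (auto simp: lessThan_empty_iff)
    then obtain i where i: "i < 3" "cmod (Z i) = Max ((\<lambda>a. cmod (Z a)) ` {..<3})"
      by auto
    have max: "cmod (Z a) \<le> cmod (Z i)" if "a < 3" for a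
      unfolding i(2) using that by (intro Max_ge) auto
    note i = i(1)
    have nz: "Z i \<noteq> 0"
      using Z(1) max by (force simp: homogeneous_def)
    have aff: "p \<in> patch i"
      using Z nz i by (simp add: proj_in_patch)
    let ?x = "affine_coords i p"
    have "cmod (?x k) \<le> 1" for k
      using Z i nz max[OF skip_less, of k i]
      by (auto simp: affine_coords_def ratio_proj skip_less norm_divide divide_le_eq)
    moreover have "?x = pt (?x 0, ?x 1)"
      by (rule cspace_2_pt[OF affine_coords_cspace])
    ultimately have "?x \<in> pt ` (cball 0 1 \<times> cball 0 1)"
      by (intro image_eqI[of _ _ "(?x 0, ?x 1)"]) auto
    then show "p \<in> (\<Union>i<3. (\<lambda>x. proj (lift i x)) ` pt ` (cball 0 1 \<times> cball 0 1))"
      using i proj_lift_coords[OF i aff] by (metis UN_iff image_eqI lessThan_iff)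
  next
    fix p assume "p \<in> (\<Union>i<3. (\<lambda>x. proj (lift i x)) ` pt ` (cball 0 1 \<times> cball 0 1))"
    then show "p \<in> P2"
      by (auto simp: P2_def lift_homogeneous)
  qed
  moreover have "compact (\<Union>i<3. (\<lambda>x. proj (lift i x)) ` pt ` (cball 0 1 \<times> cball 0 1))"
    by (intro compact_UN compact_continuous_image continuous_on_proj_lift continuous_on_pt compact_Times compact_cball) auto
  ultimately show ?thesis by simp
qed

lemma connected_P2: "connected P2"
proof -
  define U where "U i = (\<lambda>x. proj (lift i x)) ` pt ` UNIV" for i
  have "connected (U i)" if "i < 3" for i
    unfolding U_def
    by (intro connected_continuous_image continuous_on_proj_lift continuous_on_pt that connected_UNIV)
  moreover have "proj (\<lambda>a. 1) \<in> U i" if "i < 3" for i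
  proof -
    have "lift i (pt (1, 1)) a = 1 * 1" if "a < 3" for a
      using that \<open>i < 3\<close> by (cases rule: skip_cases) (auto simp: pt_def less_2_cases_iff)
    then have "proj (lift i (pt (1, 1))) = proj (\<lambda>a. 1)"
      by (intro proj_scale[of 1]) auto
    then show ?thesis
      unfolding U_def by (intro image_eqI[of _ _ "pt (1, 1)"]) simp_all
  qed
  then have "proj (\<lambda>a. 1) \<in> (\<Inter>i<3. U i)"
    by blast
  ultimately have "connected (\<Union>i<3. U i)"
    by (intro connected_Union) blast+
  moreover have "U i = patch i" if "i < 3" for i
  proof
    show "U i \<subseteq> patch i"
      using that by (auto simp: U_def proj_lift_patch)
    show "patch i \<subseteq> U i"
    proof
      fix p assume "p \<in> patch i"
      then show "p \<in> U i"
        using proj_lift_coords[OF that, of p] cspace_2_pt[OF affine_coords_cspace, of i p]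
        unfolding U_def by (metis image_eqI UNIV_I)
    qed
  qed
  ultimately show ?thesis
    by (simp add: P2_eq_patches)
qed

lemma plane_simps [simp]:
  "mtop plane = top_of_set P2" "mdim plane = 2" "atlas plane = affine_chart ` {..<3}"
  by (simp_all add: plane_def)

lemma complex_manifold_plane: "complex_manifold plane"
  unfolding complex_manifold_def
proof (intro conjI ballI)
  show "Hausdorff_space (mtop plane)"
    by (simp add: Hausdorff_space_subtopology)
  show "second_countable (mtop plane)"
    unfolding plane_simps
  proof (rule second_countable_subtopology)
    obtain B :: "(nat \<Rightarrow> complex) set set" where "countable B" "topological_basis B"
      using ex_countable_basis by blast
    then show "second_countable (euclidean :: (nat \<Rightarrow> complex) topology)"
      unfolding second_countable_def
      by (intro exI[of _ B]) (auto simp: topological_basis_open elim: topological_basisE)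
  qed
  show "(\<Union>c\<in>atlas plane. fst c) = topspace (mtop plane)"
    by (simp add: affine_chart_def P2_eq_patches)
qed (auto simp: is_chart_affine compatible_affine)

lemma holo_fun_ratio:
  assumes W: "openin (top_of_set P2) W" "W \<subseteq> patch i" and i: "i < 3" and a: "a < 3"
  shows "holo_fun plane W (ratio a i)"
proof (rule holo_funI[OF complex_manifold_plane])
  show "openin (mtop plane) W" using W by simp
  fix c assume "c \<in> atlas plane"
  then obtain j where j: "j < 3" "c = affine_chart j" by auto
  have "holo_on 2 (affine_coords j ` (patch j \<inter> W)) (\<lambda>x. lift j x a / lift j x i)"
    by (rule holo_on_subset[OF holo_on_ratio[OF j(1) i a]]) (use W in \<open>auto simp: affine_coords_image[OF j(1)]\<close>)
  moreover have "lift j (affine_coords j p) a / lift j (affine_coords j p) i = ratio a i p"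
    if "p \<in> patch j" for p
    using ratio_proj[OF lift_homogeneous[OF j(1)] a i, of "affine_coords j p"]
    by (simp add: proj_lift_coords[OF j(1) that])
  ultimately show "\<exists>g. holo_on (mdim plane) (snd c ` (fst c \<inter> W)) g \<and>
      (\<forall>p\<in>fst c \<inter> W. g (snd c p) = ratio a i p)"
    by (intro exI[of _ "\<lambda>x. lift j x a / lift j x i"]) (simp add: j(2) affine_chart_def)
qed


section \<open>The Fubini-Study metric\<close>

lemma cinner_cong:
  "(\<And>a. a < 3 \<Longrightarrow> V a = V' a) \<Longrightarrow> (\<And>a. a < 3 \<Longrightarrow> W a = W' a) \<Longrightarrow> cinner V W = cinner V' W'"
  by (simp add: cinner_def)

lemma cinner_comb_left: "cinner (\<lambda>a. c * V a - d * Z a) W = c * cinner V W - d * cinner Z W"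
  by (simp add: cinner_def sum_subtractf[symmetric] sum_distrib_left algebra_simps)

lemma cinner_comb_right:
  "cinner V (\<lambda>a. c * W a - d * Z a) = cnj c * cinner V W - cnj d * cinner V Z"
  by (simp add: cinner_def sum_subtractf[symmetric] sum_distrib_left algebra_simps)

lemma cinner_scale_left: "cinner (\<lambda>a. c * V a) W = c * cinner V W"
  by (simp add: cinner_def sum_distrib_left algebra_simps)

lemma cinner_scale_right: "cinner V (\<lambda>a. c * W a) = cnj c * cinner V W"
  by (simp add: cinner_def sum_distrib_left algebra_simps)

lemma cinner_commute: "cinner W V = cnj (cinner V W)"
  by (simp add: cinner_def mult.commute)

lemma cinner_insert_at:
  assumes "i < 3"
  shows "cinner (insert_at i c x) (insert_at i d y) = c * cnj d + (\<Sum>k<2. x k * cnj (y k))"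
  unfolding cinner_def sum_skip[OF assms] by simp

text \<open>
  The Fubini-Study form at the line spanned by \<open>Z\<close>, on tangent vectors represented by vectors
  \<open>V\<close>, \<open>W\<close> that are determined modulo \<open>Z\<close>.
\<close>

definition fs :: "(nat \<Rightarrow> complex) \<Rightarrow> (nat \<Rightarrow> complex) \<Rightarrow> (nat \<Rightarrow> complex) \<Rightarrow> complex" where
  "fs Z V W = (cinner Z Z * cinner V W - cinner V Z * cinner Z W) / (cinner Z Z)\<^sup>2"

lemma fs_cong:
  "(\<And>a. a < 3 \<Longrightarrow> Z a = Z' a) \<Longrightarrow> (\<And>a. a < 3 \<Longrightarrow> V a = V' a) \<Longrightarrow> (\<And>a. a < 3 \<Longrightarrow> W a = W' a)
    \<Longrightarrow> fs Z V W = fs Z' V' W'"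
  unfolding fs_def by (simp cong: cinner_cong)

text \<open>The derivative of \<open>Z\<^sub>a / Z\<^sub>i\<close> in the direction \<open>V\<close>.\<close>

definition dratio :: "(nat \<Rightarrow> complex) \<Rightarrow> (nat \<Rightarrow> complex) \<Rightarrow> nat \<Rightarrow> nat \<Rightarrow> complex" where
  "dratio Z V i a = (V a * Z i - Z a * V i) / (Z i)\<^sup>2"

text \<open>
  Passing to the representative \<open>Z / Z\<^sub>i\<close> multiplies the tangent vectors by \<open>1 / Z\<^sub>i\<close> and changes
  them by multiples of \<open>Z\<close>, and the Fubini-Study form ignores both.
\<close>

lemma fs_invariant:
  assumes "Z i \<noteq> 0" "cinner Z Z \<noteq> 0"
  shows "fs (\<lambda>a. Z a / Z i) (dratio Z V i) (dratio Z W i) = fs Z V W"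
proof -
  define z where "z = Z i"
  define N where "N = cinner Z Z"
  have z: "z \<noteq> 0" "N \<noteq> 0" using assms by (auto simp: z_def N_def)
  have d: "dratio Z X i = (\<lambda>a. (1 / z) * X a - (X i / z\<^sup>2) * Z a)" for X
    using z by (auto simp: dratio_def z_def[symmetric] fun_eq_iff field_simps power2_eq_square)
  have Z: "(\<lambda>a. Z a / Z i) = (\<lambda>a. (1 / z) * Z a)"
    by (simp add: z_def)
  show ?thesis
    using z unfolding fs_def d Z cinner_comb_left cinner_comb_right cinner_scale_left cinner_scale_right
      N_def[symmetric]
    by (simp add: field_simps power2_eq_square)
qed

abbreviation unit_coord :: "nat \<Rightarrow> nat \<Rightarrow> complex" where
  "unit_coord b \<equiv> (\<lambda>c. if c = b then 1 else 0)"

lemma insert_at_upd: "insert_at j c (x(b := z)) = (insert_at j c x)(skip j b := z)"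
  by (auto simp: insert_at_def skip_def fun_eq_iff)

lemma insert_at_unit: "insert_at j 0 (unit_coord b) a = unit_coord (skip j b) a"
  by (auto simp: insert_at_def skip_def)

lemma insert_at_derivative:
  "((\<lambda>z. insert_at j c (x(b := z)) a) has_field_derivative insert_at j 0 (unit_coord b) a) (at y)"
  unfolding insert_at_upd insert_at_unit
  by (cases "a = skip j b") (auto intro!: derivative_eq_intros)

text \<open>
  The derivative of one affine coordinate by those of another patch \<open>j\<close>: the lift of the patch \<open>j\<close>
  is affine linear, so only the quotient rule is involved.
\<close>

lemma ratio_derivative:
  assumes "lift j x i \<noteq> 0"
  shows "((\<lambda>z. lift j (x(b := z)) a / lift j (x(b := z)) i) has_field_derivative
      dratio (lift j x) (insert_at j 0 (unit_coord b)) i a) (at (x b))"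
  using DERIV_divide[OF insert_at_derivative[of j 1 x b a "x b"] insert_at_derivative[of j 1 x b i "x b"]]
    assms
  by (simp add: dratio_def power2_eq_square)

definition sqn :: "(nat \<Rightarrow> complex) \<Rightarrow> complex" where
  "sqn u = 1 + (\<Sum>k<2. u k * cnj (u k))"

lemma sqn_real: "sqn u = of_real (1 + (\<Sum>k<2. (cmod (u k))\<^sup>2))"
  by (simp add: sqn_def complex_norm_square[symmetric] del: of_real_power)

lemma sqn_pos: "0 < 1 + (\<Sum>k<2. (cmod (u k))\<^sup>2)"
  by (intro add_pos_nonneg sum_nonneg) auto

lemma sqn_nonzero: "sqn u \<noteq> 0"
  unfolding sqn_real using sqn_pos[of u] by (metis of_real_eq_0_iff less_irrefl)

lemma cnj_sqn [simp]: "cnj (sqn u) = sqn u"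
  by (simp add: sqn_real)

lemma cinner_lift: "i < 3 \<Longrightarrow> cinner (lift i u) (lift i u) = sqn u"
  by (simp add: cinner_insert_at sqn_def)

definition fs_matrix :: "(nat \<Rightarrow> complex) \<Rightarrow> complex mat" where
  "fs_matrix u = mat 2 2 (\<lambda>(l, k). (if l = k then 1 else 0) / sqn u - cnj (u k) * u l / (sqn u)\<^sup>2)"

lemma herm_eq_sum:
  assumes "H \<in> carrier_mat r r" "v \<in> carrier_vec r" "w \<in> carrier_vec r"
  shows "herm H v w = (\<Sum>l<r. (\<Sum>k<r. H $$ (l, k) * v $ k) * cnj (w $ l))"
  using assms by (auto simp: herm_def scalar_prod_def lessThan_atLeast0 intro!: sum.cong)

lemma mult_mat_vec_index:
  assumes "A \<in> carrier_mat r n" "v \<in> carrier_vec n" "a < r"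
  shows "(A *\<^sub>v v) $ a = (\<Sum>b<n. A $$ (a, b) * v $ b)"
  using assms by (auto simp: scalar_prod_def lessThan_atLeast0 intro!: sum.cong)

lemma herm_fs_matrix:
  assumes "v \<in> carrier_vec 2" "w \<in> carrier_vec 2" "i < 3"
  shows "herm (fs_matrix u) v w =
    fs (lift i u) (insert_at i 0 (vec_index v)) (insert_at i 0 (vec_index w))"
proof -
  have "herm (fs_matrix u) v w = (v $ 0 * cnj (w $ 0) + v $ 1 * cnj (w $ 1)) / sqn u -
      (v $ 0 * cnj (u 0) + v $ 1 * cnj (u 1)) * (u 0 * cnj (w $ 0) + u 1 * cnj (w $ 1)) / (sqn u)\<^sup>2"
    using assms(1,2)
    by (simp add: herm_eq_sum[of _ 2] fs_matrix_def sum_less_2) (simp add: divide_inverse algebra_simps)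
  also have "\<dots> = (sqn u * (v $ 0 * cnj (w $ 0) + v $ 1 * cnj (w $ 1)) -
      (v $ 0 * cnj (u 0) + v $ 1 * cnj (u 1)) * (u 0 * cnj (w $ 0) + u 1 * cnj (w $ 1))) / (sqn u)\<^sup>2"
    using sqn_nonzero[of u] by (simp add: diff_divide_distrib power2_eq_square)
  finally show ?thesis
    unfolding fs_def cinner_lift[OF assms(3)] by (simp add: cinner_insert_at[OF assms(3)] sum_less_2)
qed

text \<open>
  The numerator of the form on \<open>v\<close> is \<open>|v|\<^sup>2 + |u\<^sub>0 v\<^sub>1 - u\<^sub>1 v\<^sub>0|\<^sup>2\<close>, by Lagrange's identity.
\<close>

lemma fs_matrix_positive:
  assumes "v \<in> carrier_vec 2" "v \<noteq> 0\<^sub>v 2"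
  shows "0 < Re (herm (fs_matrix u) v v)"
proof -
  define q where "q = (cmod (v $ 0))\<^sup>2 + (cmod (v $ 1))\<^sup>2 + (cmod (u 0 * v $ 1 - u 1 * v $ 0))\<^sup>2"
  define s where "s = 1 + (\<Sum>k<2. (cmod (u k))\<^sup>2)"
  have "v $ 0 \<noteq> 0 \<or> v $ 1 \<noteq> 0"
    using assms by (auto simp: less_2_cases_iff intro!: eq_vecI)
  then have "0 < (cmod (v $ 0))\<^sup>2 \<or> 0 < (cmod (v $ 1))\<^sup>2"
    by simp
  then have "0 < q"
    using zero_le_power2[of "cmod (v $ 0)"] zero_le_power2[of "cmod (v $ 1)"]
      zero_le_power2[of "cmod (u 0 * v $ 1 - u 1 * v $ 0)"]
    unfolding q_def by linarith
  have s: "sqn u = of_real s" "0 < s"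
    using sqn_pos[of u] by (auto simp: sqn_real s_def)
  have "herm (fs_matrix u) v v * (sqn u)\<^sup>2 =
      v $ 0 * cnj (v $ 0) + v $ 1 * cnj (v $ 1) +
      (u 0 * v $ 1 - u 1 * v $ 0) * cnj (u 0 * v $ 1 - u 1 * v $ 0)"
  proof -
    have "herm (fs_matrix u) v v * (sqn u)\<^sup>2 =
       sqn u * (v $ 0 * cnj (v $ 0) + v $ 1 * cnj (v $ 1)) -
       (v $ 0 * cnj (u 0) + v $ 1 * cnj (u 1)) * (u 0 * cnj (v $ 0) + u 1 * cnj (v $ 1))"
      unfolding herm_fs_matrix[OF assms(1,1), of 0, simplified] fs_def cinner_lift[of 0, simplified]
      using sqn_nonzero[of u] by (simp add: cinner_insert_at sum_less_2)
    then show ?thesis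
      by (simp add: sqn_def sum_less_2 algebra_simps)
  qed
  also have "\<dots> = of_real q"
    by (simp add: q_def complex_norm_square del: of_real_power)
  finally have "herm (fs_matrix u) v v = of_real (q / s\<^sup>2)"
    using s by (simp add: field_simps)
  then show ?thesis
    using s \<open>0 < q\<close> by simp
qed

lemma lift_affine_coords:
  assumes "i < 3" "a < 3" "p \<in> patch i"
  shows "lift i (affine_coords i p) a = ratio a i p"
  using assms(2,1)
proof (cases rule: skip_cases)
  case 1
  then show ?thesis using assms(3) by (simp add: ratio_def patch_def)
qed (simp add: affine_coords_def)

lemma jacobian_carrier: "jacobian n c d p \<in> carrier_mat n n"
  by (simp add: jacobian_def)

lemma jacobian_affine:
  assumes i: "i < 3" and j: "j < 3" and p: "p \<in> patch i \<inter> patch j" and ab: "a < 2" "b < 2"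
  shows "jacobian 2 (affine_chart i) (affine_chart j) p $$ (a, b) =
    dratio (lift j (affine_coords j p)) (insert_at j 0 (unit_coord b)) i (skip i a)"
proof -
  define x where "x = affine_coords j p"
  have x: "x \<in> cspace 2"
    by (simp add: x_def affine_coords_cspace)
  have nz: "lift j x i \<noteq> 0"
    using p j i by (simp add: proj_in_patch[symmetric] lift_homogeneous x_def proj_lift_coords)
  have "in_chart (affine_chart j) (\<lambda>q. snd (affine_chart i) q a) (x(b := z)) =
      lift j (x(b := z)) (skip i a) / lift j (x(b := z)) i" for z
  proof -
    have "x(b := z) \<in> cspace 2" using x ab by (auto simp: cspace_def)
    then show ?thesis
      using ab(1) i by (simp add: in_affine_chart[OF j])
        (simp add: affine_chart_def affine_coords_def ratio_proj lift_homogeneous j skip_less)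
  qed
  then have "cpartial b (in_chart (affine_chart j) (\<lambda>q. snd (affine_chart i) q a)) x =
      dratio (lift j x) (insert_at j 0 (unit_coord b)) i (skip i a)"
    unfolding cpartial_def by (simp add: DERIV_imp_deriv[OF ratio_derivative[OF nz]])
  then show ?thesis
    using ab by (simp add: jacobian_def x_def affine_chart_def)
qed

lemma dratio_linear:
  "dratio Z (\<lambda>a. \<Sum>b\<in>B. V b a * v b) i a = (\<Sum>b\<in>B. dratio Z (V b) i a * v b)"
  by (simp add: dratio_def sum_distrib_left sum_distrib_right sum_subtractf[symmetric]
      sum_divide_distrib algebra_simps)

lemma insert_at_expand:
  assumes "j < 3" "a < 3"
  shows "(\<Sum>b<2. insert_at j 0 (unit_coord b) a * v b) = insert_at j 0 v a"
  unfolding insert_at_unit using assms(2,1)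
  by (cases rule: skip_cases) (auto simp: skip_eq_iff skip_neq[symmetric] sum_less_2 less_2_cases_iff)

lemma dratio_cong:
  "V a = V' a \<Longrightarrow> V i = V' i \<Longrightarrow> dratio Z V i a = dratio Z V' i a"
  by (simp add: dratio_def)

text \<open>
  In homogeneous terms, the Jacobian of a change of patches is the passage from the representative
  \<open>Z\<close> to \<open>Z / Z\<^sub>i\<close>, to which \<open>fs_invariant\<close> applies.
\<close>

lemma jacobian_affine_mult:
  assumes i: "i < 3" and j: "j < 3" and p: "p \<in> patch i \<inter> patch j"
    and v: "v \<in> carrier_vec 2" and a: "a < 3"
  shows "insert_at i 0 (vec_index (jacobian 2 (affine_chart i) (affine_chart j) p *\<^sub>v v)) a =
    dratio (lift j (affine_coords j p)) (insert_at j 0 (vec_index v)) i a"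
  using a i
proof (cases rule: skip_cases)
  case 1
  then show ?thesis by (simp add: dratio_def)
next
  case (2 k)
  let ?J = "jacobian 2 (affine_chart i) (affine_chart j) p"
  have "(?J *\<^sub>v v) $ k = (\<Sum>b<2. ?J $$ (k, b) * v $ b)"
    by (rule mult_mat_vec_index[OF _ v 2(1)]) (simp add: jacobian_def)
  also have "\<dots> = (\<Sum>b<2. dratio (lift j (affine_coords j p)) (insert_at j 0 (unit_coord b)) i a * v $ b)"
    using 2 by (intro sum.cong) (simp_all add: jacobian_affine[OF i j p])
  also have "\<dots> = dratio (lift j (affine_coords j p)) (insert_at j 0 (vec_index v)) i a"
    unfolding dratio_linear[symmetric]
    by (rule dratio_cong) (simp_all add: insert_at_expand[OF j a] insert_at_expand[OF j i])
  finally show ?thesis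
    using 2 by simp
qed

lemma fs_matrix_transform:
  assumes i: "i < 3" and j: "j < 3" and p: "p \<in> patch i \<inter> patch j"
    and v: "v \<in> carrier_vec 2" and w: "w \<in> carrier_vec 2"
  shows "herm (fs_matrix (affine_coords i p)) (jacobian 2 (affine_chart i) (affine_chart j) p *\<^sub>v v)
      (jacobian 2 (affine_chart i) (affine_chart j) p *\<^sub>v w) =
    herm (fs_matrix (affine_coords j p)) v w"
proof -
  let ?J = "jacobian 2 (affine_chart i) (affine_chart j) p"
  let ?Z = "lift j (affine_coords j p)"
  have Jv: "?J *\<^sub>v v \<in> carrier_vec 2" "?J *\<^sub>v w \<in> carrier_vec 2"
    using v w by (auto intro: mult_mat_vec_carrier[OF jacobian_carrier])
  have nz: "?Z i \<noteq> 0"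
    using p j i by (simp add: proj_in_patch[symmetric] lift_homogeneous proj_lift_coords)
  have Z: "lift i (affine_coords i p) a = ?Z a / ?Z i" if "a < 3" for a
  proof -
    have "ratio a i p = ratio a i (proj ?Z)"
      using p by (simp add: proj_lift_coords[OF j])
    then show ?thesis
      using that i p by (simp add: lift_affine_coords ratio_proj lift_homogeneous[OF j])
  qed
  have "herm (fs_matrix (affine_coords i p)) (?J *\<^sub>v v) (?J *\<^sub>v w) =
      fs (\<lambda>a. ?Z a / ?Z i) (dratio ?Z (insert_at j 0 (vec_index v)) i)
        (dratio ?Z (insert_at j 0 (vec_index w)) i)"
    unfolding herm_fs_matrix[OF Jv i]
    by (rule fs_cong) (simp_all only: Z jacobian_affine_mult[OF i j p] v w)
  also have "\<dots> = fs ?Z (insert_at j 0 (vec_index v)) (insert_at j 0 (vec_index w))"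
    by (rule fs_invariant[of ?Z i]) (simp_all add: nz cinner_lift j sqn_nonzero)
  finally show ?thesis
    by (simp add: herm_fs_matrix[OF v w j])
qed

context
  fixes M :: "'p cmanifold" and W
  assumes M: "complex_manifold M" and W: "openin (mtop M) W"
begin

lemma chart_image_open:
  assumes "c \<in> atlas M"
  shows "openin (top_of_set (cspace (mdim M))) (snd c ` (fst c \<inter> W))"
  using M W assms by (auto simp: complex_manifold_def intro: is_chart_image_open)

lemma smooth_fun_const: "smooth_fun M W (\<lambda>p. c)"
  by (auto simp: smooth_fun_def in_chart_def intro: smooth_fun_on_const chart_image_open)

lemma smooth_fun_cnj: "smooth_fun M W f \<Longrightarrow> smooth_fun M W (\<lambda>p. cnj (f p))"
  by (auto simp: smooth_fun_def in_chart_def intro: smooth_fun_on_cnj chart_image_open)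

lemma smooth_fun_add: "smooth_fun M W f \<Longrightarrow> smooth_fun M W g \<Longrightarrow> smooth_fun M W (\<lambda>p. f p + g p)"
  by (auto simp: smooth_fun_def in_chart_def intro: smooth_fun_on_add chart_image_open)

lemma smooth_fun_diff: "smooth_fun M W f \<Longrightarrow> smooth_fun M W g \<Longrightarrow> smooth_fun M W (\<lambda>p. f p - g p)"
  by (auto simp: smooth_fun_def in_chart_def intro: smooth_fun_on_diff chart_image_open)

lemma smooth_fun_mult: "smooth_fun M W f \<Longrightarrow> smooth_fun M W g \<Longrightarrow> smooth_fun M W (\<lambda>p. f p * g p)"
  by (auto simp: smooth_fun_def in_chart_def intro: smooth_fun_on_mult chart_image_open)

lemma smooth_fun_divide:
  assumes f: "smooth_fun M W f" and g: "smooth_fun M W g" and nz: "\<And>p. p \<in> W \<Longrightarrow> g p \<noteq> 0"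
  shows "smooth_fun M W (\<lambda>p. f p / g p)"
  unfolding smooth_fun_def
proof
  fix c assume c: "c \<in> atlas M"
  then have chart: "is_chart (mtop M) (mdim M) c"
    using M by (simp add: complex_manifold_def)
  have "smooth_fun_on (mdim M) (snd c ` (fst c \<inter> W)) (\<lambda>x. in_chart c f x / in_chart c g x)"
    by (rule smooth_fun_on_divide[OF chart_image_open[OF c]])
      (use f g c nz in \<open>auto simp: smooth_fun_def in_chart_apply[OF chart]\<close>)
  then show "smooth_fun_on (mdim M) (snd c ` (fst c \<inter> W)) (in_chart c (\<lambda>p. f p / g p))"
    by (simp add: in_chart_def)
qed

end

lemma smooth_fun_ratio:
  assumes i: "i < 3" and a: "a < 3"
  shows "smooth_fun plane (patch i) (ratio a i)"
  unfolding smooth_fun_def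
proof
  fix c assume c: "c \<in> atlas plane"
  then obtain j where j: "j < 3" "c = affine_chart j" by auto
  have S: "openin (top_of_set (cspace 2)) (snd c ` (fst c \<inter> patch i))"
    using chart_image_open[OF complex_manifold_plane _ c] openin_patch by simp
  have eq: "snd c ` (fst c \<inter> patch i) = {x \<in> cspace 2. proj (lift j x) \<in> patch i}"
    by (simp add: j affine_chart_def affine_coords_image)
  have ins: "smooth_fun_on 2 (snd c ` (fst c \<inter> patch i)) (\<lambda>x. lift j x e)" for e
    unfolding insert_at_def
    by (cases "e = j"; cases "e < j") (auto intro: smooth_fun_on_const[OF S] smooth_fun_on_coord[OF S])
  have "smooth_fun_on 2 (snd c ` (fst c \<inter> patch i)) (in_chart c (ratio a i))"
  proof (rule smooth_fun_on_cong[OF S])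
    have "lift j x i \<noteq> 0" if "x \<in> snd c ` (fst c \<inter> patch i)" for x
      using that i j unfolding eq by (simp add: proj_in_patch lift_homogeneous)
    then show "smooth_fun_on 2 (snd c ` (fst c \<inter> patch i)) (\<lambda>x. lift j x a / lift j x i)"
      by (intro smooth_fun_on_divide[OF S ins ins])
    fix x assume "x \<in> snd c ` (fst c \<inter> patch i)"
    then show "lift j x a / lift j x i = in_chart c (ratio a i) x"
      unfolding eq using j i a by (simp add: in_affine_chart ratio_proj lift_homogeneous)
  qed
  then show "smooth_fun_on (mdim plane) (snd c ` (fst c \<inter> patch i)) (in_chart c (ratio a i))"
    by simp
qed

lemma smooth_fun_affine_coords:
  assumes i: "i < 3" and k: "k < 2"
  shows "smooth_fun plane (patch i) (\<lambda>p. affine_coords i p k)"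
  using smooth_fun_ratio[OF i skip_less[OF k]] k by (simp add: affine_coords_def)

lemmas plane_smooth_intros =
  smooth_fun_const[OF complex_manifold_plane] smooth_fun_cnj[OF complex_manifold_plane]
  smooth_fun_add[OF complex_manifold_plane] smooth_fun_diff[OF complex_manifold_plane]
  smooth_fun_mult[OF complex_manifold_plane] smooth_fun_divide[OF complex_manifold_plane]

lemma smooth_fun_sqn:
  assumes i: "i < 3"
  shows "smooth_fun plane (patch i) (\<lambda>p. sqn (affine_coords i p))"
  unfolding sqn_def sum_less_2
  by (intro plane_smooth_intros smooth_fun_affine_coords i) (auto simp: openin_patch)

lemma has_wirt_coord: "has_wirt i (\<lambda>x. x k) (if k = i then 1 else 0) 0 x"
  by (cases "k = i") (auto simp: has_wirt_def)

lemma has_wirt_sqn: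
  assumes "m < 2"
  shows "has_wirt m sqn (cnj (x m)) (x m) x"
proof -
  have "has_wirt m (\<lambda>x. 1 + (\<Sum>k<2. x k * cnj (x k)))
      (0 + (\<Sum>k<2. (if k = m then 1 else 0) * cnj (x k) + x k * cnj 0))
      (0 + (\<Sum>k<2. 0 * cnj (x k) + x k * cnj (if k = m then 1 else 0))) x"
    by (intro has_wirt_add has_wirt_const has_wirt_sum has_wirt_mult has_wirt_cnj has_wirt_coord)
  moreover have "(\<lambda>x. 1 + (\<Sum>k<2. x k * cnj (x k))) = sqn"
    by (simp add: sqn_def fun_eq_iff)
  ultimately show ?thesis
    using assms by (auto simp: sum_less_2 less_2_cases_iff)
qed

text \<open>
  The coefficient is symmetric in \<open>k\<close> and \<open>m\<close>, which is closedness of the fundamental form.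
\<close>

lemma has_wirt_fs_matrix:
  assumes "k < 2" "l < 2" "m < 2"
  shows "\<exists>b. has_wirt m (\<lambda>x. fs_matrix x $$ (l, k))
    (2 * cnj (x k) * x l * cnj (x m) / (sqn x) ^ 3 -
      ((if l = k then 1 else 0) * cnj (x m) + (if l = m then 1 else 0) * cnj (x k)) / (sqn x)\<^sup>2) b x"
proof -
  let ?d = "\<lambda>i j. if i = j then 1 else 0 :: complex"
  have "(\<lambda>x. fs_matrix x $$ (l, k)) = (\<lambda>x. ?d l k / sqn x - cnj (x k) * x l / (sqn x * sqn x))"
    using assms by (simp add: fs_matrix_def power2_eq_square)
  moreover have "has_wirt m (\<lambda>x. ?d l k / sqn x - cnj (x k) * x l / (sqn x * sqn x))
     ((0 * sqn x - ?d l k * cnj (x m)) / (sqn x)\<^sup>2 -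
       ((cnj 0 * x l + cnj (x k) * ?d l m) * (sqn x * sqn x) -
          cnj (x k) * x l * (cnj (x m) * sqn x + sqn x * cnj (x m))) / (sqn x * sqn x)\<^sup>2)
     ((0 * sqn x - ?d l k * x m) / (sqn x)\<^sup>2 -
       ((cnj (?d k m) * x l + cnj (x k) * 0) * (sqn x * sqn x) -
          cnj (x k) * x l * (x m * sqn x + sqn x * x m)) / (sqn x * sqn x)\<^sup>2) x"
    by (intro has_wirt_diff has_wirt_divide has_wirt_mult has_wirt_cnj has_wirt_coord has_wirt_const
        has_wirt_sqn assms) (simp_all add: sqn_nonzero)
  moreover have "(0 * sqn x - ?d l k * cnj (x m)) / (sqn x)\<^sup>2 -
       ((cnj 0 * x l + cnj (x k) * ?d l m) * (sqn x * sqn x) -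
          cnj (x k) * x l * (cnj (x m) * sqn x + sqn x * cnj (x m))) / (sqn x * sqn x)\<^sup>2 =
    2 * cnj (x k) * x l * cnj (x m) / (sqn x) ^ 3 - (?d l k * cnj (x m) + ?d l m * cnj (x k)) / (sqn x)\<^sup>2"
    using sqn_nonzero[of x] by (simp add: field_simps power2_eq_square power3_eq_cube)
  ultimately show ?thesis
    by auto
qed

lemma openin_cspace: "openin (top_of_set (cspace n)) (cspace n)"
  by simp

lemma kaehler_metric_fs: "kaehler_metric plane (\<lambda>c p. fs_matrix (snd c p))"
  unfolding kaehler_metric_def
proof
  show "hermitian_metric plane (tangent_bundle plane) (\<lambda>c p. fs_matrix (snd c p))"
    unfolding hermitian_metric_def
  proof (intro conjI ballI allI impI)
    fix c p assume "c \<in> vidx (tangent_bundle plane)"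
    show "fs_matrix (snd c p) \<in> carrier_mat (vrank (tangent_bundle plane)) (vrank (tangent_bundle plane))"
      by (simp add: fs_matrix_def tangent_bundle_def)
    fix v :: "complex vec" assume v: "v \<in> carrier_vec (vrank (tangent_bundle plane))"
    show "0 < Re (herm (fs_matrix (snd c p)) v v)" if "v \<noteq> 0\<^sub>v (vrank (tangent_bundle plane))"
      using fs_matrix_positive v that by (simp add: tangent_bundle_def)
    fix w :: "complex vec" assume "w \<in> carrier_vec (vrank (tangent_bundle plane))"
    with v show "herm (fs_matrix (snd c p)) w v = cnj (herm (fs_matrix (snd c p)) v w)"
      by (simp add: tangent_bundle_def herm_fs_matrix[where i = 0] fs_def cinner_commute[of "insert_at _ _ (vec_index w)"]
          cinner_commute[of "lift 0 _" "insert_at 0 0 (vec_index v)"] cinner_lift mult.commute)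
  next
    fix c a b assume "c \<in> vidx (tangent_bundle plane)"
      and ab: "a < vrank (tangent_bundle plane)" "b < vrank (tangent_bundle plane)"
    then obtain i where i: "i < 3" "c = affine_chart i"
      by (auto simp: tangent_bundle_def)
    show "smooth_fun plane (vcov (tangent_bundle plane) c) (\<lambda>p. fs_matrix (snd c p) $$ (a, b))"
    proof -
      have ab': "a < 2" "b < 2"
        using ab by (simp_all add: tangent_bundle_def)
      have "smooth_fun plane (patch i) (\<lambda>p. (if a = b then 1 else 0) / sqn (affine_coords i p) -
          cnj (affine_coords i p b) * affine_coords i p a / (sqn (affine_coords i p) * sqn (affine_coords i p)))"
        by (intro plane_smooth_intros smooth_fun_affine_coords smooth_fun_sqn i(1) ab')
          (simp_all add: openin_patch sqn_nonzero)
      moreover have "(\<lambda>p. fs_matrix (snd c p) $$ (a, b)) =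
          (\<lambda>p. (if a = b then 1 else 0) / sqn (affine_coords i p) -
          cnj (affine_coords i p b) * affine_coords i p a / (sqn (affine_coords i p) * sqn (affine_coords i p)))"
        using ab' by (simp add: fs_matrix_def i(2) affine_chart_def power2_eq_square)
      ultimately have "smooth_fun plane (patch i) (\<lambda>p. fs_matrix (snd c p) $$ (a, b))"
        by (simp only:)
      then show ?thesis
        by (simp add: tangent_bundle_def i(2) affine_chart_def)
    qed
  next
    fix c d p and v w :: "complex vec" assume cd: "c \<in> vidx (tangent_bundle plane)" "d \<in> vidx (tangent_bundle plane)"
      and p: "p \<in> vcov (tangent_bundle plane) c \<inter> vcov (tangent_bundle plane) d"
      and v: "v \<in> carrier_vec (vrank (tangent_bundle plane))"
      and w: "w \<in> carrier_vec (vrank (tangent_bundle plane))"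
    obtain i where i: "i < 3" "c = affine_chart i"
      using cd by (auto simp: tangent_bundle_def)
    obtain j where j: "j < 3" "d = affine_chart j"
      using cd by (auto simp: tangent_bundle_def)
    show "herm (fs_matrix (snd c p)) (vtrans (tangent_bundle plane) c d p *\<^sub>v v)
        (vtrans (tangent_bundle plane) c d p *\<^sub>v w) = herm (fs_matrix (snd d p)) v w"
      using fs_matrix_transform[OF i(1) j(1), of p v w] p v w
      by (simp add: tangent_bundle_def i(2) j(2)) (simp add: affine_chart_def)
  qed
next
  show "\<forall>c\<in>atlas plane. \<forall>p\<in>fst c. \<forall>k<mdim plane. \<forall>l<mdim plane. \<forall>m<mdim plane.
      wirt m (in_chart c (\<lambda>q. fs_matrix (snd c q) $$ (l, k))) (snd c p) =
      wirt k (in_chart c (\<lambda>q. fs_matrix (snd c q) $$ (l, m))) (snd c p)"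
  proof (intro ballI allI impI)
    fix c p k l m assume c: "c \<in> atlas plane"
      and klm: "k < mdim plane" "l < mdim plane" "m < mdim plane"
    obtain i where i: "i < 3" "c = affine_chart i"
      using c by auto
    let ?x = "affine_coords i p"
    have eq: "in_chart c (\<lambda>q. fs_matrix (snd c q) $$ (l, k)) y = fs_matrix y $$ (l, k)"
      if "y \<in> cspace 2" for y k
      using that i(1) by (simp add: i(2) in_affine_chart) (simp add: affine_chart_def affine_coords_lift)
    have D: "wirt m (in_chart c (\<lambda>q. fs_matrix (snd c q) $$ (l, k))) ?x =
        2 * cnj (?x k) * ?x l * cnj (?x m) / (sqn ?x) ^ 3 -
        ((if l = k then 1 else 0) * cnj (?x m) + (if l = m then 1 else 0) * cnj (?x k)) / (sqn ?x)\<^sup>2"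
      if m: "m < 2" and k: "k < 2" for m k
    proof -
      obtain b where b: "has_wirt m (\<lambda>x. fs_matrix x $$ (l, k))
          (2 * cnj (?x k) * ?x l * cnj (?x m) / (sqn ?x) ^ 3 -
            ((if l = k then 1 else 0) * cnj (?x m) + (if l = m then 1 else 0) * cnj (?x k)) / (sqn ?x)\<^sup>2) b ?x"
        using has_wirt_fs_matrix[of k l m ?x] klm m k by auto
      show ?thesis
        by (rule has_wirt_imp(1), rule has_wirt_cong[OF openin_cspace affine_coords_cspace m _ b])
          (rule eq[symmetric])
    qed
    have x: "snd c p = ?x"
      by (simp add: i(2) affine_chart_def)
    have km: "k < 2" "m < 2"
      using klm by simp_all
    show "wirt m (in_chart c (\<lambda>q. fs_matrix (snd c q) $$ (l, k))) (snd c p) =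
        wirt k (in_chart c (\<lambda>q. fs_matrix (snd c q) $$ (l, m))) (snd c p)"
      unfolding x D[OF km(2,1)] D[OF km] by (simp only: mult_ac add_ac)
  qed
qed

lemma compact_kaehler_plane: "compact_kaehler_manifold plane"
  using complex_manifold_plane kaehler_metric_fs compact_P2 connected_P2
  by (auto simp: compact_kaehler_manifold_def compact_space_subtopology connected_space_subtopology)


section \<open>The hyperplane bundle and the tangent bundle\<close>

lemma ratio_self: "p \<in> patch i \<Longrightarrow> ratio i i p = 1"
  by (simp add: ratio_def patch_def)

lemma patch_cases:
  assumes "p \<in> patch i" "i < 3"
  obtains Z where "Z \<in> homogeneous" "p = proj Z" "Z i \<noteq> 0"
proof -
  obtain Z where Z: "Z \<in> homogeneous" "p = proj Z"
    using assms(1) patch_subset P2_cases by blast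
  then show ?thesis
    using that assms by (simp add: proj_in_patch)
qed

lemma ratio_mult:
  assumes "p \<in> patch j" "i < 3" "j < 3" "a < 3"
  shows "ratio a j p * ratio j i p = ratio a i p"
proof -
  obtain Z where "Z \<in> homogeneous" "p = proj Z" "Z j \<noteq> 0"
    using patch_cases[OF assms(1,3)] .
  then show ?thesis
    using assms by (simp add: ratio_proj)
qed

lemma ratio_nonzero:
  assumes "p \<in> patch i" "p \<in> patch j" "i < 3" "j < 3"
  shows "ratio i j p \<noteq> 0"
proof -
  obtain Z where "Z \<in> homogeneous" "p = proj Z" "Z j \<noteq> 0"
    using patch_cases[OF assms(2,4)] .
  then show ?thesis
    using assms by (simp add: ratio_proj proj_in_patch)
qed

definition hyperplane_bundle :: "(nat, nat \<Rightarrow> complex) vbundle" where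
  "hyperplane_bundle =
     \<lparr>vrank = 1, vidx = {..<3}, vcov = patch, vtrans = (\<lambda>i j p. mat 1 1 (\<lambda>_. ratio j i p))\<rparr>"

definition hyperplane_metric :: "nat \<Rightarrow> (nat \<Rightarrow> complex) \<Rightarrow> complex mat" where
  "hyperplane_metric i p = mat 1 1 (\<lambda>_. 1 / sqn (affine_coords i p))"

lemma hyperplane_bundle_simps [simp]:
  "vrank hyperplane_bundle = 1" "vidx hyperplane_bundle = {..<3}" "vcov hyperplane_bundle = patch"
  "vtrans hyperplane_bundle i j p = mat 1 1 (\<lambda>_. ratio j i p)"
  by (simp_all add: hyperplane_bundle_def)

lemma openin_patch_Int: "openin (top_of_set P2) (patch i \<inter> patch j)"
  by (intro openin_Int openin_patch)

lemma holomorphic_hyperplane_bundle: "holomorphic_vector_bundle plane hyperplane_bundle"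
  unfolding holomorphic_vector_bundle_def
proof (intro conjI ballI allI impI)
  fix i j k p assume "i \<in> vidx hyperplane_bundle" "j \<in> vidx hyperplane_bundle" "k \<in> vidx hyperplane_bundle"
    and p: "p \<in> vcov hyperplane_bundle i \<inter> vcov hyperplane_bundle j \<inter> vcov hyperplane_bundle k"
  then show "vtrans hyperplane_bundle i j p * vtrans hyperplane_bundle j k p = vtrans hyperplane_bundle i k p"
    using ratio_mult[of p j i k] by (auto simp: scalar_prod_def mult.commute intro!: eq_matI)
next
  fix i j a b assume "i \<in> vidx hyperplane_bundle" "j \<in> vidx hyperplane_bundle"
    "a < vrank hyperplane_bundle" "b < vrank hyperplane_bundle"
  then show "holo_fun plane (vcov hyperplane_bundle i \<inter> vcov hyperplane_bundle j)
      (\<lambda>p. vtrans hyperplane_bundle i j p $$ (a, b))"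
    using holo_fun_ratio[OF openin_patch_Int, of i j i j] by simp
qed (auto simp: openin_patch P2_eq_patches[symmetric] ratio_self intro!: eq_matI)

text \<open>
  The vectors \<open>\<xi>\<close> with \<open>\<Sum> Z\<^sub>a \<xi>\<^sub>a = 0\<close> form a bundle of rank two over the plane, the bundle of
  one-forms twisted by \<open>O(1)\<close>. Over the patch \<open>i\<close>, such a vector is determined by its entries other
  than \<open>\<xi>\<^sub>i\<close>, and this function restores \<open>\<xi>\<close> from them.
\<close>

definition perp_lift :: "nat \<Rightarrow> (nat \<Rightarrow> complex) \<Rightarrow> (nat \<Rightarrow> complex) \<Rightarrow> (nat \<Rightarrow> complex)" where
  "perp_lift i p x = insert_at i (- (\<Sum>k<2. ratio (skip i k) i p * x k)) x"

text \<open>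
  Twisting once more by \<open>O(2)\<close>, where the frame over the patch \<open>i\<close> is \<open>Z\<^sub>i\<^sup>2\<close>, gives the twisted
  cotangent bundle \<open>\<Omega>(3)\<close>. As the canonical bundle is \<open>O(-3)\<close>, this is the tangent bundle.
\<close>

definition twisted_cotangent :: "(nat, nat \<Rightarrow> complex) vbundle" where
  "twisted_cotangent =
     \<lparr>vrank = 2, vidx = {..<3}, vcov = patch,
      vtrans = (\<lambda>i j p. mat 2 2 (\<lambda>(a, b). perp_lift j p (unit_coord b) (skip i a) / (ratio i j p)\<^sup>2))\<rparr>"

text \<open>
  The matrix of \<open>|\<xi>|\<^sup>2 / |Z|\<^sup>4\<close>, in the coordinates \<open>u\<close> of the patch. The exponent four compensates
  the degree two of \<open>\<xi>\<close>.
\<close>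

definition perp_matrix :: "(nat \<Rightarrow> complex) \<Rightarrow> complex mat" where
  "perp_matrix u = mat 2 2 (\<lambda>(a, b). ((if a = b then 1 else 0) + cnj (u a) * u b) / (sqn u * sqn u))"

definition perp_metric :: "nat \<Rightarrow> (nat \<Rightarrow> complex) \<Rightarrow> complex mat" where
  "perp_metric i p = perp_matrix (affine_coords i p)"

lemma twisted_cotangent_simps [simp]:
  "vrank twisted_cotangent = 2" "vidx twisted_cotangent = {..<3}" "vcov twisted_cotangent = patch"
  "vtrans twisted_cotangent i j p =
    mat 2 2 (\<lambda>(a, b). perp_lift j p (unit_coord b) (skip i a) / (ratio i j p)\<^sup>2)"
  by (simp_all add: twisted_cotangent_def)

lemma perp_lift_cong:
  assumes "\<And>k. k < 2 \<Longrightarrow> x k = y k" "i < 3" "a < 3"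
  shows "perp_lift i p x a = perp_lift i p y a"
  using assms(3,2) by (cases rule: skip_cases) (simp_all add: perp_lift_def assms(1))

lemma perp_lift_skip: "perp_lift i p x (skip i k) = x k"
  by (simp add: perp_lift_def)

lemma perp_lift_expand:
  assumes "i < 3" "a < 3"
  shows "(\<Sum>b<2. perp_lift i p (unit_coord b) a * v b) = perp_lift i p v a"
  using assms(2,1)
  by (cases rule: skip_cases)
    (auto simp: perp_lift_def sum_less_2 less_2_cases_iff algebra_simps)

lemma perp_lift_orthogonal:
  assumes "p \<in> patch i" "i < 3"
  shows "(\<Sum>a<3. ratio a i p * perp_lift i p x a) = 0"
  unfolding sum_skip[OF assms(2)] using assms by (simp add: perp_lift_skip ratio_self) (simp add: perp_lift_def)

lemma perp_lift_restore:
  assumes i: "i < 3" and p: "p \<in> patch i" and orth: "(\<Sum>a<3. ratio a i p * \<xi> a) = 0" and a: "a < 3"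
  shows "perp_lift i p (\<lambda>k. \<xi> (skip i k)) a = \<xi> a"
  using a i
proof (cases rule: skip_cases)
  case 1
  then show ?thesis
    using orth p unfolding sum_skip[OF i]
    by (simp add: perp_lift_def ratio_self) (metis add.inverse_unique add.commute)
qed (simp add: perp_lift_skip)

text \<open>
  The vector \<open>\<xi>\<close> restored from its entries in the patch \<open>j\<close> is orthogonal to \<open>Z\<close> regardless of the
  patch, so that its entries in the patch \<open>i\<close> restore the same vector. The cocycle condition and the
  invariance of the metric both come down to this.
\<close>

lemma perp_lift_change:
  assumes i: "i < 3" and j: "j < 3" and p: "p \<in> patch i \<inter> patch j" and a: "a < 3"
  shows "perp_lift i p (\<lambda>k. perp_lift j p x (skip i k) / c) a = perp_lift j p x a / c"
proof (rule perp_lift_restore[OF i _ _ a])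
  have "(\<Sum>a<3. ratio a i p * (perp_lift j p x a / c)) =
      (\<Sum>a<3. ratio a j p * perp_lift j p x a) * (ratio j i p / c)"
    unfolding sum_distrib_right
  proof (rule sum.cong)
    fix b assume "b \<in> {..<3::nat}"
    then have "ratio b i p = ratio b j p * ratio j i p"
      using ratio_mult[of p j i b] p i j by simp
    then show "ratio b i p * (perp_lift j p x b / c) = ratio b j p * perp_lift j p x b * (ratio j i p / c)"
      by simp
  qed simp
  then show "(\<Sum>a<3. ratio a i p * (perp_lift j p x a / c)) = 0"
    using perp_lift_orthogonal[of p j x] p j by simp
qed (use p in simp)

lemma twisted_cotangent_mult:
  assumes i: "i < 3" and j: "j < 3" and v: "v \<in> carrier_vec 2" and a: "a < 2"
  shows "(vtrans twisted_cotangent i j p *\<^sub>v v) $ a =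
    perp_lift j p (vec_index v) (skip i a) / (ratio i j p)\<^sup>2"
proof -
  have "(vtrans twisted_cotangent i j p *\<^sub>v v) $ a =
      (\<Sum>b<2. vtrans twisted_cotangent i j p $$ (a, b) * v $ b)"
    by (rule mult_mat_vec_index[OF _ v a]) simp
  also have "\<dots> = (\<Sum>b<2. perp_lift j p (unit_coord b) (skip i a) * v $ b) / (ratio i j p)\<^sup>2"
    using a by (simp add: sum_divide_distrib)
  finally show ?thesis
    by (simp add: perp_lift_expand[OF j skip_less[OF a]])
qed

lemma mat_mult_col:
  assumes "A \<in> carrier_mat n n" "B \<in> carrier_mat n n" "a < n" "b < n"
  shows "(A * B) $$ (a, b) = (A *\<^sub>v col B b) $ a"
  using assms by auto

lemma holomorphic_twisted_cotangent: "holomorphic_vector_bundle plane twisted_cotangent"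
  unfolding holomorphic_vector_bundle_def
proof (intro conjI ballI allI impI)
  fix i j k p assume "i \<in> vidx twisted_cotangent" "j \<in> vidx twisted_cotangent" "k \<in> vidx twisted_cotangent"
    and "p \<in> vcov twisted_cotangent i \<inter> vcov twisted_cotangent j \<inter> vcov twisted_cotangent k"
  then have ijk: "i < 3" "j < 3" "k < 3" and p: "p \<in> patch i" "p \<in> patch j" "p \<in> patch k"
    by auto
  show "vtrans twisted_cotangent i j p * vtrans twisted_cotangent j k p = vtrans twisted_cotangent i k p"
  proof (rule eq_matI)
    fix a c assume "a < dim_row (vtrans twisted_cotangent i k p)" "c < dim_col (vtrans twisted_cotangent i k p)"
    then have ac: "a < 2" "c < 2" by simp_all
    have "(vtrans twisted_cotangent i j p * vtrans twisted_cotangent j k p) $$ (a, c) =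
        (vtrans twisted_cotangent i j p *\<^sub>v col (vtrans twisted_cotangent j k p) c) $ a"
      by (rule mat_mult_col[of _ 2]) (use ac in simp_all)
    also have "\<dots> = perp_lift j p (vec_index (col (vtrans twisted_cotangent j k p) c)) (skip i a) / (ratio i j p)\<^sup>2"
      by (rule twisted_cotangent_mult[OF ijk(1,2) _ ac(1)]) (use ac in simp)
    also have "perp_lift j p (vec_index (col (vtrans twisted_cotangent j k p) c)) (skip i a) =
        perp_lift j p (\<lambda>b. perp_lift k p (unit_coord c) (skip j b) / (ratio j k p)\<^sup>2) (skip i a)"
      using ac ijk by (intro perp_lift_cong skip_less) auto
    also have "\<dots> = perp_lift k p (unit_coord c) (skip i a) / (ratio j k p)\<^sup>2"
      using p ijk ac by (intro perp_lift_change skip_less) auto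
    also have "\<dots> / (ratio i j p)\<^sup>2 = perp_lift k p (unit_coord c) (skip i a) / (ratio i k p)\<^sup>2"
      using ratio_mult[OF p(2), of k i] ijk by (simp add: power_mult_distrib[symmetric] mult.commute)
    finally show "(vtrans twisted_cotangent i j p * vtrans twisted_cotangent j k p) $$ (a, c) =
        vtrans twisted_cotangent i k p $$ (a, c)"
      using ac by simp
  qed auto
next
  fix i j a b assume ij: "i \<in> vidx twisted_cotangent" "j \<in> vidx twisted_cotangent"
    and ab: "a < vrank twisted_cotangent" "b < vrank twisted_cotangent"
  have r: "holo_fun plane (patch i \<inter> patch j) (ratio e j)" if "e < 3" for e
    using ij that by (intro holo_fun_ratio openin_patch_Int) auto
  have "holo_fun plane (patch i \<inter> patch j) (\<lambda>p. perp_lift j p (unit_coord b) (skip i a))"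
  proof (cases "skip i a = j")
    case True
    then have "perp_lift j p (unit_coord b) (skip i a) = - ratio (skip j b) j p" for p
      using ab by (auto simp: perp_lift_def sum_less_2 less_2_cases_iff)
    then show ?thesis
      using holo_fun_minus[OF r[OF skip_less]] ab by simp
  next
    case False
    then have "perp_lift j p (unit_coord b) (skip i a) = insert_at j 0 (unit_coord b) (skip i a)" for p
      by (simp add: perp_lift_def insert_at_def)
    then show ?thesis
      by (simp add: holo_fun_const)
  qed
  then have "holo_fun plane (patch i \<inter> patch j)
      (\<lambda>p. perp_lift j p (unit_coord b) (skip i a) / (ratio i j p * ratio i j p))"
    using ij ratio_nonzero
    by (intro holo_fun_divide[OF complex_manifold_plane] holo_fun_mult r) auto
  then show "holo_fun plane (vcov twisted_cotangent i \<inter> vcov twisted_cotangent j)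
      (\<lambda>p. vtrans twisted_cotangent i j p $$ (a, b))"
    using ab by (simp add: power2_eq_square)
qed (auto simp: openin_patch P2_eq_patches[symmetric] ratio_self perp_lift_skip intro!: eq_matI)


section \<open>The metrics on the two bundles\<close>

text \<open>
  \<open>1 + |u|\<^sup>2 = |Z|\<^sup>2 / |Z\<^sub>i|\<^sup>2\<close> in the patch \<open>i\<close>.
\<close>

lemma sqn_change:
  assumes p: "p \<in> patch i" "p \<in> patch j" and ij: "i < 3" "j < 3"
  shows "sqn (affine_coords j p) = sqn (affine_coords i p) * (ratio i j p * cnj (ratio i j p))"
proof -
  have "cinner (lift j (affine_coords j p)) (lift j (affine_coords j p)) =
      cinner (\<lambda>a. ratio i j p * lift i (affine_coords i p) a) (\<lambda>a. ratio i j p * lift i (affine_coords i p) a)"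
    using p ij ratio_mult[OF p(1) ij(2,1)]
    by (intro cinner_cong) (simp_all add: lift_affine_coords mult.commute)
  then show ?thesis
    using ij by (simp add: cinner_scale_left cinner_scale_right cinner_lift)
qed

lemma herm_rank_one: "herm (mat 1 1 (\<lambda>_. c)) v w = c * v $ 0 * cnj (w $ 0)"
  if "v \<in> carrier_vec 1" "w \<in> carrier_vec 1"
  using that by (simp add: herm_eq_sum[of _ 1])

lemma hermitian_hyperplane_metric: "hermitian_metric plane hyperplane_bundle hyperplane_metric"
  unfolding hermitian_metric_def
proof (intro conjI ballI allI impI)
  fix i p and v w :: "complex vec"
  show "hyperplane_metric i p \<in> carrier_mat (vrank hyperplane_bundle) (vrank hyperplane_bundle)"
    by (simp add: hyperplane_metric_def)
  assume v: "v \<in> carrier_vec (vrank hyperplane_bundle)"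
  show "0 < Re (herm (hyperplane_metric i p) v v)" if "v \<noteq> 0\<^sub>v (vrank hyperplane_bundle)"
  proof -
    have "v $ 0 \<noteq> 0"
      using v that by (auto intro!: eq_vecI)
    moreover have "herm (hyperplane_metric i p) v v =
        of_real ((cmod (v $ 0))\<^sup>2 / (1 + (\<Sum>k<2. (cmod (affine_coords i p k))\<^sup>2)))"
      using v unfolding hyperplane_metric_def hyperplane_bundle_simps
      by (subst herm_rank_one) (simp_all add: sqn_real complex_norm_square[symmetric] del: of_real_power)
    ultimately show ?thesis
      using sqn_pos[of "affine_coords i p"] by (simp only: Re_complex_of_real) simp
  qed
  assume w: "w \<in> carrier_vec (vrank hyperplane_bundle)"
  show "herm (hyperplane_metric i p) w v = cnj (herm (hyperplane_metric i p) v w)"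
    unfolding hyperplane_metric_def herm_rank_one[OF v[unfolded hyperplane_bundle_simps] w[unfolded hyperplane_bundle_simps]]
      herm_rank_one[OF w[unfolded hyperplane_bundle_simps] v[unfolded hyperplane_bundle_simps]] by simp
next
  fix i a b assume "i \<in> vidx hyperplane_bundle" and ab: "a < vrank hyperplane_bundle" "b < vrank hyperplane_bundle"
  then have i: "i < 3" by simp
  have "smooth_fun plane (patch i) (\<lambda>p. 1 / sqn (affine_coords i p))"
    by (intro plane_smooth_intros smooth_fun_sqn i) (simp_all add: openin_patch sqn_nonzero)
  then show "smooth_fun plane (vcov hyperplane_bundle i) (\<lambda>p. hyperplane_metric i p $$ (a, b))"
    using ab by (simp add: hyperplane_metric_def)
next
  fix i j p and v w :: "complex vec"
  assume ij: "i \<in> vidx hyperplane_bundle" "j \<in> vidx hyperplane_bundle"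
    and p: "p \<in> vcov hyperplane_bundle i \<inter> vcov hyperplane_bundle j"
    and v: "v \<in> carrier_vec (vrank hyperplane_bundle)" and w: "w \<in> carrier_vec (vrank hyperplane_bundle)"
  have gv: "(vtrans hyperplane_bundle i j p *\<^sub>v x) $ 0 = ratio j i p * x $ 0" if "x \<in> carrier_vec 1" for x
    using mult_mat_vec_index[of "vtrans hyperplane_bundle i j p" 1 1 x 0] that by simp
  have "herm (hyperplane_metric i p) (vtrans hyperplane_bundle i j p *\<^sub>v v) (vtrans hyperplane_bundle i j p *\<^sub>v w)
      = 1 / sqn (affine_coords i p) * (ratio j i p * v $ 0) * cnj (ratio j i p * w $ 0)"
  proof -
    have "vtrans hyperplane_bundle i j p \<in> carrier_mat 1 1" by simp
    note gc = mult_mat_vec_carrier[OF this]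
    show ?thesis
      unfolding hyperplane_metric_def herm_rank_one[OF gc[OF v[unfolded hyperplane_bundle_simps]]
          gc[OF w[unfolded hyperplane_bundle_simps]]]
        gv[OF v[unfolded hyperplane_bundle_simps]] gv[OF w[unfolded hyperplane_bundle_simps]] ..
  qed
  also have "\<dots> = 1 / sqn (affine_coords j p) * v $ 0 * cnj (w $ 0)"
    using sqn_change[of p j i] sqn_nonzero[of "affine_coords i p"] sqn_nonzero[of "affine_coords j p"] ij p
    by (simp add: field_simps)
  finally show "herm (hyperplane_metric i p) (vtrans hyperplane_bundle i j p *\<^sub>v v)
      (vtrans hyperplane_bundle i j p *\<^sub>v w) = herm (hyperplane_metric j p) v w"
    unfolding hyperplane_metric_def herm_rank_one[OF v[unfolded hyperplane_bundle_simps] w[unfolded hyperplane_bundle_simps]] .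
qed

lemma herm_perp_matrix:
  assumes "v \<in> carrier_vec 2" "w \<in> carrier_vec 2"
  shows "herm (perp_matrix u) v w =
    (v $ 0 * cnj (w $ 0) + v $ 1 * cnj (w $ 1) +
      (u 0 * v $ 0 + u 1 * v $ 1) * cnj (u 0 * w $ 0 + u 1 * w $ 1)) / (sqn u * sqn u)"
  using assms
  by (simp add: herm_eq_sum[of _ 2] perp_matrix_def sum_less_2) (simp add: divide_inverse algebra_simps)

lemma herm_perp_metric:
  assumes v: "v \<in> carrier_vec 2" and w: "w \<in> carrier_vec 2" and i: "i < 3"
  shows "herm (perp_metric i p) v w =
    cinner (perp_lift i p (vec_index v)) (perp_lift i p (vec_index w)) /
      (sqn (affine_coords i p) * sqn (affine_coords i p))"
  unfolding perp_metric_def herm_perp_matrix[OF v w] perp_lift_def cinner_insert_at[OF i]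
  by (simp add: sum_less_2 affine_coords_def) (simp add: algebra_simps)

lemma hermitian_perp_metric: "hermitian_metric plane twisted_cotangent perp_metric"
  unfolding hermitian_metric_def
proof (intro conjI ballI allI impI)
  fix i p and v w :: "complex vec"
  show "perp_metric i p \<in> carrier_mat (vrank twisted_cotangent) (vrank twisted_cotangent)"
    by (simp add: perp_metric_def perp_matrix_def)
  assume "v \<in> carrier_vec (vrank twisted_cotangent)"
  then have v: "v \<in> carrier_vec 2" by simp
  show "0 < Re (herm (perp_metric i p) v v)" if "v \<noteq> 0\<^sub>v (vrank twisted_cotangent)"
  proof -
    let ?u = "affine_coords i p"
    define q where "q = (cmod (v $ 0))\<^sup>2 + (cmod (v $ 1))\<^sup>2 + (cmod (?u 0 * v $ 0 + ?u 1 * v $ 1))\<^sup>2"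
    define s where "s = 1 + (\<Sum>k<2. (cmod (?u k))\<^sup>2)"
    have "v $ 0 \<noteq> 0 \<or> v $ 1 \<noteq> 0"
      using v that by (auto simp: less_2_cases_iff intro!: eq_vecI)
    then have "0 < (cmod (v $ 0))\<^sup>2 \<or> 0 < (cmod (v $ 1))\<^sup>2"
      by simp
    then have "0 < q"
      using zero_le_power2[of "cmod (v $ 0)"] zero_le_power2[of "cmod (v $ 1)"]
        zero_le_power2[of "cmod (?u 0 * v $ 0 + ?u 1 * v $ 1)"]
      unfolding q_def by linarith
    moreover have "herm (perp_metric i p) v v = of_real (q / (s * s))"
      unfolding perp_metric_def herm_perp_matrix[OF v v] q_def s_def
      by (simp add: sqn_real complex_norm_square del: of_real_power)
    ultimately show ?thesis
      using sqn_pos[of ?u] unfolding s_def[symmetric] by simp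
  qed
  assume "w \<in> carrier_vec (vrank twisted_cotangent)"
  then have w: "w \<in> carrier_vec 2" by simp
  show "herm (perp_metric i p) w v = cnj (herm (perp_metric i p) v w)"
    unfolding perp_metric_def herm_perp_matrix[OF v w] herm_perp_matrix[OF w v]
    by (simp add: mult.commute)
next
  fix i a b assume "i \<in> vidx twisted_cotangent" and "a < vrank twisted_cotangent" "b < vrank twisted_cotangent"
  then have i: "i < 3" and ab: "a < 2" "b < 2" by simp_all
  have "smooth_fun plane (patch i) (\<lambda>p. ((if a = b then 1 else 0) + cnj (affine_coords i p a) * affine_coords i p b) /
      (sqn (affine_coords i p) * sqn (affine_coords i p)))"
    by (intro plane_smooth_intros smooth_fun_sqn smooth_fun_affine_coords i ab)
      (simp_all add: openin_patch sqn_nonzero)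
  moreover have "(\<lambda>p. perp_metric i p $$ (a, b)) =
      (\<lambda>p. ((if a = b then 1 else 0) + cnj (affine_coords i p a) * affine_coords i p b) /
      (sqn (affine_coords i p) * sqn (affine_coords i p)))"
    using ab by (simp add: perp_metric_def perp_matrix_def)
  ultimately show "smooth_fun plane (vcov twisted_cotangent i) (\<lambda>p. perp_metric i p $$ (a, b))"
    by (simp only: twisted_cotangent_simps)
next
  fix i j p and v w :: "complex vec"
  assume "i \<in> vidx twisted_cotangent" "j \<in> vidx twisted_cotangent"
    and "p \<in> vcov twisted_cotangent i \<inter> vcov twisted_cotangent j"
    and "v \<in> carrier_vec (vrank twisted_cotangent)" and "w \<in> carrier_vec (vrank twisted_cotangent)"
  then have ij: "i < 3" "j < 3" and p: "p \<in> patch i" "p \<in> patch j"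
    and v: "v \<in> carrier_vec 2" and w: "w \<in> carrier_vec 2"
    by simp_all
  let ?g = "vtrans twisted_cotangent i j p" and ?r = "ratio i j p"
  have g: "?g \<in> carrier_mat 2 2" by simp
  have gc: "?g *\<^sub>v v \<in> carrier_vec 2" "?g *\<^sub>v w \<in> carrier_vec 2"
    using mult_mat_vec_carrier[OF g v] mult_mat_vec_carrier[OF g w] by simp_all
  have gx: "perp_lift i p (vec_index (?g *\<^sub>v x)) a = (1 / ?r\<^sup>2) * perp_lift j p (vec_index x) a"
    if "a < 3" "x \<in> carrier_vec 2" for a x
  proof -
    have "perp_lift i p (vec_index (?g *\<^sub>v x)) a =
        perp_lift i p (\<lambda>k. perp_lift j p (vec_index x) (skip i k) / ?r\<^sup>2) a"
      using twisted_cotangent_mult[OF ij that(2)] ij that(1) by (intro perp_lift_cong) auto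
    then show ?thesis
      using perp_lift_change[of i j p a] p ij that(1) by simp
  qed
  have "cinner (perp_lift i p (vec_index (?g *\<^sub>v v))) (perp_lift i p (vec_index (?g *\<^sub>v w))) =
      cinner (\<lambda>a. (1 / ?r\<^sup>2) * perp_lift j p (vec_index v) a) (\<lambda>a. (1 / ?r\<^sup>2) * perp_lift j p (vec_index w) a)"
    by (rule cinner_cong) (simp_all only: gx v w)
  then show "herm (perp_metric i p) (?g *\<^sub>v v) (?g *\<^sub>v w) = herm (perp_metric j p) v w"
    unfolding herm_perp_metric[OF gc ij(1)] herm_perp_metric[OF v w ij(2)]
      cinner_scale_left cinner_scale_right sqn_change[OF p ij]
    using ratio_nonzero[OF p ij] sqn_nonzero[of "affine_coords i p"]
    by (simp add: field_simps power2_eq_square)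
qed


section \<open>Curvature\<close>

lemma mat_inverse_eqI:
  fixes A :: "'a :: field mat"
  assumes A: "A \<in> carrier_mat n n" and B: "B \<in> carrier_mat n n" and AB: "A * B = 1\<^sub>m n" and BA: "B * A = 1\<^sub>m n"
  shows "the (mat_inverse A) = B"
proof (cases "mat_inverse A")
  case None
  have "A \<in> Units (ring_mat TYPE('a) n ())"
    using assms by (auto simp: Units_def ring_mat_def)
  with mat_inverse(1)[OF A None, of "()"] show ?thesis by blast
next
  case (Some C)
  then have C: "C * A = 1\<^sub>m n" "C \<in> carrier_mat n n"
    using mat_inverse(2)[OF A Some] by auto
  have "C = C * (A * B)"
    using AB C by simp
  also have "\<dots> = (C * A) * B"
    by (rule assoc_mult_mat[OF C(2) A B, symmetric])
  also have "\<dots> = B"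
    using B C by simp
  finally show ?thesis
    by (simp add: Some)
qed

lemma has_wirt_sqn_comp:
  assumes "\<And>a. a < 2 \<Longrightarrow> has_wirt m (\<lambda>y. u y a) (D a) 0 x"
  shows "has_wirt m (\<lambda>y. sqn (u y)) (\<Sum>e<2. cnj (u x e) * D e) (\<Sum>e<2. u x e * cnj (D e)) x"
proof -
  have "has_wirt m (\<lambda>y. 1 + (\<Sum>e<2. u y e * cnj (u y e)))
      (0 + (\<Sum>e<2. D e * cnj (u x e) + u x e * cnj 0))
      (0 + (\<Sum>e<2. 0 * cnj (u x e) + u x e * cnj (D e))) x"
    by (intro has_wirt_add has_wirt_const has_wirt_sum has_wirt_mult has_wirt_cnj assms) simp_all
  then show ?thesis
    by (simp add: sqn_def mult.commute)
qed

text \<open>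
  The curvature coefficient of the metric \<open>1 / (1 + |u|\<^sup>2)\<close>: the Fubini-Study form of the tangent
  vectors \<open>d\<close> and \<open>d'\<close> in affine coordinates.
\<close>

definition fs_coeff :: "(nat \<Rightarrow> complex) \<Rightarrow> (nat \<Rightarrow> complex) \<Rightarrow> (nat \<Rightarrow> complex) \<Rightarrow> complex" where
  "fs_coeff u d d' =
    ((\<Sum>e<2. d e * cnj (d' e)) * sqn u - (\<Sum>e<2. cnj (u e) * d e) * (\<Sum>e<2. u e * cnj (d' e))) / (sqn u)\<^sup>2"

text \<open>
  The functions \<open>u\<close> stand for the affine coordinates of some patch, expressed in a chart that need
  not be the one of the patch. All that is used of them is that they are holomorphic with holomorphic
  derivatives \<open>D\<close>, so that the curvature is computed at once for all pairs of a chart and a frame.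
\<close>

context
  fixes n S and u :: "(nat \<Rightarrow> complex) \<Rightarrow> nat \<Rightarrow> complex" and D :: "nat \<Rightarrow> nat \<Rightarrow> (nat \<Rightarrow> complex) \<Rightarrow> complex"
  assumes S: "openin (top_of_set (cspace n)) S"
    and u: "\<And>m a y. m < n \<Longrightarrow> a < 2 \<Longrightarrow> y \<in> S \<Longrightarrow> has_wirt m (\<lambda>y. u y a) (D m a y) 0 y"
    and D: "\<And>m l a y. m < n \<Longrightarrow> l < n \<Longrightarrow> a < 2 \<Longrightarrow> y \<in> S \<Longrightarrow> \<exists>c. has_wirt l (D m a) c 0 y"
begin

lemma has_wirt_trace:
  assumes "k < n" "l < n" "x \<in> S"
  shows "\<exists>c. has_wirt l (\<lambda>y. \<Sum>e<2. cnj (u y e) * D k e y) c (\<Sum>e<2. D k e x * cnj (D l e x)) x"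
proof -
  obtain c where c: "\<And>a. a < 2 \<Longrightarrow> has_wirt l (D k a) (c a) 0 x"
    using D[OF assms(1,2) _ assms(3)] by metis
  have "has_wirt l (\<lambda>y. \<Sum>e<2. cnj (u y e) * D k e y)
      (\<Sum>e<2. cnj 0 * D k e x + cnj (u x e) * c e) (\<Sum>e<2. cnj (D l e x) * D k e x + cnj (u x e) * 0) x"
    by (intro has_wirt_sum has_wirt_mult has_wirt_cnj u c assms) simp_all
  then show ?thesis
    by (auto simp: mult.commute)
qed

lemma curvature_line_metric:
  assumes kl: "k < n" "l < n" and x: "x \<in> S"
    and H: "\<And>y. y \<in> S \<Longrightarrow> H y = mat 1 1 (\<lambda>_. 1 / sqn (u y))"
  shows "chern_curvature 1 H k l x $$ (0, 0) = fs_coeff (u x) (\<lambda>a. D k a x) (\<lambda>a. D l a x)"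
proof -
  have conn: "chern_connection 1 H k y $$ (0, 0) = - ((\<Sum>e<2. cnj (u y e) * D k e y) / sqn (u y))"
    if y: "y \<in> S" for y
  proof -
    have "has_wirt k (\<lambda>y. 1 / sqn (u y))
        ((0 * sqn (u y) - 1 * (\<Sum>e<2. cnj (u y e) * D k e y)) / (sqn (u y))\<^sup>2)
        ((0 * sqn (u y) - 1 * (\<Sum>e<2. u y e * cnj (D k e y))) / (sqn (u y))\<^sup>2) y"
      by (intro has_wirt_divide has_wirt_const has_wirt_sqn_comp u kl y sqn_nonzero)
    then have "wirt k (\<lambda>y. H y $$ (0, 0)) y = - (\<Sum>e<2. cnj (u y e) * D k e y) / (sqn (u y))\<^sup>2"
      by (intro has_wirt_imp(1)[OF has_wirt_cong[OF S y kl(1)]]) (auto simp: H)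
    moreover have "the (mat_inverse (H y)) = mat 1 1 (\<lambda>_. sqn (u y))"
      by (rule mat_inverse_eqI[of _ 1]) (auto simp: H[OF y] sqn_nonzero scalar_prod_def intro!: eq_matI)
    ultimately show ?thesis
      using sqn_nonzero[of "u y"] by (simp add: chern_connection_def scalar_prod_def power2_eq_square)
  qed
  obtain c where c: "has_wirt l (\<lambda>y. \<Sum>e<2. cnj (u y e) * D k e y) c (\<Sum>e<2. D k e x * cnj (D l e x)) x"
    using has_wirt_trace[OF kl x] by blast
  have "has_wirt l (\<lambda>y. 0 - (\<Sum>e<2. cnj (u y e) * D k e y) / sqn (u y))
      (0 - (c * sqn (u x) - (\<Sum>e<2. cnj (u x e) * D k e x) * (\<Sum>e<2. cnj (u x e) * D l e x)) / (sqn (u x))\<^sup>2)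
      (0 - fs_coeff (u x) (\<lambda>a. D k a x) (\<lambda>a. D l a x)) x"
    unfolding fs_coeff_def
    by (intro has_wirt_diff has_wirt_const has_wirt_divide c has_wirt_sqn_comp u kl x sqn_nonzero)
  then have "wirt_bar l (\<lambda>y. chern_connection 1 H k y $$ (0, 0)) x =
      0 - fs_coeff (u x) (\<lambda>a. D k a x) (\<lambda>a. D l a x)"
    by (intro has_wirt_imp(2)[OF has_wirt_cong[OF S x kl(2)]]) (auto simp: conn[simplified])
  then show ?thesis
    by (simp add: chern_curvature_def)
qed

text \<open>
  Up to the scalar factor, the metric matrix is \<open>I + u\<^sup>* u\<close> with \<open>u\<close> holomorphic, and
  \<open>(I + u\<^sup>* u)\<^sup>-\<^sup>1 u\<^sup>* = u\<^sup>* / (1 + |u|\<^sup>2)\<close>; hence the connection matrix has this simple form.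
\<close>

lemma connection_perp_matrix:
  assumes k: "k < n" and y: "y \<in> S" and ab: "a < 2" "b < 2"
    and H: "\<And>y. y \<in> S \<Longrightarrow> H y = perp_matrix (u y)"
  shows "chern_connection 2 H k y $$ (a, b) = cnj (u y a) * D k b y / sqn (u y) -
    (if a = b then 2 else 0) * ((\<Sum>e<2. cnj (u y e) * D k e y) / sqn (u y))"
proof -
  define s where "s = sqn (u y)"
  define t where "t = (\<Sum>e<2. cnj (u y e) * D k e y)"
  have s: "s \<noteq> 0" and uu: "cnj (u y 0) * u y 0 = s - 1 - cnj (u y 1) * u y 1"
    by (simp_all add: s_def sqn_nonzero) (simp add: sqn_def sum_less_2)
  define dH where "dH c b = cnj (u y c) * D k b y / (s * s) -
      2 * ((if c = b then 1 else 0) + cnj (u y c) * u y b) * t / (s * s * s)" for c b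
  have dH: "wirt k (\<lambda>y. H y $$ (c, b)) y = dH c b" if "c < 2" "b < 2" for c b
  proof -
    let ?d = "if c = b then 1 else 0 :: complex"
    have sq: "has_wirt k (\<lambda>y. sqn (u y)) t (\<Sum>e<2. u y e * cnj (D k e y)) y"
      unfolding t_def by (intro has_wirt_sqn_comp u k y)
    have "has_wirt k (\<lambda>y. (?d + cnj (u y c) * u y b) / (sqn (u y) * sqn (u y)))
        (((0 + (cnj 0 * u y b + cnj (u y c) * D k b y)) * (sqn (u y) * sqn (u y)) -
          (?d + cnj (u y c) * u y b) * (t * sqn (u y) + sqn (u y) * t)) / (sqn (u y) * sqn (u y))\<^sup>2)
        (((0 + (cnj (D k c y) * u y b + cnj (u y c) * 0)) * (sqn (u y) * sqn (u y)) -
          (?d + cnj (u y c) * u y b) * ((\<Sum>e<2. u y e * cnj (D k e y)) * sqn (u y) +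
             sqn (u y) * (\<Sum>e<2. u y e * cnj (D k e y)))) / (sqn (u y) * sqn (u y))\<^sup>2) y"
      by (intro has_wirt_divide has_wirt_add has_wirt_const has_wirt_mult has_wirt_cnj sq u k y that)
        (simp add: sqn_nonzero)
    then have "wirt k (\<lambda>y. H y $$ (c, b)) y =
        ((0 + (cnj 0 * u y b + cnj (u y c) * D k b y)) * (s * s) -
          (?d + cnj (u y c) * u y b) * (t * s + s * t)) / (s * s)\<^sup>2"
      unfolding s_def using that
      by (intro has_wirt_imp(1)[OF has_wirt_cong[OF S y k]]) (auto simp: H perp_matrix_def)
    also have "\<dots> = dH c b"
      unfolding dH_def using s by (simp add: divide_simps power2_eq_square) (simp add: algebra_simps)
    finally show ?thesis .
  qed
  \<comment> \<open>The inverse of \<open>I + u\<^sup>* u\<close> is \<open>I - u\<^sup>* u / s\<close>.\<close>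
  let ?inv = "mat 2 2 (\<lambda>(a, c). (if a = c then s * s else 0) - s * cnj (u y a) * u y c)"
  have Hy: "H y = mat 2 2 (\<lambda>(a, b). ((if a = b then 1 else 0) + cnj (u y a) * u y b) / (s * s))"
    using H[OF y] by (simp add: perp_matrix_def s_def)
  have inv: "the (mat_inverse (H y)) = ?inv"
  proof (rule mat_inverse_eqI[of _ 2])
    show "H y * ?inv = 1\<^sub>m 2"
      unfolding Hy using s uu
      by (intro eq_matI) (auto simp: scalar_prod_def numeral_2_eq_2 less_Suc_eq field_simps)
    show "?inv * H y = 1\<^sub>m 2"
      unfolding Hy using s uu
      by (intro eq_matI) (auto simp: scalar_prod_def numeral_2_eq_2 less_Suc_eq field_simps)
  qed (simp_all add: Hy)
  have "chern_connection 2 H k y $$ (a, b) =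
      (\<Sum>c<2. ((if a = c then s * s else 0) - s * cnj (u y a) * u y c) * dH c b)"
    using ab by (simp add: chern_connection_def inv scalar_prod_def lessThan_atLeast0 dH)
  also have "\<dots> = s * s * dH a b - s * cnj (u y a) * (\<Sum>c<2. u y c * dH c b)"
    using ab(1) by (auto simp: sum_less_2 less_2_cases_iff algebra_simps)
  also have "(\<Sum>c<2. u y c * dH c b) = (s - 1) * D k b y / (s * s) - 2 * u y b * t / (s * s)"
  proof -
    have uu': "(\<Sum>c<2. u y c * cnj (u y c)) = s - 1"
      by (simp add: s_def sqn_def)
    have ub: "(\<Sum>c<2. u y c * (if c = b then 1 else 0)) = u y b"
      using ab(2) by (auto simp: sum_less_2 less_2_cases_iff)
    have "(\<Sum>c<2. u y c * dH c b) = (\<Sum>c<2. u y c * cnj (u y c)) * D k b y / (s * s) -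
        2 * ((\<Sum>c<2. u y c * (if c = b then 1 else 0)) + (\<Sum>c<2. u y c * cnj (u y c)) * u y b) * t / (s * s * s)"
      unfolding dH_def sum_less_2 by (simp only: divide_inverse ring_distribs mult_ac add_ac diff_diff_eq2 diff_add_eq add_diff_eq diff_diff_eq)
    also have "\<dots> = (s - 1) * D k b y / (s * s) - 2 * (s * u y b) * t / (s * s * s)"
      unfolding uu' ub by (simp add: algebra_simps)
    finally show ?thesis
      using s by simp
  qed
  also have "s * s * dH a b - s * cnj (u y a) * ((s - 1) * D k b y / (s * s) - 2 * u y b * t / (s * s)) =
      cnj (u y a) * D k b y / s - (if a = b then 2 else 0) * (t / s)"
    using s by (simp add: dH_def field_simps)
  finally show ?thesis
    by (simp add: s_def t_def)
qed

text \<open>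
  The first term is twice the curvature of \<open>O(1)\<close>, from the factor \<open>1 / |Z|\<^sup>4\<close>, and the second one,
  which is seminegative, that of the subbundle \<open>\<Omega>(1)\<close> of the trivial bundle.
\<close>

lemma curvature_perp_matrix:
  assumes kl: "k < n" "l < n" and x: "x \<in> S" and ab: "a < 2" "b < 2"
    and H: "\<And>y. y \<in> S \<Longrightarrow> H y = perp_matrix (u y)"
  shows "chern_curvature 2 H k l x $$ (a, b) =
    (if a = b then 2 else 0) * fs_coeff (u x) (\<lambda>a. D k a x) (\<lambda>a. D l a x) -
    D k b x * (cnj (D l a x) * sqn (u x) - cnj (u x a) * (\<Sum>e<2. u x e * cnj (D l e x))) / (sqn (u x))\<^sup>2"
proof -
  let ?d = "if a = b then 2 else 0 :: complex"
  obtain c where c: "has_wirt l (\<lambda>y. \<Sum>e<2. cnj (u y e) * D k e y) c (\<Sum>e<2. D k e x * cnj (D l e x)) x"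
    using has_wirt_trace[OF kl x] by blast
  obtain d where d: "has_wirt l (D k b) d 0 x"
    using D[OF kl ab(2) x] by blast
  have "has_wirt l (\<lambda>y. cnj (u y a) * D k b y / sqn (u y) - ?d * ((\<Sum>e<2. cnj (u y e) * D k e y) / sqn (u y)))
      (((cnj 0 * D k b x + cnj (u x a) * d) * sqn (u x) -
          cnj (u x a) * D k b x * (\<Sum>e<2. cnj (u x e) * D l e x)) / (sqn (u x))\<^sup>2 -
        (0 * ((\<Sum>e<2. cnj (u x e) * D k e x) / sqn (u x)) + ?d * ((c * sqn (u x) -
          (\<Sum>e<2. cnj (u x e) * D k e x) * (\<Sum>e<2. cnj (u x e) * D l e x)) / (sqn (u x))\<^sup>2)))
      (((cnj (D l a x) * D k b x + cnj (u x a) * 0) * sqn (u x) -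
          cnj (u x a) * D k b x * (\<Sum>e<2. u x e * cnj (D l e x))) / (sqn (u x))\<^sup>2 -
        (0 * ((\<Sum>e<2. cnj (u x e) * D k e x) / sqn (u x)) + ?d * fs_coeff (u x) (\<lambda>a. D k a x) (\<lambda>a. D l a x))) x"
    unfolding fs_coeff_def
    by (intro has_wirt_diff has_wirt_mult has_wirt_cnj has_wirt_const has_wirt_divide c d has_wirt_sqn_comp
        u kl x ab sqn_nonzero)
  then have "wirt_bar l (\<lambda>y. chern_connection 2 H k y $$ (a, b)) x =
      ((cnj (D l a x) * D k b x + cnj (u x a) * 0) * sqn (u x) -
          cnj (u x a) * D k b x * (\<Sum>e<2. u x e * cnj (D l e x))) / (sqn (u x))\<^sup>2 -
        (0 * ((\<Sum>e<2. cnj (u x e) * D k e x) / sqn (u x)) + ?d * fs_coeff (u x) (\<lambda>a. D k a x) (\<lambda>a. D l a x))"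
    by (intro has_wirt_imp(2)[OF has_wirt_cong[OF S x kl(2)]]) (auto simp: connection_perp_matrix[OF kl(1) _ ab H])
  then show ?thesis
    using ab by (simp add: chern_curvature_def algebra_simps)
qed

end

text \<open>
  In the notation of three-dimensional vector algebra, with \<open>Z = (1, u)\<close>, \<open>X = (- u v, v)\<close> and
  \<open>Y = Z \<times> (0, d)\<close>, the left-hand side is \<open>|X|\<^sup>2 |Y|\<^sup>2 - |X \<times> Y|\<^sup>2\<close>: as \<open>X Z = 0\<close>, the triple
  product \<open>X \<times> Y\<close> is \<open>Z (v d)\<close>.
\<close>

lemma lagrange_identity_perp:
  fixes u0 u1 v0 v1 d0 d1 :: complex
  defines "C \<equiv> - (u0 * v0 + u1 * v1) * cnj (u0 * d1 - u1 * d0) - v0 * cnj d1 + v1 * cnj d0"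
  shows "(v0 * cnj v0 + v1 * cnj v1 + (u0 * v0 + u1 * v1) * cnj (u0 * v0 + u1 * v1)) *
      (d0 * cnj d0 + d1 * cnj d1 + (u0 * d1 - u1 * d0) * cnj (u0 * d1 - u1 * d0)) -
      (1 + u0 * cnj u0 + u1 * cnj u1) * ((v0 * d0 + v1 * d1) * cnj (v0 * d0 + v1 * d1)) = C * cnj C"
  unfolding C_def by (simp add: algebra_simps)


lemma double_sum_less_2: "(\<Sum>k<2::nat. \<Sum>l<2::nat. (f k l :: complex)) = f 0 0 + f 0 1 + f 1 0 + f 1 1"
  by (simp add: sum_less_2)

lemma fs_coeff_eq:
  "fs_coeff u d d * (sqn u)\<^sup>2 =
    d 0 * cnj (d 0) + d 1 * cnj (d 1) + (u 0 * d 1 - u 1 * d 0) * cnj (u 0 * d 1 - u 1 * d 0)"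
proof -
  have "fs_coeff u d d * (sqn u)\<^sup>2 =
      (\<Sum>e<2. d e * cnj (d e)) * sqn u - (\<Sum>e<2. cnj (u e) * d e) * (\<Sum>e<2. u e * cnj (d e))"
    by (simp add: fs_coeff_def sqn_nonzero)
  then show ?thesis
    by (simp add: sqn_def sum_less_2 algebra_simps)
qed

text \<open>
  With \<open>d\<close> the combination of the derivatives by \<open>\<xi>\<close>, the form is
  \<open>((2 - t) P R - s |v d|\<^sup>2) / s\<^sup>4\<close>, where \<open>s = 1 + |u|\<^sup>2\<close>, \<open>P / s\<^sup>2\<close> is the squared norm of
  \<open>v\<close>, and \<open>R / s\<^sup>2\<close> the squared Fubini-Study norm of \<open>d\<close>. As \<open>s |v d|\<^sup>2 \<le> P R\<close> by
  \<open>lagrange_identity_perp\<close>, the numerator is at least \<open>(1 - t) P R\<close>.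
\<close>

lemma griffiths_perp_matrix:
  assumes A: "\<And>k l. k < 2 \<Longrightarrow> l < 2 \<Longrightarrow> A k l \<in> carrier_mat 2 2"
    and A_entry: "\<And>k l a b. k < 2 \<Longrightarrow> l < 2 \<Longrightarrow> a < 2 \<Longrightarrow> b < 2 \<Longrightarrow> A k l $$ (a, b) =
      (if a = b then 2 else 0) * fs_coeff u (D k) (D l) -
      D k b * (cnj (D l a) * sqn u - cnj (u a) * (\<Sum>e<2. u e * cnj (D l e))) / (sqn u)\<^sup>2"
    and B: "\<And>k l. k < 2 \<Longrightarrow> l < 2 \<Longrightarrow> B k l = (of_real t * fs_coeff u (D k) (D l)) \<cdot>\<^sub>m 1\<^sub>m 2"
    and t: "t \<le> 1"
  shows "griffiths_ge 2 2 (perp_matrix u) A B"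
  unfolding griffiths_ge_def
proof (intro allI ballI)
  fix \<xi> :: "nat \<Rightarrow> complex" and v :: "complex vec"
  assume v: "v \<in> carrier_vec 2"
  define s where "s = sqn u"
  have s: "s \<noteq> 0" "s = 1 + u 0 * cnj (u 0) + u 1 * cnj (u 1)"
    by (simp_all add: s_def sqn_nonzero) (simp add: sqn_def sum_less_2)
  define P where "P = v $ 0 * cnj (v $ 0) + v $ 1 * cnj (v $ 1) +
    (u 0 * v $ 0 + u 1 * v $ 1) * cnj (u 0 * v $ 0 + u 1 * v $ 1)"
  have herm_kl: "herm (perp_matrix u) ((A k l - B k l) *\<^sub>v v) v =
      (2 - of_real t) * fs_coeff u (D k) (D l) * P / (s * s) -
      (\<Sum>b<2. D k b * v $ b) * cnj (\<Sum>b<2. D l b * v $ b) / (s * s * s)"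
    if kl: "k < 2" "l < 2" for k l
  proof -
    let ?F = "fs_coeff u (D k) (D l)"
    let ?dv = "\<Sum>b<2. D k b * v $ b"
    define y where "y = (\<Sum>e<2. u e * cnj (D l e))"
    define m where "m a = (cnj (D l a) * s - cnj (u a) * y) / (s * s)" for a
    have AB: "A k l - B k l \<in> carrier_mat 2 2"
      by (simp add: B[OF kl] minus_carrier_mat)
    have w: "((A k l - B k l) *\<^sub>v v) $ a = (2 - of_real t) * ?F * v $ a - ?dv * m a" if a: "a < 2" for a
    proof -
      have "((A k l - B k l) *\<^sub>v v) $ a = (\<Sum>b<2. (A k l - B k l) $$ (a, b) * v $ b)"
        by (rule mult_mat_vec_index[OF AB v a])
      also have "\<dots> = (\<Sum>b<2. (if b = a then (2 - of_real t) * ?F * v $ b else 0) - D k b * v $ b * m a)"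
        using a A[OF kl] by (intro sum.cong) (auto simp: A_entry[OF kl a] B[OF kl] s_def m_def y_def power2_eq_square algebra_simps)
      also have "\<dots> = (2 - of_real t) * ?F * v $ a - ?dv * m a"
        using a by (simp add: sum_subtractf sum_distrib_right sum_divide_distrib)
      finally show ?thesis .
    qed
    have one_lt_2: "(1::nat) < 2" by simp
    have hm: "m 0 * cnj (v $ 0) + m 1 * cnj (v $ 1) +
        (u 0 * m 0 + u 1 * m 1) * cnj (u 0 * v $ 0 + u 1 * v $ 1) = cnj (\<Sum>b<2. D l b * v $ b) / s"
    proof -
      have y: "u 0 * cnj (D l 0) + u 1 * cnj (D l 1) = y"
        by (simp add: y_def sum_less_2)
      have "u 0 * m 0 + u 1 * m 1 = (y * s - (u 0 * cnj (u 0) + u 1 * cnj (u 1)) * y) / (s * s)"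
        unfolding m_def y[symmetric] by (simp add: divide_inverse algebra_simps)
      also have "\<dots> = y / (s * s)"
        using s(2) by (simp add: algebra_simps)
      finally have um: "u 0 * m 0 + u 1 * m 1 = y / (s * s)" .
      show ?thesis
        unfolding um unfolding m_def using s(1) by (simp add: field_simps sum_less_2)
    qed
    have "herm (perp_matrix u) ((A k l - B k l) *\<^sub>v v) v =
        ((2 - of_real t) * ?F * P - ?dv * (m 0 * cnj (v $ 0) + m 1 * cnj (v $ 1) +
          (u 0 * m 0 + u 1 * m 1) * cnj (u 0 * v $ 0 + u 1 * v $ 1))) / (s * s)"
      unfolding herm_perp_matrix[OF mult_mat_vec_carrier[OF AB v] v] s_def[symmetric] w[OF pos2] w[OF one_lt_2]
        P_def
      by (simp add: ring_distribs mult_ac)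
    also have "\<dots> = (2 - of_real t) * ?F * P / (s * s) - ?dv * cnj (\<Sum>b<2. D l b * v $ b) / (s * s * s)"
      unfolding hm by (simp add: diff_divide_distrib mult_ac)
    finally show ?thesis .
  qed
  show "0 \<le> Re (\<Sum>k<2. \<Sum>l<2. \<xi> k * cnj (\<xi> l) * herm (perp_matrix u) ((A k l - B k l) *\<^sub>v v) v)"
  proof -
    define d where "d e = (\<Sum>k<2. \<xi> k * D k e)" for e
    define Q where "Q = v $ 0 * d 0 + v $ 1 * d 1"
    define R where "R = d 0 * cnj (d 0) + d 1 * cnj (d 1) + (u 0 * d 1 - u 1 * d 0) * cnj (u 0 * d 1 - u 1 * d 0)"
    define C where "C = - (u 0 * v $ 0 + u 1 * v $ 1) * cnj (u 0 * d 1 - u 1 * d 0) - v $ 0 * cnj (d 1) + v $ 1 * cnj (d 0)"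
    have F: "(\<Sum>k<2. \<Sum>l<2. \<xi> k * cnj (\<xi> l) * fs_coeff u (D k) (D l)) = R / (s * s)"
    proof -
      have "(\<Sum>k<2. \<Sum>l<2. \<xi> k * cnj (\<xi> l) * fs_coeff u (D k) (D l)) = fs_coeff u d d"
        unfolding fs_coeff_def d_def double_sum_less_2 sum_less_2 by (simp add: divide_inverse algebra_simps)
      also have "\<dots> = R / (s * s)"
        unfolding R_def fs_coeff_eq[symmetric] using s(1) by (simp add: s_def power2_eq_square)
      finally show ?thesis .
    qed
    have Q: "(\<Sum>k<2. \<Sum>l<2. \<xi> k * cnj (\<xi> l) * ((\<Sum>b<2. D k b * v $ b) * cnj (\<Sum>b<2. D l b * v $ b))) = Q * cnj Q"
      unfolding Q_def d_def double_sum_less_2 sum_less_2 by (simp add: algebra_simps)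
    have "(\<Sum>k<2. \<Sum>l<2. \<xi> k * cnj (\<xi> l) * herm (perp_matrix u) ((A k l - B k l) *\<^sub>v v) v) =
      (2 - of_real t) * P / (s * s) * (\<Sum>k<2. \<Sum>l<2. \<xi> k * cnj (\<xi> l) * fs_coeff u (D k) (D l)) -
      (\<Sum>k<2. \<Sum>l<2. \<xi> k * cnj (\<xi> l) * ((\<Sum>b<2. D k b * v $ b) * cnj (\<Sum>b<2. D l b * v $ b))) / (s * s * s)"
      unfolding double_sum_less_2 by (simp add: herm_kl) (simp add: divide_inverse algebra_simps)
    also have "\<dots> = (2 - of_real t) * P / (s * s) * (R / (s * s)) - Q * cnj Q / (s * s * s)"
      unfolding F Q ..
    also have "\<dots> = ((1 - of_real t) * (P * R) + (P * R - s * (Q * cnj Q))) / (s * s * s * s)"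
      using s(1) by (simp add: field_simps)
    also have "P * R - s * (Q * cnj Q) = C * cnj C"
      unfolding P_def R_def s(2) Q_def C_def by (rule lagrange_identity_perp)
    finally have sum: "(\<Sum>k<2. \<Sum>l<2. \<xi> k * cnj (\<xi> l) * herm (perp_matrix u) ((A k l - B k l) *\<^sub>v v) v) =
      ((1 - of_real t) * (P * R) + C * cnj C) / (s * s * s * s)" .
    define p where "p = (cmod (v $ 0))\<^sup>2 + (cmod (v $ 1))\<^sup>2 + (cmod (u 0 * v $ 0 + u 1 * v $ 1))\<^sup>2"
    define r where "r = (cmod (d 0))\<^sup>2 + (cmod (d 1))\<^sup>2 + (cmod (u 0 * d 1 - u 1 * d 0))\<^sup>2"
    define \<sigma> where "\<sigma> = 1 + (\<Sum>k<2. (cmod (u k))\<^sup>2)"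
    have real: "P = of_real p" "R = of_real r" "s = of_real \<sigma>" "C * cnj C = of_real ((cmod C)\<^sup>2)"
      unfolding P_def p_def R_def r_def s_def \<sigma>_def sqn_real complex_norm_square[symmetric] by simp_all
    have "0 \<le> p" "0 \<le> r" "0 < \<sigma>"
      unfolding p_def r_def \<sigma>_def using sqn_pos[of u] by simp_all
    then have "0 \<le> ((1 - t) * (p * r) + (cmod C)\<^sup>2) / (\<sigma> * \<sigma> * \<sigma> * \<sigma>)"
      using t by simp
    also have "\<dots> = Re (((1 - of_real t) * (P * R) + C * cnj C) / (s * s * s * s))"
    proof -
      have "((1 - of_real t) * (P * R) + C * cnj C) / (s * s * s * s) =
          of_real (((1 - t) * (p * r) + (cmod C)\<^sup>2) / (\<sigma> * \<sigma> * \<sigma> * \<sigma>))"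
        unfolding real by simp
      then show ?thesis
        by (simp only: Re_complex_of_real)
    qed
    finally show ?thesis
      unfolding sum .
  qed
qed


lemma open_chart_patch:
  assumes "c < 3"
  shows "openin (top_of_set (cspace 2)) {x \<in> cspace 2. proj (lift c x) \<in> patch i}"
proof -
  have "openin (top_of_set (cspace 2)) (snd (affine_chart c) ` (fst (affine_chart c) \<inter> patch i))"
    by (rule is_chart_image_open[OF is_chart_affine[OF assms] openin_patch])
  then show ?thesis
    by (simp add: affine_chart_def affine_coords_image[OF assms])
qed

lemma has_wirt_affine_coords:
  assumes c: "c < 3" and i: "i < 3" and m: "m < 2" and a: "a < 2"
    and y: "y \<in> {x \<in> cspace 2. proj (lift c x) \<in> patch i}"
  shows "has_wirt m (\<lambda>y. affine_coords i (proj (lift c y)) a)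
    (dratio (lift c y) (insert_at c 0 (unit_coord m)) i (skip i a)) 0 y"
proof -
  have nz: "lift c y i \<noteq> 0"
    using y c i by (simp add: proj_in_patch lift_homogeneous)
  have "has_wirt m (\<lambda>y. lift c y (skip i a) / lift c y i)
      (dratio (lift c y) (insert_at c 0 (unit_coord m)) i (skip i a)) 0 y"
    by (rule has_wirt_field_derivative[OF ratio_derivative[OF nz]])
  moreover have "(\<lambda>y. affine_coords i (proj (lift c y)) a) = (\<lambda>y. lift c y (skip i a) / lift c y i)"
    using a c i by (simp add: affine_coords_def ratio_proj lift_homogeneous skip_less)
  ultimately show ?thesis
    by (simp only:)
qed

lemma has_wirt_dratio:
  assumes "lift c y i \<noteq> 0"
  shows "\<exists>e. has_wirt l (\<lambda>y. dratio (lift c y) V i a) e 0 y"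
proof -
  have "(\<lambda>z. insert_at c 1 (y(l := z)) b) field_differentiable (at (y l))" for b
    unfolding field_differentiable_def by (rule exI, rule insert_at_derivative)
  then have "(\<lambda>z. dratio (lift c (y(l := z))) V i a) field_differentiable (at (y l))"
    unfolding dratio_def power2_eq_square using assms
    by (intro field_differentiable_divide field_differentiable_diff field_differentiable_mult
        field_differentiable_const) auto
  then show ?thesis
    unfolding field_differentiable_def by (blast intro: has_wirt_field_derivative)
qed

text \<open>
  The left-hand side is the Fubini-Study form at the representative \<open>Z / Z\<^sub>i\<close>.
\<close>

lemma fs_coeff_eq_fs:
  assumes i: "i < 3" and nz: "Z i \<noteq> 0" "cinner Z Z \<noteq> 0" and u: "\<And>a. a < 2 \<Longrightarrow> u a = Z (skip i a) / Z i"
  shows "fs_coeff u (\<lambda>a. dratio Z V i (skip i a)) (\<lambda>a. dratio Z W i (skip i a)) = fs Z V W"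
proof -
  have "fs (\<lambda>a. Z a / Z i) (dratio Z V i) (dratio Z W i) =
      fs_coeff u (\<lambda>a. dratio Z V i (skip i a)) (\<lambda>a. dratio Z W i (skip i a))"
    using nz(1) unfolding fs_def cinner_def sum_skip[OF i] fs_coeff_def sqn_def
    by (simp add: dratio_def[of _ _ i i] u sum_less_2) (simp add: mult_ac)
  then show ?thesis
    by (simp only: fs_invariant[OF nz])
qed

text \<open>
  The curvature of the hyperplane bundle is the Fubini-Study form whatever the patch in which it is
  computed, whence the comparison may be made in the patch \<open>i\<close> of the frame of \<open>\<Omega>(3)\<close>, although the
  frame of \<open>O(1)\<close> and the chart belong to other patches.
\<close>

lemma griffiths_twisted_cotangent:
  assumes t: "t \<le> 1"
  shows "griffiths_curvature_ge plane twisted_cotangent perp_metric t hyperplane_bundle hyperplane_metric"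
  unfolding griffiths_curvature_ge_def
proof (intro ballI)
  fix d i j p assume "d \<in> atlas plane" "i \<in> vidx twisted_cotangent" "j \<in> vidx hyperplane_bundle"
    and "p \<in> fst d \<inter> vcov twisted_cotangent i \<inter> vcov hyperplane_bundle j"
  then obtain c where c: "c < 3" "d = affine_chart c" and ij: "i < 3" "j < 3"
    and p: "p \<in> patch c" "p \<in> patch i" "p \<in> patch j"
    by (auto simp: affine_chart_def)
  define x where "x = affine_coords c p"
  define e where "e k = insert_at c 0 (unit_coord k)" for k
  define S where "S i = {x \<in> cspace 2. proj (lift c x) \<in> patch i}" for i
  define u where "u i y = affine_coords i (proj (lift c y))" for i y
  define D where "D i m a y = dratio (lift c y) (e m) i (skip i a)" for i m a y
  have px: "proj (lift c x) = p"
    by (simp add: x_def proj_lift_coords c p)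
  have xS: "x \<in> S i" if "p \<in> patch i" for i
    using that by (simp add: S_def px x_def affine_coords_cspace) (simp add: x_def[symmetric] px)
  have opS: "openin (top_of_set (cspace 2)) (S i)" for i
    unfolding S_def by (rule open_chart_patch[OF c(1)])
  have lift_nz: "lift c y i \<noteq> 0" if "y \<in> S i" "i < 3" for y i
    using that c(1) by (simp add: S_def proj_in_patch lift_homogeneous)
  have uD: "has_wirt m (\<lambda>y. u i y a) (D i m a y) 0 y" if "m < 2" "a < 2" "y \<in> S i" "i < 3" for i m a y
    unfolding u_def D_def e_def using has_wirt_affine_coords[OF c(1) that(4,1,2)] that(3) by (simp add: S_def)
  have DD: "\<exists>b. has_wirt l (D i m a) b 0 y" if "y \<in> S i" "i < 3" for i m l a y
    unfolding D_def by (rule has_wirt_dratio[OF lift_nz[OF that]])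
  have F: "fs_coeff (u i x) (\<lambda>a. D i k a x) (\<lambda>a. D i l a x) = fs (lift c x) (e k) (e l)"
    if "i < 3" "p \<in> patch i" for i k l
    unfolding D_def
  proof (rule fs_coeff_eq_fs[where Z = "lift c x" and i = i])
    show "i < 3" "lift c x i \<noteq> 0"
      by (rule that(1), rule lift_nz[OF xS[OF that(2)] that(1)])
    show "cinner (lift c x) (lift c x) \<noteq> 0"
      by (simp add: cinner_lift c sqn_nonzero)
    show "u i x a = lift c x (skip i a) / lift c x i" if "a < 2" for a
      using that \<open>i < 3\<close> c(1)
      by (simp add: u_def) (simp add: affine_coords_def ratio_proj lift_homogeneous skip_less)
  qed
  have mE: "in_chart d (perp_metric i) y = perp_matrix (u i y)" if "y \<in> S i" for y
    using that c by (simp add: in_affine_chart S_def perp_metric_def u_def)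
  have mL: "in_chart d (hyperplane_metric j) y = mat 1 1 (\<lambda>_. 1 / sqn (u j y))" if "y \<in> S j" for y
    using that c by (simp add: in_affine_chart S_def hyperplane_metric_def u_def)
  have xd: "snd d p = x"
    by (simp add: c affine_chart_def x_def)
  have pm: "perp_metric i p = perp_matrix (u i x)"
    by (simp add: perp_metric_def u_def px)
  show "griffiths_ge (mdim plane) (vrank twisted_cotangent) (perp_metric i p)
      (curvature_at twisted_cotangent perp_metric d i p)
      (\<lambda>k l. (of_real t * curvature_at hyperplane_bundle hyperplane_metric d j p k l $$ (0, 0)) \<cdot>\<^sub>m
        1\<^sub>m (vrank twisted_cotangent))"
    unfolding plane_simps twisted_cotangent_simps pm
  proof (rule griffiths_perp_matrix[where D = "\<lambda>k a. D i k a x", OF _ _ _ t])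
    fix k l :: nat assume kl: "k < 2" "l < 2"
    show "curvature_at twisted_cotangent perp_metric d i p k l \<in> carrier_mat 2 2"
      by (simp add: curvature_at_def chern_curvature_def)
    show "curvature_at twisted_cotangent perp_metric d i p k l $$ (a, b) =
        (if a = b then 2 else 0) * fs_coeff (u i x) (\<lambda>a. D i k a x) (\<lambda>a. D i l a x) -
        D i k b x * (cnj (D i l a x) * sqn (u i x) - cnj (u i x a) * (\<Sum>e<2. u i x e * cnj (D i l e x))) /
          (sqn (u i x))\<^sup>2" if "a < 2" "b < 2" for a b
      unfolding curvature_at_def twisted_cotangent_simps xd
      by (rule curvature_perp_matrix[OF opS[of i] _ _ kl xS[OF p(2)] that mE]) (use uD DD ij in auto)
    have "curvature_at hyperplane_bundle hyperplane_metric d j p k l $$ (0, 0) =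
        fs_coeff (u j x) (\<lambda>a. D j k a x) (\<lambda>a. D j l a x)"
      unfolding curvature_at_def hyperplane_bundle_simps xd
      by (rule curvature_line_metric[OF opS[of j] _ _ kl xS[OF p(3)] mL]) (use uD DD ij in auto)
    then show "(of_real t * curvature_at hyperplane_bundle hyperplane_metric d j p k l $$ (0, 0)) \<cdot>\<^sub>m 1\<^sub>m 2 =
        (of_real t * fs_coeff (u i x) (\<lambda>a. D i k a x) (\<lambda>a. D i l a x)) \<cdot>\<^sub>m 1\<^sub>m 2"
      by (simp only: F[OF ij(1) p(2)] F[OF ij(2) p(3)])
  qed
qed


section \<open>Charts of a hypersurface and one complex variable\<close>

lemma cspace_pred:
  assumes "1 \<le> n"
  shows "x \<in> cspace (n - 1) \<longleftrightarrow> x \<in> cspace n \<and> x (n - 1) = 0"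
proof -
  have "x i = 0" if "\<forall>i\<ge>n. x i = 0" "x (n - 1) = 0" "n - 1 \<le> i" for i
    using that by (cases "i = n - 1") auto
  then show ?thesis
    by (auto simp: cspace_def)
qed

text \<open>
  The points of \<open>C\<^sup>n\<close> on which the last coordinate vanishes are those of \<open>C\<^sup>n\<^sup>-\<^sup>1\<close>.
\<close>

lemma hypersurface_chart:
  assumes n: "1 \<le> mdim M" and c: "c \<in> adapted_charts M Z"
  shows "is_chart (subtopology (mtop M) Z) (mdim M - 1) (fst c \<inter> Z, snd c)"
proof -
  let ?n = "mdim M"
  have chart: "is_chart (mtop M) ?n c" and Z: "\<And>p. p \<in> fst c \<Longrightarrow> p \<in> Z \<longleftrightarrow> snd c p (?n - 1) = 0"
    using c by (auto simp: adapted_charts_def holo_charts_def)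
  have img: "snd c ` (fst c \<inter> Z) = snd c ` fst c \<inter> cspace (?n - 1)"
  proof -
    have "p \<in> Z \<longleftrightarrow> snd c p \<in> cspace (?n - 1)" if "p \<in> fst c" for p
      using cspace_pred[OF n] Z[OF that] is_chart_cspace[OF chart that] by blast
    then show ?thesis by blast
  qed
  obtain U where U: "open U" "snd c ` fst c = cspace ?n \<inter> U"
    using chart by (auto simp: is_chart_def openin_open)
  have "cspace (?n - 1) \<subseteq> cspace ?n"
    using cspace_pred[OF n] by blast
  then have "snd c ` (fst c \<inter> Z) = cspace (?n - 1) \<inter> U"
    unfolding img U(2) by blast
  then have op: "openin (top_of_set (cspace (?n - 1))) (snd c ` (fst c \<inter> Z))"
    using U(1) by (auto simp: openin_open)
  have sub: "fst c \<subseteq> topspace (mtop M)"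
    using chart openin_subset by (auto simp: is_chart_def)
  have "homeomorphic_map (subtopology (subtopology (mtop M) (fst c)) Z)
      (subtopology (top_of_set (snd c ` fst c)) (snd c ` (fst c \<inter> Z))) (snd c)"
  proof (rule homeomorphic_map_subtopologies)
    show "homeomorphic_map (subtopology (mtop M) (fst c)) (top_of_set (snd c ` fst c)) (snd c)"
      using chart by (simp add: is_chart_def)
  qed (use sub in auto)
  then have "homeomorphic_map (subtopology (mtop M) (fst c \<inter> Z)) (top_of_set (snd c ` (fst c \<inter> Z))) (snd c)"
    by (simp add: subtopology_subtopology Int_absorb1 image_mono)
  moreover have "subtopology (subtopology (mtop M) Z) (fst c \<inter> Z) = subtopology (mtop M) (fst c \<inter> Z)"
    by (simp add: subtopology_subtopology Int_absorb1)
  moreover have "openin (subtopology (mtop M) Z) (fst c \<inter> Z)"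
    using chart by (auto simp: is_chart_def openin_subtopology_Int)
  ultimately show ?thesis
    using op by (simp add: is_chart_def)
qed

definition point1 :: "complex \<Rightarrow> nat \<Rightarrow> complex" where
  "point1 z = (\<lambda>k. if k = 0 then z else 0)"

lemma point1_0 [simp]: "point1 z 0 = z"
  by (simp add: point1_def)

lemma cspace_1_point1: "y \<in> cspace 1 \<Longrightarrow> y = point1 (y 0)"
  by (auto simp: cspace_def point1_def fun_eq_iff)

lemma cspace_1_upd: "y \<in> cspace 1 \<Longrightarrow> y(0 := z) = point1 z"
  by (auto simp: cspace_def point1_def fun_eq_iff)

lemma point1_cspace: "point1 z \<in> cspace 1"
  by (simp add: cspace_def point1_def)

lemma open_point1:
  assumes S: "openin (top_of_set (cspace 1)) S"
  shows "open {z. point1 z \<in> S}"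
proof (cases "S = {}")
  case False
  then obtain x where "x \<in> S" "x \<in> cspace 1"
    using openin_subset[OF S] by auto
  then show ?thesis
    using open_coordinate_line[OF S, of x 0] by (simp add: cspace_1_upd)
qed simp

lemma cpartial_point1:
  assumes "y \<in> cspace 1"
  shows "cpartial 0 f y = deriv (\<lambda>z. f (point1 z)) (y 0)"
  unfolding cpartial_def by (simp only: cspace_1_upd[OF assms])

lemma holo_on_1_differentiable:
  assumes f: "holo_on 1 S f" and y: "y \<in> S" "y \<in> cspace 1"
  shows "(\<lambda>z. f (point1 z)) field_differentiable (at (y 0))"
proof -
  have "(\<lambda>z. f (y(0 := z))) field_differentiable (at (y 0))"
    using f y(1) by (auto simp: holo_on_def)
  then show ?thesis
    by (simp only: cspace_1_upd[OF y(2)])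
qed

lemma holo_on_1_holomorphic:
  assumes S: "openin (top_of_set (cspace 1)) S" and f: "holo_on 1 S f"
  shows "(\<lambda>z. f (point1 z)) holomorphic_on {z. point1 z \<in> S}"
  unfolding holomorphic_on_def
proof
  fix z assume "z \<in> {z. point1 z \<in> S}"
  then show "(\<lambda>z. f (point1 z)) field_differentiable (at z within {z. point1 z \<in> S})"
    using holo_on_1_differentiable[OF f, of "point1 z"] point1_cspace
    by (auto intro: field_differentiable_at_within)
qed

lemma holo_on_compose:
  assumes f: "holo_on n S f" and G: "G holomorphic_on U" "open U" and sub: "\<And>x. x \<in> S \<Longrightarrow> f x \<in> U"
  shows "holo_on n S (\<lambda>x. G (f x))"
  unfolding holo_on_def
proof (intro conjI ballI allI impI)
  show "continuous_on S (\<lambda>x. G (f x))"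
    by (rule continuous_on_compose2[OF holomorphic_on_imp_continuous_on[OF G(1)]])
      (use f sub in \<open>auto simp: holo_on_def\<close>)
  fix x i assume x: "x \<in> S" and i: "i < n"
  have "(\<lambda>z. f (x(i := z))) field_differentiable (at (x i))"
    using f x i by (simp add: holo_on_def)
  moreover have "G field_differentiable (at (f (x(i := x i))))"
    using G sub[OF x] by (simp add: holomorphic_on_imp_differentiable_at)
  ultimately have "(G \<circ> (\<lambda>z. f (x(i := z)))) field_differentiable (at (x i))"
    by (rule field_differentiable_compose)
  then show "(\<lambda>z. G (f (x(i := z)))) field_differentiable (at (x i))"
    by (simp add: o_def)
qed

text \<open>
  A relation, and not only the value of \<^const>\<open>cpartial\<close>, since the chain rule needs the existence of the
  derivatives.
\<close>

definition has_chart_deriv :: "'p chart \<Rightarrow> ('p \<Rightarrow> complex) \<Rightarrow> complex \<Rightarrow> 'p \<Rightarrow> bool" where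
  "has_chart_deriv a g m p \<longleftrightarrow>
     ((\<lambda>z. in_chart a g (point1 z)) has_field_derivative m) (at (snd a p 0))"

lemma has_chart_deriv_cpartial:
  assumes "is_chart X 1 a" "p \<in> fst a" "has_chart_deriv a g m p"
  shows "cpartial 0 (in_chart a g) (snd a p) = m"
  using assms DERIV_imp_deriv
  by (auto simp: cpartial_point1[OF is_chart_cspace[OF assms(1,2)]] has_chart_deriv_def)

lemma eventually_in_chart:
  assumes a: "is_chart X 1 a" and W: "openin X W" and p: "p \<in> fst a \<inter> W"
  shows "\<forall>\<^sub>F z in nhds (snd a p 0). \<exists>q\<in>fst a \<inter> W. point1 z = snd a q"
proof -
  have "open {z. point1 z \<in> snd a ` (fst a \<inter> W)}"
    by (rule open_point1[OF is_chart_image_open[OF a W]])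
  moreover have "snd a p 0 \<in> {z. point1 z \<in> snd a ` (fst a \<inter> W)}"
    using p cspace_1_point1[OF is_chart_cspace[OF a, of p]] by auto
  ultimately show ?thesis
    by (auto intro!: eventually_nhds_in_open elim: eventually_mono[rotated]
        simp: eventually_nhds)
qed

lemma has_chart_deriv_cong:
  assumes a: "is_chart X 1 a" and W: "openin X W" and p: "p \<in> fst a \<inter> W"
    and eq: "\<And>q. q \<in> fst a \<inter> W \<Longrightarrow> g q = h q" and g: "has_chart_deriv a g m p"
  shows "has_chart_deriv a h m p"
proof -
  have "\<forall>\<^sub>F z in nhds (snd a p 0). in_chart a g (point1 z) = in_chart a h (point1 z)"
    using eventually_in_chart[OF a W p]
    by eventually_elim (auto simp: in_chart_apply[OF a] eq)
  then show ?thesis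
    using g unfolding has_chart_deriv_def by (subst (asm) DERIV_cong_ev[OF refl _ refl])
qed

lemma chart_chain_rule:
  assumes a: "is_chart X 1 a" and b: "is_chart X 1 b" and p: "p \<in> fst a \<inter> fst b"
    and m: "has_chart_deriv a (\<lambda>q. snd b q 0) m p" and g: "has_chart_deriv b g e p"
  shows "has_chart_deriv a g (e * m) p"
proof -
  let ?t = "\<lambda>z. in_chart a (\<lambda>q. snd b q 0) (point1 z)"
  have W: "openin X (fst b)"
    using b by (simp add: is_chart_def)
  have "?t (snd a p 0) = snd b p 0"
    using p by (simp add: cspace_1_point1[OF is_chart_cspace[OF a], symmetric] in_chart_apply[OF a])
  then have "((\<lambda>z. in_chart b g (point1 z)) has_field_derivative e) (at (?t (snd a p 0)))"
    using g by (simp add: has_chart_deriv_def)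
  from DERIV_chain2[OF this m[unfolded has_chart_deriv_def]]
  have "((\<lambda>z. in_chart b g (point1 (?t z))) has_field_derivative e * m) (at (snd a p 0))" .
  moreover have "\<forall>\<^sub>F z in nhds (snd a p 0). in_chart b g (point1 (?t z)) = in_chart a g (point1 z)"
    using eventually_in_chart[OF a W p]
    by eventually_elim
      (auto simp: in_chart_apply[OF a] in_chart_apply[OF b] cspace_1_point1[OF is_chart_cspace[OF b], symmetric])
  ultimately show ?thesis
    unfolding has_chart_deriv_def by (subst (asm) DERIV_cong_ev[OF refl _ refl])
qed

lemma compatible_has_chart_deriv:
  assumes a: "is_chart X 1 a" and ab: "compatible 1 a b" and p: "p \<in> fst a \<inter> fst b"
  shows "\<exists>m. has_chart_deriv a (\<lambda>q. snd b q 0) m p"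
proof -
  have "holo_on 1 (snd a ` (fst a \<inter> fst b)) (in_chart a (\<lambda>q. snd b q 0))"
    using ab by (simp add: compatible_def)
  from holo_on_1_differentiable[OF this, of "snd a p"] show ?thesis
    using p is_chart_cspace[OF a] by (auto simp: has_chart_deriv_def field_differentiable_def)
qed


section \<open>A line in the plane\<close>

definition line :: "(nat \<Rightarrow> complex) set" where
  "line = P2 - patch 2"

lemma ratio_eq_0_iff:
  assumes p: "p \<in> patch i" and i: "i < 3" and a: "a < 3"
  shows "ratio a i p = 0 \<longleftrightarrow> p \<notin> patch a"
proof -
  obtain Z where "Z \<in> homogeneous" "p = proj Z" "Z i \<noteq> 0"
    using patch_cases[OF p i] .
  then show ?thesis
    using i a by (simp add: ratio_proj proj_in_patch)
qed

lemma line_patch: "p \<in> line \<Longrightarrow> i < 3 \<Longrightarrow> p \<in> patch i \<Longrightarrow> i < 2"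
  by (cases "i = 2") (auto simp: line_def)

lemma line_cases:
  assumes "p \<in> line"
  obtains i where "i < 2" "p \<in> patch i"
proof -
  obtain i where "i < 3" "p \<in> patch i"
    using assms by (auto simp: line_def P2_eq_patches)
  then show ?thesis
    using that line_patch[OF assms] by blast
qed

lemma skip_1: "i < 2 \<Longrightarrow> skip i 1 = 2"
  by (simp add: skip_def)

lemma skip_0: "i < 2 \<Longrightarrow> skip i 0 = 1 - i"
  by (auto simp: skip_def)

lemma adapted_affine_chart:
  assumes "i < 2"
  shows "affine_chart i \<in> adapted_charts plane line"
proof -
  have "affine_chart i \<in> holo_charts plane"
    using atlas_subset_holo_charts[OF complex_manifold_plane] assms by auto
  moreover have "p \<in> line \<longleftrightarrow> affine_coords i p 1 = 0" if "p \<in> patch i" for p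
    using assms ratio_eq_0_iff[OF that, of 2] that patch_subset
    by (auto simp: line_def affine_coords_def skip_1[OF assms, simplified])
  ultimately show ?thesis
    by (simp add: adapted_charts_def) (simp add: affine_chart_def)
qed

lemma compact_hypersurface_line: "compact_hypersurface plane line"
  unfolding compact_hypersurface_def
proof (intro conjI ballI)
  have "closed {p :: nat \<Rightarrow> complex. p (3 * 2 + 2) = 0}"
    by (intro closed_Collect_eq continuous_on_coord continuous_on_const)
  then have "compact (P2 \<inter> {p. p (3 * 2 + 2) = 0})"
    by (rule compact_Int_closed[OF compact_P2])
  moreover have "P2 \<inter> {p. p (3 * 2 + 2) = 0} = line"
    by (auto simp: line_def patch_def)
  ultimately have "compact line"
    by simp
  moreover have "line \<subseteq> P2"
    by (auto simp: line_def)
  ultimately show "compactin (mtop plane) line"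
    by (simp add: compactin_subtopology)
  fix p assume "p \<in> line"
  then obtain i where "i < 2" "p \<in> patch i" by (rule line_cases)
  then show "\<exists>c\<in>adapted_charts plane line. p \<in> fst c"
    using adapted_affine_chart by (intro bexI[of _ "affine_chart i"]) (auto simp: affine_chart_def)
qed simp

lemma local_equation_line:
  assumes j: "j < 3"
  shows "local_equation plane line (patch j) (ratio 2 j)"
  unfolding local_equation_def
proof (intro conjI ballI)
  show "holo_fun plane (patch j) (ratio 2 j)"
    using j by (intro holo_fun_ratio openin_patch) auto
  show "ratio 2 j p = 0 \<longleftrightarrow> p \<in> line" if "p \<in> patch j" for p
    using ratio_eq_0_iff[OF that j, of 2] that patch_subset by (auto simp: line_def)
  fix p assume p: "p \<in> line \<inter> patch j"
  then have j2: "j < 2"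
    using line_patch j by blast
  have "\<exists>V u. openin (mtop plane) V \<and> p \<in> V \<and> V \<subseteq> fst (affine_chart j) \<inter> patch j \<and> holo_fun plane V u \<and>
      (\<forall>q\<in>V. u q \<noteq> 0 \<and> ratio 2 j q = u q * snd (affine_chart j) q (mdim plane - 1))"
    using p skip_1[OF j2]
    by (intro exI[of _ "patch j"] exI[of _ "\<lambda>q. 1"])
      (auto simp: openin_patch holo_fun_const affine_chart_def affine_coords_def)
  then show "\<exists>c\<in>adapted_charts plane line. \<exists>V u. openin (mtop plane) V \<and> p \<in> V \<and> V \<subseteq> fst c \<inter> patch j \<and>
      holo_fun plane V u \<and> (\<forall>q\<in>V. u q \<noteq> 0 \<and> ratio 2 j q = u q * snd c q (mdim plane - 1))"
    by (rule bexI[OF _ adapted_affine_chart[OF j2]])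
qed

lemma hyperplane_bundle_line: "line_bundle_of_divisor plane line hyperplane_bundle"
  unfolding line_bundle_of_divisor_def
proof (intro conjI exI[of _ "ratio 2"] ballI)
  fix j k p assume jk: "j \<in> vidx hyperplane_bundle" "k \<in> vidx hyperplane_bundle"
    and p: "p \<in> vcov hyperplane_bundle j \<inter> vcov hyperplane_bundle k - line"
  then have "ratio 2 k p \<noteq> 0"
    using ratio_eq_0_iff[of p k 2] patch_subset by (auto simp: line_def)
  then show "vtrans hyperplane_bundle j k p $$ (0, 0) = ratio 2 j p / ratio 2 k p"
    using ratio_mult[of p k j 2] jk p by (simp add: field_simps)
qed (simp_all add: holomorphic_hyperplane_bundle local_equation_line)

definition line_section :: "nat \<Rightarrow> (nat \<Rightarrow> complex) \<Rightarrow> complex vec" where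
  "line_section j p = vec 1 (\<lambda>_. ratio 2 j p)"

lemma line_section_holomorphic: "line_section \<in> holo_sections plane hyperplane_bundle"
  unfolding holo_sections_def
proof (intro CollectI conjI ballI allI impI)
  fix i a assume "i \<in> vidx hyperplane_bundle" "a < vrank hyperplane_bundle"
  then show "holo_fun plane (vcov hyperplane_bundle i) (\<lambda>p. line_section i p $ a)"
    using holo_fun_ratio[OF openin_patch, of i i 2] by (simp add: line_section_def)
next
  fix i j p assume ij: "i \<in> vidx hyperplane_bundle" "j \<in> vidx hyperplane_bundle"
    and p: "p \<in> vcov hyperplane_bundle i \<inter> vcov hyperplane_bundle j"
  have "ratio 2 i p = ratio j i p * ratio 2 j p"
    using ratio_mult[of p j i 2] ij p by (simp add: mult.commute)
  then show "line_section i p = vtrans hyperplane_bundle i j p *\<^sub>v line_section j p"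
    by (auto simp: line_section_def scalar_prod_def)
qed (simp add: line_section_def)

lemma line_section_cuts_out: "cuts_out plane hyperplane_bundle line_section line"
  using local_equation_line by (simp add: cuts_out_def line_section_def)

text \<open>
  The squared norm of the section is \<open>|Z\<^sub>2|\<^sup>2 / |Z|\<^sup>2\<close>.
\<close>

lemma line_section_norm:
  assumes j: "j < 3" and p: "p \<in> patch j"
  shows "Re (herm (hyperplane_metric j p) (line_section j p) (line_section j p)) \<le> 1"
proof -
  define N where "N = (\<Sum>a<3. (cmod (ratio a j p))\<^sup>2)"
  have "sqn (affine_coords j p) = cinner (\<lambda>a. ratio a j p) (\<lambda>a. ratio a j p)"
    unfolding cinner_lift[OF j, symmetric] by (rule cinner_cong) (simp_all add: lift_affine_coords j p)
  then have "sqn (affine_coords j p) = of_real N"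
    by (simp only: cinner_self N_def)
  moreover have "herm (hyperplane_metric j p) (line_section j p) (line_section j p) =
      1 / sqn (affine_coords j p) * line_section j p $ 0 * cnj (line_section j p $ 0)"
    unfolding hyperplane_metric_def by (rule herm_rank_one) (simp_all add: line_section_def)
  ultimately have "herm (hyperplane_metric j p) (line_section j p) (line_section j p) =
      of_real ((cmod (ratio 2 j p))\<^sup>2 / N)"
    by (simp add: line_section_def complex_norm_square[symmetric] del: of_real_power)
  moreover have "(cmod (ratio 2 j p))\<^sup>2 \<le> N"
    unfolding N_def by (rule member_le_sum) auto
  moreover from this have "0 \<le> N"
    by (rule order_trans[rotated]) simp
  ultimately show ?thesis
    by (simp add: divide_le_eq_1) linarith
qed


section \<open>A section over the line\<close>

abbreviation line_manifold :: "(nat \<Rightarrow> complex) cmanifold" where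
  "line_manifold \<equiv> hypersurface plane line"

abbreviation line_chart :: "nat \<Rightarrow> (nat \<Rightarrow> complex) chart" where
  "line_chart i \<equiv> (patch i \<inter> line, affine_coords i)"

lemma line_manifold_simps:
  "mtop line_manifold = top_of_set line" "mdim line_manifold = 1"
  "atlas line_manifold = (\<lambda>c. (fst c \<inter> line, snd c)) ` adapted_charts plane line"
proof -
  have "line \<subseteq> P2" by (auto simp: line_def)
  then show "mtop line_manifold = top_of_set line"
    by (simp add: hypersurface_def subtopology_subtopology Int_absorb1)
qed (simp_all add: hypersurface_def)

lemma line_atlas_chart: "c \<in> atlas line_manifold \<Longrightarrow> is_chart (top_of_set line) 1 c"
proof -
  have "subtopology (top_of_set P2) line = top_of_set line"
    using line_manifold_simps(1) by (simp add: hypersurface_def)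
  then show "c \<in> atlas line_manifold \<Longrightarrow> is_chart (top_of_set line) 1 c"
    using hypersurface_chart[of plane _ line] by (auto simp: line_manifold_simps)
qed

lemma line_chart_atlas:
  assumes "i < 2"
  shows "line_chart i \<in> atlas line_manifold"
  unfolding line_manifold_simps
  using adapted_affine_chart[OF assms] by (intro image_eqI[of _ _ "affine_chart i"]) (simp_all add: affine_chart_def)

lemma line_holo_charts:
  assumes "c \<in> holo_charts line_manifold"
  shows "is_chart (top_of_set line) 1 c"
    and "\<And>d. d \<in> atlas line_manifold \<Longrightarrow> compatible 1 c d \<and> compatible 1 d c"
  using assms by (auto simp: holo_charts_def line_manifold_simps)

lemma line_coord_deriv:
  assumes c: "c \<in> holo_charts line_manifold" and i: "i < 2" and p: "p \<in> fst c \<inter> patch i \<inter> line"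
  shows "\<exists>m. has_chart_deriv c (\<lambda>q. affine_coords i q 0) m p"
  using compatible_has_chart_deriv[of _ c "line_chart i"] line_holo_charts[OF c] line_chart_atlas[OF i] p
  by auto

text \<open>
  Both charts belong to the maximal atlas and are compatible with the charts of the atlas only; the
  transition between them factors through an affine chart of the line near the point.
\<close>

lemma line_transition_deriv:
  assumes c: "c \<in> holo_charts line_manifold" and d: "d \<in> holo_charts line_manifold"
    and p: "p \<in> fst c \<inter> fst d"
  shows "\<exists>m. has_chart_deriv c (\<lambda>q. snd d q 0) m p"
proof -
  have "p \<in> line"
    using line_holo_charts(1)[OF c] p openin_subset by (fastforce simp: is_chart_def)
  then obtain i where i: "i < 2" "p \<in> patch i" by (rule line_cases)
  note s = line_chart_atlas[OF i(1)]
  have ps: "p \<in> fst (line_chart i)"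
    using i \<open>p \<in> line\<close> by simp
  obtain m where m: "has_chart_deriv c (\<lambda>q. snd (line_chart i) q 0) m p"
    using compatible_has_chart_deriv[OF line_holo_charts(1)[OF c], of "line_chart i" p]
      line_holo_charts(2)[OF c s] ps p by auto
  obtain e where e: "has_chart_deriv (line_chart i) (\<lambda>q. snd d q 0) e p"
    using compatible_has_chart_deriv[OF line_atlas_chart[OF s], of d p] line_holo_charts(2)[OF d s] ps p
    by auto
  show ?thesis
    using chart_chain_rule[OF line_holo_charts(1)[OF c] line_atlas_chart[OF s] _ m e] ps p by blast
qed

lemma affine_coords_0: "i < 2 \<Longrightarrow> affine_coords i p 0 = ratio (1 - i) i p"
  by (simp add: affine_coords_def skip_0)

text \<open>
  The affine coordinates of the line in the patches \<open>0\<close> and \<open>1\<close> are inverse to each other.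
\<close>

lemma line_coord_deriv_swap:
  assumes d: "d \<in> holo_charts line_manifold" and ij: "i < 2" "j < 2" "i \<noteq> j"
    and p: "p \<in> fst d \<inter> (patch i \<inter> patch j) \<inter> line"
    and e: "has_chart_deriv d (\<lambda>q. affine_coords j q 0) e p"
  shows "has_chart_deriv d (\<lambda>q. affine_coords i q 0) (- e / (ratio i j p)\<^sup>2) p"
proof -
  note chart = line_holo_charts(1)[OF d]
  have ji: "1 - j = i" "1 - i = j"
    using ij by auto
  have W: "openin (top_of_set line) (patch i \<inter> patch j \<inter> line)"
  proof -
    have "openin (subtopology (top_of_set P2) line) (line \<inter> (patch i \<inter> patch j))"
      using openin_patch_Int by (rule openin_subtopology_Int2)
    moreover have "subtopology (top_of_set P2) line = top_of_set line"
      using line_manifold_simps(1) by (simp add: hypersurface_def)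
    ultimately show ?thesis
      by (simp add: Int_commute)
  qed
  have r: "in_chart d (\<lambda>q. affine_coords j q 0) (point1 (snd d p 0)) = ratio i j p"
    using p ij ji by (simp add: cspace_1_point1[OF is_chart_cspace[OF chart], symmetric] in_chart_apply[OF chart]
        affine_coords_0)
  have nz: "ratio i j p \<noteq> 0"
    using p ij by (intro ratio_nonzero) auto
  have "((\<lambda>z. inverse (in_chart d (\<lambda>q. affine_coords j q 0) (point1 z))) has_field_derivative
      - (inverse (ratio i j p) * e * inverse (ratio i j p))) (at (snd d p 0))"
    using DERIV_inverse'[OF e[unfolded has_chart_deriv_def]] nz by (simp add: r)
  then have "has_chart_deriv d (\<lambda>q. inverse (affine_coords j q 0)) (- e / (ratio i j p)\<^sup>2) p"
    by (simp add: has_chart_deriv_def in_chart_def power2_eq_square divide_inverse mult_ac)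
  then show ?thesis
  proof (rule has_chart_deriv_cong[OF chart W, rotated 2])
    show "p \<in> fst d \<inter> (patch i \<inter> patch j \<inter> line)"
      using p by blast
    fix q assume "q \<in> fst d \<inter> (patch i \<inter> patch j \<inter> line)"
    then have "ratio i j q * ratio j i q = 1"
      using ratio_mult[of q j i i] ij by (simp add: ratio_self)
    then show "inverse (affine_coords j q 0) = affine_coords i q 0"
      using ij ji by (simp add: affine_coords_0 inverse_unique)
  qed
qed

text \<open>
  On the line, the constant vector \<open>(0, 0, 1)\<close> is orthogonal to \<open>Z\<close> because \<open>Z\<^sub>2 = 0\<close>, and so is a
  section of \<open>\<Omega>(1)\<close>. To become a section of \<open>K\<^sub>Z \<otimes> \<Omega>(3)\<close> it has to be multiplied by a one-form on
  the line with values in \<open>O(2)\<close>. This is \<open>Z\<^sub>0 dZ\<^sub>1 - Z\<^sub>1 dZ\<^sub>0\<close>, which equals \<open>Z\<^sub>0\<^sup>2 d(Z\<^sub>1 / Z\<^sub>0)\<close> and also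
  \<open>- Z\<^sub>1\<^sup>2 d(Z\<^sub>0 / Z\<^sub>1)\<close>, whence the sign. Over the patch \<open>2\<close> there are no points of the line.
\<close>

definition conormal_section :: "(nat \<Rightarrow> complex) chart \<times> nat \<Rightarrow> (nat \<Rightarrow> complex) \<Rightarrow> complex vec" where
  "conormal_section = (\<lambda>(c, i) p. vec 2 (\<lambda>a. if a = 1
     then (if i = 0 then 1 else - 1) * cpartial 0 (in_chart c (\<lambda>q. affine_coords i q 0)) (snd c p)
     else 0))"

abbreviation restricted_bundle :: "((nat \<Rightarrow> complex) chart \<times> nat, nat \<Rightarrow> complex) vbundle" where
  "restricted_bundle \<equiv> line_tensor (canonical_bundle line_manifold) (restrict_bundle line twisted_cotangent)"

lemma restricted_bundle_simps:
  "vrank restricted_bundle = 2" "vidx restricted_bundle = holo_charts line_manifold \<times> {..<3}"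
  "vcov restricted_bundle (c, i) = fst c \<inter> (patch i \<inter> line)"
  "vtrans restricted_bundle (c, i) (d, j) p = (det (jacobian 1 d c p)) \<cdot>\<^sub>m vtrans twisted_cotangent i j p"
  by (simp_all add: line_tensor_def canonical_bundle_def restrict_bundle_def line_manifold_simps del: twisted_cotangent_simps(4))

text \<open>
  In another chart \<open>d\<close> of the line, the function is the derivative of a holomorphic function of the
  coordinate of \<open>c\<close>, composed with the transition from \<open>d\<close> to \<open>c\<close>.
\<close>

lemma conormal_section_holomorphic_entry:
  assumes c: "c \<in> holo_charts line_manifold" and i: "i < 2"
  shows "holo_fun line_manifold (fst c \<inter> (patch i \<inter> line))
    (\<lambda>p. cpartial 0 (in_chart c (\<lambda>q. affine_coords i q 0)) (snd c p))"
  unfolding holo_fun_def line_manifold_simps(2)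
proof
  fix d assume d: "d \<in> atlas line_manifold"
  note chart_c = line_holo_charts(1)[OF c] and chart_d = line_atlas_chart[OF d]
  note chart_i = line_atlas_chart[OF line_chart_atlas[OF i]]
  define W where "W = fst c \<inter> (patch i \<inter> line)"
  have W: "openin (top_of_set line) W"
    using chart_c chart_i openin_Int[of _ "fst c" "patch i \<inter> line"] unfolding W_def
    by (simp add: is_chart_def)
  define U where "U = {z. point1 z \<in> snd c ` W}"
  have cW: "snd c ` (fst c \<inter> W) = snd c ` W"
    by (rule arg_cong[where f = "\<lambda>A. snd c ` A"]) (auto simp: W_def)
  have opW: "openin (top_of_set (cspace 1)) (snd c ` W)"
    using is_chart_image_open[OF chart_c W] unfolding cW .
  have U: "open U"
    unfolding U_def by (rule open_point1[OF opW])
  define H where "H z = in_chart c (\<lambda>q. affine_coords i q 0) (point1 z)" for z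
  have "compatible 1 c (line_chart i)"
    using line_holo_charts(2)[OF c line_chart_atlas[OF i]] by blast
  then have "holo_on 1 (snd c ` W) (in_chart c (\<lambda>q. affine_coords i q 0))"
    by (simp add: compatible_def W_def)
  then have "H holomorphic_on U"
    unfolding H_def U_def by (rule holo_on_1_holomorphic[OF opW])
  then have dH: "deriv H holomorphic_on U"
    using U by (rule holomorphic_deriv)
  have "compatible 1 d c"
    using line_holo_charts(2)[OF c d] by blast
  then have "holo_on 1 (snd d ` (fst d \<inter> fst c)) (in_chart d (\<lambda>q. snd c q 0))"
    by (simp add: compatible_def)
  then have t: "holo_on 1 (snd d ` (fst d \<inter> W)) (in_chart d (\<lambda>q. snd c q 0))"
    by (rule holo_on_subset) (auto simp: W_def)
  have "holo_on 1 (snd d ` (fst d \<inter> W)) (\<lambda>y. deriv H (in_chart d (\<lambda>q. snd c q 0) y))"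
  proof (rule holo_on_compose[OF t dH U])
    fix y assume "y \<in> snd d ` (fst d \<inter> W)"
    then obtain q where q: "q \<in> fst d" "q \<in> W" "y = snd d q" by blast
    then show "in_chart d (\<lambda>q. snd c q 0) y \<in> U"
      by (auto simp: in_chart_apply[OF chart_d] U_def W_def
          cspace_1_point1[OF is_chart_cspace[OF chart_c], symmetric])
  qed
  then have "holo_on 1 (snd d ` (fst d \<inter> W))
      (in_chart d (\<lambda>p. cpartial 0 (in_chart c (\<lambda>q. affine_coords i q 0)) (snd c p)))"
  proof (rule holo_on_cong[OF is_chart_image_open[OF chart_d W], rotated])
    fix y assume "y \<in> snd d ` (fst d \<inter> W)"
    then obtain q where q: "q \<in> fst d" "q \<in> fst c" "y = snd d q"
      by (auto simp: W_def)
    show "deriv H (in_chart d (\<lambda>q. snd c q 0) y) =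
        in_chart d (\<lambda>p. cpartial 0 (in_chart c (\<lambda>q. affine_coords i q 0)) (snd c p)) y"
      unfolding q(3) in_chart_apply[OF chart_d q(1)] cpartial_point1[OF is_chart_cspace[OF chart_c q(2)]] H_def ..
  qed
  then show "holo_on 1 (snd d ` (fst d \<inter> (fst c \<inter> (patch i \<inter> line))))
      (in_chart d (\<lambda>p. cpartial 0 (in_chart c (\<lambda>q. affine_coords i q 0)) (snd c p)))"
    by (simp only: W_def)
qed

text \<open>
  The vector \<open>(0, 0, 1)\<close> looks the same in both patches, up to the transition function of \<open>O(2)\<close>.
\<close>

lemma twisted_cotangent_mult_normal:
  assumes i: "i < 2" and j: "j < 2" and p: "p \<in> patch i \<inter> patch j \<inter> line" and a: "a < 2"
  shows "(vtrans twisted_cotangent i j p *\<^sub>v vec 2 (\<lambda>a. if a = 1 then k else 0)) $ a =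
    (if a = 1 then k / (ratio i j p)\<^sup>2 else 0)"
proof -
  have ij: "i < 3" "j < 3"
    using i j by simp_all
  let ?v = "vec 2 (\<lambda>a. if a = 1 then k else 0)"
  have r2: "ratio 2 j p = 0"
    using ratio_eq_0_iff[of p j 2] p j by (simp add: line_def)
  have "perp_lift j p (vec_index ?v) (skip i a) = (if a = 1 then k else 0)"
  proof (cases "a = 1")
    case True
    then show ?thesis
      using perp_lift_skip[of j p "vec_index ?v" 1] skip_1[OF i] skip_1[OF j] by simp
  next
    case False
    then have a0: "a = 0" using a by simp
    have "skip i a = j \<or> skip i a = skip j 0"
      using i j a0 by (auto simp: skip_0)
    then show ?thesis
    proof
      assume "skip i a = j"
      then show ?thesis
        using a0 skip_1[OF j] by (simp add: perp_lift_def sum_less_2 r2)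
    next
      assume "skip i a = skip j 0"
      then show ?thesis
        using a0 by (simp only: perp_lift_skip) simp
    qed
  qed
  then show ?thesis
    using twisted_cotangent_mult[OF ij _ a, of ?v p] by simp
qed

lemma smult_mat_mult_vec:
  fixes A :: "'a :: comm_semiring_0 mat"
  assumes "A \<in> carrier_mat r n" "v \<in> carrier_vec n"
  shows "(k \<cdot>\<^sub>m A) *\<^sub>v v = k \<cdot>\<^sub>v (A *\<^sub>v v)"
  using assms by (intro eq_vecI) (auto simp: scalar_prod_def sum_distrib_left mult_ac intro!: sum.cong)

text \<open>
  The chain rule produces the transition function of the canonical bundle, and passing from the
  affine coordinate of the patch \<open>j\<close> to that of \<open>i\<close> the one of \<open>O(2)\<close>, together with the sign built
  into the section.
\<close>

lemma conormal_section_holomorphic: "conormal_section \<in> holo_sections line_manifold restricted_bundle"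
  unfolding holo_sections_def
proof (intro CollectI conjI ballI allI impI)
  fix ci p
  show "conormal_section ci p \<in> carrier_vec (vrank restricted_bundle)"
    by (simp add: conormal_section_def restricted_bundle_simps split: prod.split)
next
  fix ci a assume ci: "ci \<in> vidx restricted_bundle" and a: "a < vrank restricted_bundle"
  then obtain c i where c: "ci = (c, i)" "c \<in> holo_charts line_manifold" "i < 3"
    by (auto simp: restricted_bundle_simps)
  show "holo_fun line_manifold (vcov restricted_bundle ci) (\<lambda>p. conormal_section ci p $ a)"
  proof (cases "i < 2 \<and> a = 1")
    case True
    then have "holo_fun line_manifold (fst c \<inter> (patch i \<inter> line)) (\<lambda>p. (if i = 0 then 1 else - 1) *
        cpartial 0 (in_chart c (\<lambda>q. affine_coords i q 0)) (snd c p))"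
      by (intro holo_fun_mult holo_fun_const conormal_section_holomorphic_entry c(2)) simp
    then show ?thesis
      using True by (simp add: c(1) restricted_bundle_simps conormal_section_def)
  next
    case False
    then have "i = 2 \<or> a = 0"
      using c(3) a by (auto simp: restricted_bundle_simps)
    then show ?thesis
    proof
      assume "i = 2"
      moreover have "vcov restricted_bundle ci = fst c \<inter> (patch i \<inter> line)"
        by (simp add: c(1) restricted_bundle_simps)
      ultimately have "vcov restricted_bundle ci = {}"
        by (auto simp: line_def)
      then show ?thesis
        by (simp add: holo_fun_def holo_on_def)
    next
      assume "a = 0"
      then show ?thesis
        by (simp add: conormal_section_def c(1) holo_fun_const)
    qed
  qed
next
  fix ci dj p assume "ci \<in> vidx restricted_bundle" "dj \<in> vidx restricted_bundle"
    and "p \<in> vcov restricted_bundle ci \<inter> vcov restricted_bundle dj"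
  then obtain c i d j where c: "ci = (c, i)" "c \<in> holo_charts line_manifold" "i < 3"
    and d: "dj = (d, j)" "d \<in> holo_charts line_manifold" "j < 3"
    and p: "p \<in> fst c" "p \<in> fst d" "p \<in> patch i" "p \<in> patch j" "p \<in> line"
    by (auto simp: restricted_bundle_simps)
  have ij: "i < 2" "j < 2"
    using line_patch[OF p(5)] c(3) d(3) p by blast+
  note chart = line_holo_charts(1)[OF c(2)] line_holo_charts(1)[OF d(2)]
  obtain m where m: "has_chart_deriv c (\<lambda>q. snd d q 0) m p"
    using line_transition_deriv[OF c(2) d(2)] p by blast
  obtain e where e: "has_chart_deriv d (\<lambda>q. affine_coords j q 0) e p"
    using line_coord_deriv[OF d(2) ij(2)] p by blast
  define \<epsilon> where "\<epsilon> = (if i = j then 1 else - 1 :: complex)"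
  have "has_chart_deriv d (\<lambda>q. affine_coords i q 0) (\<epsilon> * e / (ratio i j p)\<^sup>2) p"
  proof (cases "i = j")
    case True
    then show ?thesis using e p by (simp add: ratio_self \<epsilon>_def)
  next
    case False
    then show ?thesis using line_coord_deriv_swap[OF d(2) ij False _ e] p by (simp add: \<epsilon>_def)
  qed
  then have "has_chart_deriv c (\<lambda>q. affine_coords i q 0) (\<epsilon> * e / (ratio i j p)\<^sup>2 * m) p"
    using p by (intro chart_chain_rule[OF chart _ m]) auto
  then have ci: "cpartial 0 (in_chart c (\<lambda>q. affine_coords i q 0)) (snd c p) = \<epsilon> * e / (ratio i j p)\<^sup>2 * m"
    by (rule has_chart_deriv_cpartial[OF chart(1) p(1)])
  have dj: "cpartial 0 (in_chart d (\<lambda>q. affine_coords j q 0)) (snd d p) = e"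
    by (rule has_chart_deriv_cpartial[OF chart(2) p(2) e])
  have det: "det (jacobian 1 d c p) = m"
    using has_chart_deriv_cpartial[OF chart(1) p(1) m] det_single[OF jacobian_carrier[of 1 d c p]]
    by (simp add: jacobian_def)
  define k where "k = (if j = 0 then 1 else - 1) * e"
  have dj_section: "conormal_section dj p = vec 2 (\<lambda>a. if a = 1 then k else 0)"
    unfolding conormal_section_def d(1) prod.case dj k_def ..
  have sign: "(if i = 0 then 1 else - 1) * \<epsilon> = (if j = 0 then 1 else - 1 :: complex)"
    using ij by (auto simp: \<epsilon>_def)
  show "conormal_section ci p = vtrans restricted_bundle ci dj p *\<^sub>v conormal_section dj p"
  proof (rule eq_vecI)
    fix a assume "a < dim_vec (vtrans restricted_bundle ci dj p *\<^sub>v conormal_section dj p)"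
    then have a: "a < 2"
      by (simp add: c(1) d(1) restricted_bundle_simps)
    have "(vtrans restricted_bundle ci dj p *\<^sub>v conormal_section dj p) $ a =
        m * (vtrans twisted_cotangent i j p *\<^sub>v vec 2 (\<lambda>a. if a = 1 then k else 0)) $ a"
    proof -
      have "(m \<cdot>\<^sub>m vtrans twisted_cotangent i j p) *\<^sub>v conormal_section dj p =
          m \<cdot>\<^sub>v (vtrans twisted_cotangent i j p *\<^sub>v conormal_section dj p)"
        by (rule smult_mat_mult_vec[of _ 2 2]) (simp_all add: dj_section)
      then show ?thesis
        using a unfolding c(1) d(1) restricted_bundle_simps det by (simp add: d(1)[symmetric] dj_section)
    qed
    also have "\<dots> = m * (if a = 1 then k / (ratio i j p)\<^sup>2 else 0)"
      using twisted_cotangent_mult_normal[OF ij _ a] p by simp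
    also have "\<dots> = conormal_section ci p $ a"
      using a by (simp add: conormal_section_def c(1) ci k_def sign[symmetric])
    finally show "conormal_section ci p $ a = (vtrans restricted_bundle ci dj p *\<^sub>v conormal_section dj p) $ a" ..
  qed (simp add: conormal_section_def c(1) d(1) restricted_bundle_simps)
qed


section \<open>The section does not extend\<close>

lemma det_mat_2:
  fixes A :: "'a :: comm_ring_1 mat"
  assumes A: "A \<in> carrier_mat 2 2"
  shows "det A = A $$ (0, 0) * A $$ (1, 1) - A $$ (0, 1) * A $$ (1, 0)"
proof -
  have "mat_delete A i 0 \<in> carrier_mat 1 1" for i
    using A by (auto simp: mat_delete_def)
  then have "det (mat_delete A i 0) = mat_delete A i 0 $$ (0, 0)" for i
    by (rule det_single)
  then have "cofactor A i 0 = (- 1) ^ i * mat_delete A i 0 $$ (0, 0)" for i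
    by (simp add: cofactor_def)
  then have "cofactor A 0 0 = A $$ (1, 1)" "cofactor A 1 0 = - A $$ (0, 1)"
    using A by (simp_all add: mat_delete_def)
  then show ?thesis
    using laplace_expansion_column[OF A, of 0] by (simp add: sum_less_2)
qed

abbreviation extension_bundle ::
    "((nat \<Rightarrow> complex) chart \<times> nat \<times> nat, nat \<Rightarrow> complex) vbundle" where
  "extension_bundle \<equiv> line_tensor (canonical_bundle plane) (line_tensor hyperplane_bundle twisted_cotangent)"

lemma extension_bundle_simps:
  "vrank extension_bundle = 2" "vidx extension_bundle = holo_charts plane \<times> {..<3} \<times> {..<3}"
  "vcov extension_bundle (c, j, i) = fst c \<inter> (patch j \<inter> patch i)"
  "vtrans extension_bundle (c, j, i) (d, j', i') p =
    det (jacobian 2 d c p) \<cdot>\<^sub>m (ratio j' j p \<cdot>\<^sub>m vtrans twisted_cotangent i i' p)"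
  by (simp_all add: line_tensor_def canonical_bundle_def del: twisted_cotangent_simps(4))

lemma affine_chart_holo: "i < 3 \<Longrightarrow> affine_chart i \<in> holo_charts plane"
  using atlas_subset_holo_charts[OF complex_manifold_plane] by auto

lemma lift_pt: "lift 0 (pt (a, b)) 0 = 1" "lift 0 (pt (a, b)) (Suc 0) = a" "lift 0 (pt (a, b)) 2 = b"
  "lift 2 (pt (a, b)) 0 = a" "lift 2 (pt (a, b)) (Suc 0) = b" "lift 2 (pt (a, b)) 2 = 1"
  by (simp_all add: insert_at_def pt_def)

lemma pt_cspace: "pt ab \<in> cspace 2"
  by (auto simp: pt_def cspace_def split: prod.split)

text \<open>
  A section of \<open>K\<^sub>X \<otimes> L \<otimes> \<Omega>(3)\<close> is a section of \<open>\<Omega>(1)\<close>, that is, a vector \<open>\<xi>\<close> of functions with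
  \<open>\<Sum> Z\<^sub>a \<xi>\<^sub>a = 0\<close>. At \<open>[1 : 0 : w]\<close> this says that \<open>\<xi>\<^sub>2 = - \<xi>\<^sub>0 / w\<close>, where the patch \<open>0\<close> shows the entry
  \<open>\<xi>\<^sub>2\<close> and the patch \<open>2\<close> the entry \<open>\<xi>\<^sub>0\<close>. The Jacobian determinant is \<open>w\<^sup>3\<close>, since the canonical
  bundle is \<open>O(-3)\<close>.
\<close>

lemma extension_bundle_transition:
  assumes F: "F \<in> holo_sections plane extension_bundle" and w: "w \<noteq> 0"
  shows "F (affine_chart 0, 0, 0) (proj (lift 0 (pt (0, w)))) $ 1 =
    - (F (affine_chart 2, 2, 2) (proj (lift 2 (pt (1 / w, 0)))) $ 0) / w"
proof -
  let ?Z = "lift 0 (pt (0, w))" and ?Y = "lift 2 (pt (1 / w, 0))"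
  define p where "p = proj ?Z"
  have pY: "proj ?Y = p"
    unfolding p_def
  proof (rule proj_scale[of "1 / w"])
    show "?Y a = 1 / w * ?Z a" if "a < 3" for a
      using less_3_cases[OF that] w by (elim disjE) (simp_all add: lift_pt)
  qed (use w in simp)
  have hom: "?Z \<in> homogeneous"
    by (simp add: lift_homogeneous)
  have p: "p \<in> patch 0" "p \<in> patch 2"
    using w unfolding p_def by (simp_all add: proj_in_patch[OF hom] lift_pt)
  have r: "ratio 0 2 p = 1 / w" "ratio 2 0 p = w" "ratio 1 0 p = 0"
    unfolding p_def by (simp_all add: ratio_proj[OF hom] lift_pt)
  have cY: "affine_coords 2 p = pt (1 / w, 0)"
    unfolding pY[symmetric] by (rule affine_coords_lift) (simp_all add: pt_cspace)
  define J where "J = jacobian 2 (affine_chart 0) (affine_chart 2) p"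
  have J: "J $$ (a, b) = dratio ?Y (unit_coord (skip 2 b)) 0 (skip 0 a)" if "a < 2" "b < 2" for a b
    unfolding J_def using jacobian_affine[of 0 2 p a b] p that
    by (simp add: cY dratio_def insert_at_unit)
  have Jc: "J \<in> carrier_mat 2 2"
    unfolding J_def by (rule jacobian_carrier)
  have "det J = w ^ 3"
    using w unfolding det_mat_2[OF Jc]
    by (simp add: J dratio_def skip_def lift_pt numeral_2_eq_2[symmetric] power2_eq_square power3_eq_cube)
  define v where "v = F (affine_chart 0, 0, 0) p"
  have idx: "(affine_chart 0, 0, 0) \<in> vidx extension_bundle" "(affine_chart 2, 2, 2) \<in> vidx extension_bundle"
    by (simp_all add: extension_bundle_simps affine_chart_holo)
  have cov: "p \<in> vcov extension_bundle (affine_chart 0, 0, 0)" "p \<in> vcov extension_bundle (affine_chart 2, 2, 2)"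
    using p by (simp_all add: extension_bundle_simps affine_chart_def)
  have v: "v \<in> carrier_vec 2"
    using F idx(1) cov(1) unfolding holo_sections_def v_def by (auto simp: extension_bundle_simps)
  have "F (affine_chart 2, 2, 2) p = vtrans extension_bundle (affine_chart 2, 2, 2) (affine_chart 0, 0, 0) p *\<^sub>v v"
    using F idx cov unfolding holo_sections_def v_def by blast
  also have "\<dots> = (det J \<cdot>\<^sub>m (ratio 0 2 p \<cdot>\<^sub>m vtrans twisted_cotangent 2 0 p)) *\<^sub>v v"
    unfolding extension_bundle_simps J_def ..
  also have "\<dots> = det J \<cdot>\<^sub>v (ratio 0 2 p \<cdot>\<^sub>v (vtrans twisted_cotangent 2 0 p *\<^sub>v v))"
    using v by (simp add: smult_mat_mult_vec[of _ 2 2] del: smult_smult_assoc)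
  finally have "F (affine_chart 2, 2, 2) p $ 0 =
      det J * (ratio 0 2 p * (vtrans twisted_cotangent 2 0 p *\<^sub>v v) $ 0)"
    by simp
  also have "(vtrans twisted_cotangent 2 0 p *\<^sub>v v) $ 0 = perp_lift 0 p (vec_index v) (skip 2 0) / (ratio 2 0 p)\<^sup>2"
    by (rule twisted_cotangent_mult) (simp_all add: v)
  also have "perp_lift 0 p (vec_index v) (skip 2 0) = - (w * v $ 1)"
    using r by (simp add: perp_lift_def skip_def sum_less_2 numeral_2_eq_2)
  also have "det J * (ratio 0 2 p * (- (w * v $ 1) / (ratio 2 0 p)\<^sup>2)) = - w * v $ 1"
    using w by (simp add: \<open>det J = w ^ 3\<close> r power2_eq_square power3_eq_cube)
  finally show ?thesis
    using w by (simp add: pY v_def p_def)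
qed

lemma extension_bundle_section_differentiable:
  assumes F: "F \<in> holo_sections plane extension_bundle" and i: "i < 3" and a: "a < 2" and k: "k < 2" and x: "x \<in> cspace 2"
  shows "(\<lambda>z. F (affine_chart i, i, i) (proj (lift i (x(k := z)))) $ a) field_differentiable (at (x k))"
proof -
  have all: "\<forall>c\<in>vidx extension_bundle. \<forall>a<vrank extension_bundle.
      holo_fun plane (vcov extension_bundle c) (\<lambda>p. F c p $ a)"
    using F unfolding holo_sections_def by blast
  have "(affine_chart i, i, i) \<in> vidx extension_bundle"
    unfolding extension_bundle_simps using i affine_chart_holo[OF i] by simp
  from bspec[OF all this] have "holo_fun plane (vcov extension_bundle (affine_chart i, i, i))
      (\<lambda>p. F (affine_chart i, i, i) p $ a)"
    using a unfolding extension_bundle_simps(1) by blast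
  moreover have "vcov extension_bundle (affine_chart i, i, i) = patch i"
    unfolding extension_bundle_simps by (simp add: affine_chart_def)
  ultimately have "holo_fun plane (patch i) (\<lambda>p. F (affine_chart i, i, i) p $ a)"
    by (simp only:)
  then have "holo_on 2 (cspace 2) (in_chart (affine_chart i) (\<lambda>p. F (affine_chart i, i, i) p $ a))"
    using i by (auto simp: holo_fun_def affine_chart_def affine_coords_image_patch dest!: bspec[of _ _ i])
  then have "(\<lambda>z. in_chart (affine_chart i) (\<lambda>p. F (affine_chart i, i, i) p $ a) (x(k := z))) field_differentiable (at (x k))"
    using x k by (auto simp: holo_on_def)
  moreover have "x(k := z) \<in> cspace 2" for z
    using x k by (auto simp: cspace_def)
  ultimately show ?thesis
    by (simp add: in_affine_chart[OF i])
qed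

text \<open>
  On the line \<open>[1 : 0 : w]\<close>, \<open>\<xi>\<^sub>2\<close> is an entire function of \<open>w\<close>. As \<open>\<xi>\<^sub>0\<close> remains bounded at
  \<open>w = \<infinity>\<close>, the relation \<open>\<xi>\<^sub>2 = - \<xi>\<^sub>0 / w\<close> makes it tend to zero there.
\<close>

lemma extension_bundle_section_vanishes:
  assumes F: "F \<in> holo_sections plane extension_bundle"
  shows "F (affine_chart 0, 0, 0) (proj (lift 0 (pt (0, 0)))) $ 1 = 0"
proof -
  define a where "a w = F (affine_chart 0, 0, 0) (proj (lift 0 (pt (0, w)))) $ 1" for w
  define b where "b v = F (affine_chart 2, 2, 2) (proj (lift 2 (pt (v, 0)))) $ 0" for v
  have upd: "(pt (x, y))(1 := z) = pt (x, z)" "(pt (x, y))(0 := z) = pt (z, y)" for x y z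
    by (auto simp: pt_def fun_eq_iff)
  have "a field_differentiable (at w)" for w
    using extension_bundle_section_differentiable[OF F, of 0 1 1 "pt (0, w)"]
    unfolding upd a_def by (simp add: pt_cspace) (simp add: pt_def)
  then have "a holomorphic_on UNIV"
    by (auto simp: holomorphic_on_def field_differentiable_at_within)
  moreover have "(a \<longlongrightarrow> 0) at_infinity"
  proof -
    have "b field_differentiable (at 0)"
      using extension_bundle_section_differentiable[OF F, of 2 0 0 "pt (0, 0)"]
      unfolding upd b_def by (simp add: pt_cspace) (simp add: pt_def)
    then have "isCont b 0"
      by (rule field_differentiable_imp_continuous_at)
    then have "((\<lambda>w. b (inverse w)) \<longlongrightarrow> b 0) at_infinity"
      by (rule isCont_tendsto_compose) (rule tendsto_inverse_0)
    then have "((\<lambda>w. - (b (inverse w)) * inverse w) \<longlongrightarrow> - (b 0) * 0) at_infinity"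
      by (intro tendsto_mult tendsto_minus tendsto_inverse_0)
    then have "((\<lambda>w. - (b (inverse w)) * inverse w) \<longlongrightarrow> 0) at_infinity"
      by simp
    moreover have "\<forall>\<^sub>F w in at_infinity. - (b (inverse w)) * inverse w = a w"
      unfolding eventually_at_infinity
    proof (intro exI[of _ 1] allI impI)
      fix w :: complex assume "1 \<le> cmod w"
      then have "w \<noteq> 0" by auto
      from extension_bundle_transition[OF F this] show "- (b (inverse w)) * inverse w = a w"
        by (simp add: a_def b_def divide_inverse)
    qed
    ultimately show ?thesis
      by (rule Lim_transform_eventually)
  qed
  ultimately have "a 0 = 0"
    by (rule Liouville_weak)
  then show ?thesis
    by (simp add: a_def)
qed

text \<open>
  At \<open>[1 : 0 : 0]\<close>, where the line meets the one of the preceding lemma, an extension would have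
  \<open>\<xi>\<^sub>2 = 1\<close>: in the affine coordinates of the patch \<open>0\<close>, both \<open>T\<close> and the coordinate of the line have
  derivative one.
\<close>

lemma conormal_section_no_extension:
  assumes F: "F \<in> holo_sections plane extension_bundle"
  shows "\<not> is_restriction_over_dT plane line hyperplane_bundle line_section twisted_cotangent F conormal_section"
proof
  assume R: "is_restriction_over_dT plane line hyperplane_bundle line_section twisted_cotangent F conormal_section"
  define p where "p = proj (lift 0 (pt (0, 0)))"
  have hom: "lift 0 (pt (0, 0)) \<in> homogeneous"
    by (simp add: lift_homogeneous)
  have p: "p \<in> patch 0" "p \<in> line"
    unfolding p_def line_def by (simp_all add: proj_in_patch hom lift_pt P2_def)
  have cp: "affine_coords 0 p = pt (0, 0)"
    unfolding p_def by (rule affine_coords_lift) (simp_all add: pt_cspace)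
  have "F (affine_chart 0, 0, 0) p =
      cpartial (mdim plane - 1) (in_chart (affine_chart 0) (\<lambda>q. line_section 0 q $ 0)) (snd (affine_chart 0) p) \<cdot>\<^sub>v
      conormal_section ((fst (affine_chart 0) \<inter> line, snd (affine_chart 0)), 0) p"
    using R adapted_affine_chart[of 0] p unfolding is_restriction_over_dT_def by (simp add: affine_chart_def)
  then have *: "F (affine_chart 0, 0, 0) p =
      cpartial 1 (in_chart (affine_chart 0) (\<lambda>q. line_section 0 q $ 0)) (pt (0, 0)) \<cdot>\<^sub>v
      conormal_section (line_chart 0, 0) p"
    by (simp add: affine_chart_def cp)
  have "in_chart (affine_chart 0) (\<lambda>q. line_section 0 q $ 0) ((pt (0, 0))(1 := z)) = z" for z
  proof -
    have upd: "(pt (0, 0))(1 := z) = pt (0, z)"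
      by (auto simp: pt_def fun_eq_iff)
    show ?thesis
      unfolding upd by (simp add: in_affine_chart pt_cspace line_section_def ratio_proj lift_homogeneous lift_pt)
  qed
  then have dT: "cpartial 1 (in_chart (affine_chart 0) (\<lambda>q. line_section 0 q $ 0)) (pt (0, 0)) = 1"
    by (simp add: cpartial_def)
  have "in_chart (line_chart 0) (\<lambda>q. affine_coords 0 q 0) (point1 z) = z" for z
  proof -
    have x: "point1 z \<in> cspace 2"
      by (simp add: point1_def cspace_def)
    then have q: "affine_coords 0 (proj (lift 0 (point1 z))) = point1 z"
      by (simp add: affine_coords_lift)
    have "proj (lift 0 (point1 z)) \<in> patch 0 \<inter> line"
      by (simp add: line_def proj_in_patch lift_homogeneous P2_def) (simp add: insert_at_def point1_def)
    then show ?thesis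
      using in_chart_apply[OF line_atlas_chart[OF line_chart_atlas[of 0]], of "proj (lift 0 (point1 z))"
          "\<lambda>q. affine_coords 0 q 0"] q by simp
  qed
  moreover have "pt (0, 0) \<in> cspace 1"
    by (simp add: pt_def cspace_def)
  ultimately have "cpartial 0 (in_chart (line_chart 0) (\<lambda>q. affine_coords 0 q 0)) (affine_coords 0 p) = 1"
    by (simp add: cp cpartial_point1)
  then have "F (affine_chart 0, 0, 0) p $ 1 = 1"
    unfolding * dT by (simp add: conormal_section_def)
  then show False
    using extension_bundle_section_vanishes[OF F] by (simp add: p_def)
qed

theorem theorem1:
  shows "\<exists>(X :: (nat \<Rightarrow> complex) cmanifold) (Z :: (nat \<Rightarrow> complex) set)
           (L :: (nat, nat \<Rightarrow> complex) vbundle) T g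
           (E :: (nat, nat \<Rightarrow> complex) vbundle) h.
    compact_kaehler_manifold X \<and>
    compact_hypersurface X Z \<and>
    line_bundle_of_divisor X Z L \<and>
    T \<in> holo_sections X L \<and> cuts_out X L T Z \<and>
    hermitian_metric X L g \<and>
    holomorphic_vector_bundle X E \<and>
    hermitian_metric X E h \<and>
    (\<exists>\<delta>::real. 0 < \<delta> \<and>
       (\<forall>j\<in>vidx L. \<forall>p\<in>vcov L j. Re (herm (g j p) (T j p) (T j p)) \<le> 1) \<and>
       (\<forall>t\<in>{0..1}. griffiths_curvature_ge X E h (t * \<delta>) L g)) \<and>
    \<not> (\<forall>f\<in>holo_sections (hypersurface X Z)
              (line_tensor (canonical_bundle (hypersurface X Z)) (restrict_bundle Z E)).
         \<exists>F\<in>holo_sections X (line_tensor (canonical_bundle X) (line_tensor L E)).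
           is_restriction_over_dT X Z L T E F f)"
proof (rule exI[of _ plane], rule exI[of _ line], rule exI[of _ hyperplane_bundle], rule exI[of _ line_section],
    rule exI[of _ hyperplane_metric], rule exI[of _ twisted_cotangent], rule exI[of _ perp_metric],
    intro conjI)
  show "\<exists>\<delta>::real. 0 < \<delta> \<and>
      (\<forall>j\<in>vidx hyperplane_bundle. \<forall>p\<in>vcov hyperplane_bundle j.
        Re (herm (hyperplane_metric j p) (line_section j p) (line_section j p)) \<le> 1) \<and>
      (\<forall>t\<in>{0..1}. griffiths_curvature_ge plane twisted_cotangent perp_metric (t * \<delta>)
        hyperplane_bundle hyperplane_metric)"
    by (rule exI[of _ 1]) (simp add: line_section_norm griffiths_twisted_cotangent)
  show "\<not> (\<forall>f\<in>holo_sections line_manifold restricted_bundle.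
      \<exists>F\<in>holo_sections plane extension_bundle.
        is_restriction_over_dT plane line hyperplane_bundle line_section twisted_cotangent F f)"
  proof
    assume "\<forall>f\<in>holo_sections line_manifold restricted_bundle. \<exists>F\<in>holo_sections plane extension_bundle.
        is_restriction_over_dT plane line hyperplane_bundle line_section twisted_cotangent F f"
    from bspec[OF this conormal_section_holomorphic] obtain F where
      F: "F \<in> holo_sections plane extension_bundle"
        "is_restriction_over_dT plane line hyperplane_bundle line_section twisted_cotangent F conormal_section"
      by (elim bexE)
    show False
      using conormal_section_no_extension[OF F(1)] F(2) by (rule notE)
  qed
qed (rule compact_kaehler_plane compact_hypersurface_line hyperplane_bundle_line line_section_holomorphic
  line_section_cuts_out hermitian_hyperplane_metric holomorphic_twisted_cotangent hermitian_perp_metric)+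

end
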